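(* Let $b\ge1$ and $0<\alpha<1$. In the infinite Poisson model, the probability generating function of $U_\alpha$ is $$\psi_U(q)=\frac{T_0(b\alpha)}{1-q}\prod_{\ell=0}^{b-1}\bigl(1-\zeta_\ell(q)\bigr)$$ (for $q=1$ interpreted as the limit). Moreover, for the exact model, as $m,n\to\infty$ with $n/(bm)\to\alpha$, $U_{m,n}\to U_\alpha$ in distribution with convergence of all moments, and for some $\delta>0$ the probability generating function of $U_{m,n}$ converges to $\psi_U(q)$ uniformly for $|q|\le1+\delta$.
   Context: $T(z)=\sum_{n\ge1}n^{n-1}z^n/n!$, $\omega=e^{2\pi i/b}$; for $|q|\le(e^{\alpha-1}/\alpha)^b$, $\zeta_\ell(q)=T(\omega^\ell\alpha e^{-\alpha}q^{1/b})/\alpha$, $\ell=0,\dots,b-1$ (fixed choice of $q^{1/b}$; the product does not depend on it); $\zeta_\ell=\zeta_\ell(1)$ with $1^{1/b}=1$; $T_0(b\alpha)=b(1-\alpha)/\prod_{\ell=1}^{b-1}(1-\zeta_\ell)$. Infinite Poisson model: buckets $i\in\mathbb Z$ of capacity $b$, $X_i$ i.i.d. Poisson($\alpha b$), $H_i=b+\max_{j<i}\sum_{k=j+1}^i(X_k-b)$, bucket $i$ full iff $H_i\ge b$. $U_\alpha=U_0$ is the number of full buckets searched in an unsuccessful search starting at bucket $0$, i.e. $U_0=k-0$ where $k\ge0$ is the smallest index $\ge0$ of a non-full bucket. Exact model: $m$ cyclically arranged buckets of capacity $b$, $n<bm$ keys with independent uniform hash addresses placed by linear probing with wrap-around; $U_{m,n}$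 is the number of full buckets searched, starting from a given bucket, before reaching a non-full bucket. *)

theory Defs
  imports "HOL-Probability.Probability" "HOL-Complex_Analysis.Complex_Analysis"
begin

text \<open>
  The tree function $T(z) = \sum_{n \ge 1} n^{n-1} z^n / n!$, with the summation index shifted
  by one; the series converges exactly for $|z| \le 1/e$.
\<close>

definition tree_fun :: "complex \<Rightarrow> complex" where
  "tree_fun z = (\<Sum>n. of_nat (Suc n ^ n) / fact (Suc n) * z ^ Suc n)"

text \<open>
  For $q^{1/b}$ we fix the principal value (which gives $0^{1/b} = 0$ and $1^{1/b} = 1$).
  The condition $|q| \le$ \<open>zeta_radius b \<alpha>\<close> says that the argument of $T$ has modulus
  at most $1/e$.
\<close>

definition zeta_radius :: "nat \<Rightarrow> real \<Rightarrow> real" where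
  "zeta_radius b \<alpha> = (exp (\<alpha> - 1) / \<alpha>) ^ b"

definition zeta :: "nat \<Rightarrow> real \<Rightarrow> nat \<Rightarrow> complex \<Rightarrow> complex" where
  "zeta b \<alpha> l q =
     (let \<omega> = exp (2 * of_real pi * \<i> / of_nat b)
      in tree_fun (\<omega> ^ l * of_real (\<alpha> * exp (- \<alpha>)) * q powr (1 / of_nat b)) / of_real \<alpha>)"

text \<open>\<open>T0 b \<alpha>\<close> is $T_0(b\alpha)$.\<close>

definition T0 :: "nat \<Rightarrow> real \<Rightarrow> complex" where
  "T0 b \<alpha> = of_nat b * (1 - of_real \<alpha>) / (\<Prod>l\<in>{1..<b}. 1 - zeta b \<alpha> l 1)"

definition psi_formula :: "nat \<Rightarrow> real \<Rightarrow> complex \<Rightarrow> complex" where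
  "psi_formula b \<alpha> q = T0 b \<alpha> / (1 - q) * (\<Prod>l<b. 1 - zeta b \<alpha> l q)"

definition pgf :: "'w measure \<Rightarrow> ('w \<Rightarrow> nat) \<Rightarrow> complex \<Rightarrow> complex" where
  "pgf M U q = (\<integral>w. q ^ U w \<partial>M)"


section \<open>The infinite Poisson model\<close>

definition poisson_model :: "nat \<Rightarrow> real \<Rightarrow> 'w measure \<Rightarrow> (int \<Rightarrow> 'w \<Rightarrow> nat) \<Rightarrow> bool" where
  "poisson_model b \<alpha> M X \<longleftrightarrow>
     prob_space M \<and>
     prob_space.indep_vars M (\<lambda>_. count_space UNIV) X UNIV \<and>
     (\<forall>i. distr M (count_space UNIV) (X i) = measure_pmf (poisson_pmf (\<alpha> * real b)))"

text \<open>
  The maximum over $j < i$ is attained almost surely when $\alpha < 1$. It is written as a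
  supremum in the extended reals, so that $H_i = \infty$ on the exceptional null set.
\<close>

definition H :: "nat \<Rightarrow> (int \<Rightarrow> 'w \<Rightarrow> nat) \<Rightarrow> int \<Rightarrow> 'w \<Rightarrow> ereal" where
  "H b X i w =
     ereal (real b) + (SUP j\<in>{..<i}. ereal (\<Sum>k\<in>{j+1..i}. real (X k w) - real b))"

definition full_bucket :: "nat \<Rightarrow> (int \<Rightarrow> 'w \<Rightarrow> nat) \<Rightarrow> 'w \<Rightarrow> int \<Rightarrow> bool" where
  "full_bucket b X w i \<longleftrightarrow> H b X i w \<ge> ereal (real b)"

text \<open>The value is unspecified (but irrelevant) if all buckets $k \ge 0$ are full.\<close>

definition U_inf :: "nat \<Rightarrow> (int \<Rightarrow> 'w \<Rightarrow> nat) \<Rightarrow> 'w \<Rightarrow> nat" where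
  "U_inf b X w = (LEAST k. \<not> full_bucket b X w (int k))"


section \<open>The exact model\<close>

text \<open>
  The buckets are \<open>0, \<dots>, m - 1\<close>, the keys \<open>0, \<dots>, n - 1\<close>; \<open>h i\<close> is the hash address
  of key \<open>i\<close>, and \<open>c j\<close> the number of keys in bucket \<open>j\<close>. \<open>probes b m c s\<close> is the
  number of full buckets met, going round cyclically from bucket \<open>s\<close>, before the first
  non-full one; it is meaningful if some bucket is not full.
\<close>

definition probes :: "nat \<Rightarrow> nat \<Rightarrow> (nat \<Rightarrow> nat) \<Rightarrow> nat \<Rightarrow> nat" where
  "probes b m c s = (LEAST k. c ((s + k) mod m) < b)"

definition insert_key :: "nat \<Rightarrow> nat \<Rightarrow> nat \<Rightarrow> (nat \<Rightarrow> nat) \<Rightarrow> (nat \<Rightarrow> nat)" where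
  "insert_key b m a c = (let j = (a + probes b m c a) mod m in c(j := Suc (c j)))"

primrec occupancy :: "nat \<Rightarrow> nat \<Rightarrow> (nat \<Rightarrow> nat) \<Rightarrow> nat \<Rightarrow> (nat \<Rightarrow> nat)" where
  "occupancy b m h 0 = (\<lambda>_. 0)"
| "occupancy b m h (Suc n) = insert_key b m (h n) (occupancy b m h n)"

definition hash_pmf :: "nat \<Rightarrow> nat \<Rightarrow> (nat \<Rightarrow> nat) pmf" where
  "hash_pmf m n = Pi_pmf {..<n} 0 (\<lambda>_. pmf_of_set {..<m})"

definition U_exact :: "nat \<Rightarrow> nat \<Rightarrow> nat \<Rightarrow> nat \<Rightarrow> (nat \<Rightarrow> nat) \<Rightarrow> nat" where
  "U_exact b m n s h = probes b m (occupancy b m h n) s"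

end

(*
  In both models bucket i is full iff some window of l >= 1 consecutive buckets ending at i
  receives at least b l keys; for the exact model this follows from a flow invariant of linear
  probing. In the infinite model the non-full buckets are the strict descending ladder epochs of
  the random walk with steps X_k - b, so stationarity gives P(U = k) = p0 P(the walk started
  at 0 stays nonnegative for k steps). The generating function of the latter comes from the kernel
  method: z^b - q e^{alpha b (z-1)} has the roots zeta_l(q) in the unit disc, and
  z^b - q (overshoot polynomial) is a monic polynomial of degree b with the same roots; put z = 1.
  The formula is continued from |q| < 1 to the closed disc |q| <= zeta_radius in the variable
  y = q^{1/b}, and p0 = T_0 is read off from the derivative at y = 1.
  For the exact model, Chernoff bounds confine the event U = k to finitely many buckets up to a
  small error, where the multinomial hash counts converge to independent Poisson variables. The same
  bounds give tails decaying geometrically, uniformly in the size of the table, so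
  sum_k rho^k |P(U_{m,n} = k) - P(U = k)| -> 0 for some rho > 1, which yields all the limits.
*)
theory Submission
  imports Defs
begin

section \<open>Windows of hash counts\<close>

text \<open>Fullness is recast as a condition on natural-number counts, \<open>full\<close>, which
  both models share, so that attainment of the supremum in \<open>H\<close> never becomes an issue;
  the laws are then compared through point probabilities alone. The kernel argument needs b distinct
  roots, which fails at q = 0, and it leaves the factor p0 undetermined. Continuation in y fills in
  the missing point, makes y = 1 an interior point where derivatives can be compared, and requires
  no choice of a branch of q^(1/b). The Chernoff ratio e^(r(z-1)) / z^b is used with two tilts. For
  r = \<alpha> b and z = 1/\<alpha> it is minimal and equals 1 /
  \<open>zeta_radius b \<alpha>\<close>, so that plain union bounds already give convergence in the
  whole open disc; the boundary circle then follows from nonnegative coefficients and boundedness of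
  the product. In the exact model the load only tends to \<alpha>, so the ratio is taken at a larger
  load \<beta> < 1: this costs some radius but is uniform over large tables. For the tree function
  only the series is available: T(w e^(-w)) = w is checked on coefficients by vanishing finite
  differences and then turned into T e^(-T) = z by the identity theorem.\<close>

definition window :: "(int \<Rightarrow> nat) \<Rightarrow> int \<Rightarrow> nat \<Rightarrow> nat" where
  "window y i l = (\<Sum>t<l. y (i - int t))"

definition full :: "nat \<Rightarrow> (int \<Rightarrow> nat) \<Rightarrow> int \<Rightarrow> bool" where
  "full b y i \<longleftrightarrow> (\<exists>l\<ge>1. b * l \<le> window y i l)"

definition first_nonfull :: "nat \<Rightarrow> (int \<Rightarrow> nat) \<Rightarrow> nat" where
  "first_nonfull b y = (LEAST k. \<not> full b y (int k))"

lemma window_add: "window y i (l + l') = window y i l + window y (i - int l) l'"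
  unfolding window_def
  by (induction l') (auto simp: algebra_simps)

lemma window_Suc_right: "window y i (Suc l) = y i + window y (i - 1) l"
  using window_add[of y i 1 l] by (simp add: window_def)

lemma window_cong: "(\<And>t. t < l \<Longrightarrow> y (i - int t) = y' (i' - int t)) \<Longrightarrow> window y i l = window y' i' l"
  unfolding window_def by (intro sum.cong) auto

text \<open>Witness windows are glued. If the window witnessing that \<open>j\<close> is full is
  shorter than \<open>k\<close>, the bucket just before it is full too and brings a window of its
  own; the induction continues with the remaining run.\<close>

lemma full_run_window:
  assumes "k \<ge> 1" "\<And>i. i < k \<Longrightarrow> full b y (j - int i)"
  shows "\<exists>l\<ge>k. b * l \<le> window y j l"
  using assms
proof (induction k arbitrary: j rule: less_induct)
  case (less k j)
  have "full b y j"
    using less.prems(2)[of 0] less.prems(1) by simp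
  then obtain l where l: "l \<ge> 1" "b * l \<le> window y j l"
    by (auto simp: full_def)
  show ?case
  proof (cases "l \<ge> k")
    case False
    have "\<exists>l'\<ge>k - l. b * l' \<le> window y (j - int l) l'"
    proof (rule less.IH)
      show "full b y (j - int l - int i)" if "i < k - l" for i
        using less.prems(2)[of "l + i"] that by (simp add: algebra_simps)
    qed (use l False in auto)
    then obtain l' where "l' \<ge> k - l" "b * l' \<le> window y (j - int l) l'"
      by blast
    then show ?thesis
      using l window_add[of y j l l'] by (intro exI[of _ "l + l'"]) (auto simp: algebra_simps)
  qed (use l in auto)
qed

text \<open>A window reaching past the non-full bucket \<open>j - k\<close> can be cut there: the
  part beyond the run ends at a non-full bucket, holds fewer keys than its capacity, and so leaves
  at least \<open>b * k\<close> for the run itself.\<close>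

lemma full_run_window_after_nonfull:
  assumes "k \<ge> 1" "\<And>i. i < k \<Longrightarrow> full b y (j - int i)" "\<not> full b y (j - int k)"
  shows "b * k \<le> window y j k"
proof -
  obtain l where l: "l \<ge> k" "b * l \<le> window y j l"
    using full_run_window[of k b y j] assms by blast
  show ?thesis
  proof (cases "l = k")
    case False
    have "window y j l = window y j k + window y (j - int k) (l - k)"
      using window_add[of y j k "l - k"] l by simp
    moreover have "window y (j - int k) (l - k) < b * (l - k)"
      using assms(3) False l unfolding full_def by (metis One_nat_def Suc_leI diff_is_0_eq le_antisym not_gr_zero not_le)
    moreover have "b * l = b * k + b * (l - k)"
      using l by (simp flip: distrib_left)
    ultimately show ?thesis using l by linarith
  qed (use l in auto)
qed

text \<open>This is the regeneration property: to the right of a non-full bucket \<open>p\<close>,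
  fullness of a run is decided by the counts after \<open>p\<close> alone, so it will be independent
  of the event that \<open>p\<close> is non-full.\<close>

lemma full_run_after_nonfull_iff:
  assumes "\<not> full b y p"
  shows "(\<forall>i\<in>{1..k}. full b y (p + int i)) \<longleftrightarrow> (\<forall>i\<in>{1..k}. b * i \<le> window y (p + int i) i)"
proof
  assume L: "\<forall>i\<in>{1..k}. full b y (p + int i)"
  show "\<forall>i\<in>{1..k}. b * i \<le> window y (p + int i) i"
  proof
    fix i assume i: "i \<in> {1..k}"
    show "b * i \<le> window y (p + int i) i"
    proof (rule full_run_window_after_nonfull)
      show "full b y (p + int i - int j)" if "j < i" for j
      proof -
        have "i - j \<in> {1..k}" using i that by auto
        from L[rule_format, OF this] show ?thesis using that by (simp add: of_nat_diff algebra_simps)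
      qed
    qed (use i assms in auto)
  qed
qed (auto simp: full_def)

text \<open>The partial sums are integers, so their supremum is nonnegative iff one of them is. The
  equivalence holds at every sample point, also where the supremum is infinite.\<close>

lemma full_bucket_iff_full: "full_bucket b X w i \<longleftrightarrow> full b (\<lambda>i. X i w) i"
proof -
  define S where "S = (\<lambda>j. \<Sum>k\<in>{j+1..i}. real (X k w) - real b)"
  have S: "S (i - int l) = real (window (\<lambda>i. X i w) i l) - real (b * l)" for l
  proof -
    have "S (i - int l) = (\<Sum>t<l. real (X (i - int t) w) - real b)"
      unfolding S_def
      by (rule sum.reindex_bij_witness[of _ "\<lambda>t. i - int t" "\<lambda>k. nat (i - k)"]) auto
    then show ?thesis by (simp add: window_def sum_subtractf)
  qed
  have "full_bucket b X w i \<longleftrightarrow> (SUP j\<in>{..<i}. ereal (S j)) \<ge> 0"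
    unfolding full_bucket_def H_def S_def by (cases "SUP j\<in>{..<i}. ereal (S j)") (auto simp: S_def)
  also have "\<dots> \<longleftrightarrow> (\<exists>j<i. S j \<ge> 0)"
  proof
    assume "(SUP j\<in>{..<i}. ereal (S j)) \<ge> 0"
    \<comment> \<open>A supremum above -1/2 already yields a partial sum above -1/2, and an integer
      above -1/2 is nonnegative.\<close>
    moreover have "ereal (- 1/2) < 0" by simp
    ultimately have "ereal (- 1/2) < (SUP j\<in>{..<i}. ereal (S j))"
      by (rule order.strict_trans2[rotated])
    then obtain j where j: "j < i" "ereal (- 1/2) < ereal (S j)"
      by (auto simp: less_SUP_iff)
    obtain l where l: "j = i - int l"
      using j(1) by (metis diff_diff_eq2 add_diff_cancel_left' less_imp_le zero_le_imp_eq_int diff_ge_0_iff_ge)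
    have "- 1/2 < S j" using j(2) by simp
    then have "real (b * l) < real (window (\<lambda>i. X i w) i l) + 1" unfolding l S by linarith
    then have "real (b * l) < real (window (\<lambda>i. X i w) i l + 1)" by simp
    then have "b * l < window (\<lambda>i. X i w) i l + 1" by (simp only: of_nat_less_iff)
    then have "real (b * l) \<le> real (window (\<lambda>i. X i w) i l)" by (intro of_nat_mono) simp
    then have "S j \<ge> 0" unfolding l S by linarith
    with j show "\<exists>j<i. S j \<ge> 0" by blast
  next
    assume "\<exists>j<i. S j \<ge> 0"
    then obtain j where "j < i" "S j \<ge> 0" by blast
    then show "(SUP j\<in>{..<i}. ereal (S j)) \<ge> 0"
      by (intro SUP_upper2[of j]) auto
  qed
  also have "\<dots> \<longleftrightarrow> full b (\<lambda>i. X i w) i"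
  proof
    assume "\<exists>j<i. S j \<ge> 0"
    then obtain j where j: "j < i" "S j \<ge> 0" by blast
    obtain l where l: "j = i - int l"
      using j(1) by (metis diff_diff_eq2 add_diff_cancel_left' less_imp_le zero_le_imp_eq_int diff_ge_0_iff_ge)
    show "full b (\<lambda>i. X i w) i"
      unfolding full_def using j unfolding l S by (intro exI[of _ l]) (auto simp flip: of_nat_mult)
  next
    assume "full b (\<lambda>i. X i w) i"
    then obtain l where "l \<ge> 1" "b * l \<le> window (\<lambda>i. X i w) i l" by (auto simp: full_def)
    then show "\<exists>j<i. S j \<ge> 0"
      by (intro exI[of _ "i - int l"]) (auto simp: S simp flip: of_nat_mult)
  qed
  finally show ?thesis .
qed

lemma U_inf_eq_first_nonfull: "U_inf b X w = first_nonfull b (\<lambda>i. X i w)"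
  unfolding U_inf_def first_nonfull_def full_bucket_iff_full ..

section \<open>The exact model\<close>

lemma full_shift: "full b (\<lambda>i. y (c + i)) i \<longleftrightarrow> full b y (c + i)"
proof -
  have "window (\<lambda>i. y (c + i)) i l = window y (c + i) l" for l
    by (rule window_cong) (simp add: algebra_simps)
  then show ?thesis by (simp add: full_def)
qed

lemma first_nonfull_ge_iff:
  assumes "\<not> full b y (int k0)"
  shows "k \<le> first_nonfull b y \<longleftrightarrow> (\<forall>i<k. full b y (int i))"
  unfolding first_nonfull_def
  by (metis (mono_tags, lifting) LeastI assms leD linorder_not_less not_less_Least order_less_le_trans)

lemma first_nonfull_eq_iff:
  assumes "\<not> full b y (int k0)"
  shows "first_nonfull b y = k \<longleftrightarrow> (\<forall>i<k. full b y (int i)) \<and> \<not> full b y (int k)"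
  using first_nonfull_ge_iff[OF assms, of k] first_nonfull_ge_iff[OF assms, of "Suc k"]
  by (auto simp: less_Suc_eq le_Suc_eq Suc_le_eq)

text \<open>Going left from \<open>j\<close>, a copy of the non-full bucket \<open>p\<close> is met
  in less than one turn; the window is cut at the first non-full bucket met. Length below
  \<open>m\<close> matters later: such windows have distinct hash addresses, and only finitely many
  lengths enter the union bound.\<close>

lemma periodic_full_run_window:
  assumes m: "m > 0" and periodic: "\<And>i. y (i mod int m) = y i"
    and nonfull: "\<not> full b y p"
    and k: "k \<ge> 1" "\<And>i. i < k \<Longrightarrow> full b y (j - int i)"
  shows "\<exists>l. k \<le> l \<and> l < m \<and> b * l \<le> window y j l"
proof -
  have full_cong: "full b y i \<longleftrightarrow> full b y i'" if "i mod int m = i' mod int m" for i i'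
  proof -
    have "window y i l = window y i' l" for l
    proof (rule window_cong)
      fix t have "(i - int t) mod int m = (i' - int t) mod int m"
        using that by (metis mod_diff_left_eq)
      then show "y (i - int t) = y (i' - int t)" by (metis periodic)
    qed
    then show ?thesis by (simp add: full_def)
  qed
  define l0 where "l0 = nat ((j - p) mod int m)"
  have l0: "int l0 = (j - p) mod int m" using m by (simp add: l0_def)
  have "(j - int l0) mod int m = p mod int m" by (simp add: l0 mod_diff_right_eq)
  then have l0_nonfull: "\<not> full b y (j - int l0)" using nonfull full_cong by blast
  have "l0 < m" using m l0 by (metis of_nat_0_less_iff of_nat_less_iff pos_mod_bound)
  define l where "l = (LEAST l. \<not> full b y (j - int l))"
  have l: "\<not> full b y (j - int l)" "l \<le> l0"
    unfolding l_def by (rule LeastI[of _ l0], fact, rule Least_le, fact)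
  have "k \<le> l" using k(2) l by (meson not_le)
  moreover have "b * l \<le> window y j l"
  proof (rule full_run_window_after_nonfull[OF _ _ l(1)])
    show "full b y (j - int i)" if "i < l" for i
      using that not_less_Least unfolding l_def by blast
  qed (use k \<open>k \<le> l\<close> in auto)
  ultimately show ?thesis using \<open>l0 < m\<close> l by (intro exI[of _ l]) auto
qed

lemma nat_mod_eq_iff:
  assumes "p < m" "(a::nat) < m"
  shows "nat (i mod int m) = (a + p) mod m \<longleftrightarrow> (i - int a) mod int m = int p"
proof -
  have "nat (i mod int m) = (a + p) mod m \<longleftrightarrow> i mod int m = int ((a + p) mod m)"
    using assms by (auto simp: nat_eq_iff)
  also have "\<dots> \<longleftrightarrow> i mod int m = (int a + int p) mod int m"
    by (simp add: of_nat_mod)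
  also have "\<dots> \<longleftrightarrow> (i - int a) mod int m = int p mod int m"
    by (simp add: mod_eq_dvd_iff algebra_simps)
  finally show ?thesis using assms by simp
qed

section \<open>Conservation of keys under linear probing\<close>

lemma probes_less:
  assumes "j < m" "c j < b" "a < m"
  shows "probes b m c a < m" "c ((a + probes b m c a) mod m) < b"
    "\<And>k. k < probes b m c a \<Longrightarrow> c ((a + k) mod m) \<ge> b"
proof -
  define k0 where "k0 = (if a \<le> j then j - a else j + m - a)"
  have k0: "k0 < m" "(a + k0) mod m = j"
    using assms by (auto simp: k0_def)
  then have *: "c ((a + k0) mod m) < b" using assms by simp
  show "probes b m c a < m"
    using Least_le[of "\<lambda>k. c ((a + k) mod m) < b", OF *] k0 unfolding probes_def by linarith
  show "c ((a + probes b m c a) mod m) < b"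
    unfolding probes_def by (rule LeastI[of "\<lambda>k. c ((a + k) mod m) < b", OF *])
  show "c ((a + k) mod m) \<ge> b" if "k < probes b m c a" for k
    using not_less_Least[OF that[unfolded probes_def]] by simp
qed

lemma sum_occupancy: "m > 0 \<Longrightarrow> (\<Sum>j<m. occupancy b m h n j) = n"
proof (induction n)
  case (Suc n)
  define j where "j = (h n + probes b m (occupancy b m h n) (h n)) mod m"
  have "j < m" using Suc by (simp add: j_def)
  have "(\<Sum>i<m. occupancy b m h (Suc n) i) = (\<Sum>i<m. occupancy b m h n i + (if i = j then 1 else 0))"
    by (intro sum.cong) (auto simp: insert_key_def Let_def simp flip: j_def)
  then show ?case using Suc \<open>j < m\<close> by (simp add: sum.distrib)
qed auto

lemma occupancy_nonfull:
  assumes "n < b * m"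
  shows "\<exists>j<m. occupancy b m h n j < b"
proof (rule ccontr)
  assume "\<not> ?thesis"
  then have "(\<Sum>j<m. b) \<le> (\<Sum>j<m. occupancy b m h n j)"
    by (intro sum_mono) (metis lessThan_iff not_less)
  then show False using assms sum_occupancy[of m b h n] by (cases "m = 0") (auto simp: mult.commute)
qed

text \<open>The cyclic table is unrolled to all integers, periodically and with bucket
  \<open>s\<close> as origin, so that \<open>full\<close> and \<open>first_nonfull\<close> apply to
  it unchanged.\<close>

definition hash_count :: "nat \<Rightarrow> nat \<Rightarrow> nat \<Rightarrow> (nat \<Rightarrow> nat) \<Rightarrow> int \<Rightarrow> nat" where
  "hash_count m n s h i = card {k. k < n \<and> h k = nat ((int s + i) mod int m)}"

lemma hash_count_Suc:
  "hash_count m (Suc n) s h i = hash_count m n s h i + (if h n = nat ((int s + i) mod int m) then 1 else 0)"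
proof -
  have "{k. k < Suc n \<and> h k = nat ((int s + i) mod int m)} =
     (if h n = nat ((int s + i) mod int m) then insert n {k. k < n \<and> h k = nat ((int s + i) mod int m)}
      else {k. k < n \<and> h k = nat ((int s + i) mod int m)})"
    by (auto simp: less_Suc_eq)
  then show ?thesis by (simp add: hash_count_def)
qed

text \<open>
  With \<open>f i\<close> the number of keys carried over from bucket \<open>i\<close> to bucket
  \<open>i + 1\<close>, occupancies, hash counts and flows balance, and only full buckets pass keys on.
\<close>

lemma occupancy_flow:
  assumes "n \<le> b * m" "\<And>k. k < n \<Longrightarrow> h k < m"
  shows "\<exists>f :: int \<Rightarrow> nat. \<forall>i.
    occupancy b m h n (nat (i mod int m)) + f i = hash_count m n 0 h i + f (i - 1) \<and>
    occupancy b m h n (nat (i mod int m)) \<le> b \<and>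
    (f i > 0 \<longrightarrow> occupancy b m h n (nat (i mod int m)) = b)"
  using assms
proof (induction n)
  case 0
  then show ?case by (intro exI[of _ "\<lambda>_. 0"]) (auto simp: hash_count_def)
next
  case (Suc n)
  define c where "c = occupancy b m h n"
  define a where "a = h n"
  define p where "p = probes b m c a"
  have a: "a < m" using Suc by (simp add: a_def)
  have "n < b * m" using Suc by simp
  obtain j where "j < m" "c j < b"
    using occupancy_nonfull[OF \<open>n < b * m\<close>, of h] by (auto simp: c_def)
  note p = probes_less[where c = c and b = b, OF this a, folded p_def]
  have "\<exists>f :: int \<Rightarrow> nat. \<forall>i.
    c (nat (i mod int m)) + f i = hash_count m n 0 h i + f (i - 1) \<and>
    c (nat (i mod int m)) \<le> b \<and> (f i > 0 \<longrightarrow> c (nat (i mod int m)) = b)"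
    unfolding c_def using Suc by simp
  then obtain f :: "int \<Rightarrow> nat" where f:
    "\<And>i. c (nat (i mod int m)) + f i = hash_count m n 0 h i + f (i - 1)"
    "\<And>i. c (nat (i mod int m)) \<le> b" "\<And>i. f i > 0 \<Longrightarrow> c (nat (i mod int m)) = b"
    by blast
  \<comment> \<open>\<open>t i\<close> is the number of steps from the hash address \<open>a\<close>
    forward to bucket \<open>i\<close> around the circle; the key comes to rest at distance
    \<open>p\<close>.\<close>
  define t where "t = (\<lambda>i. nat ((i - int a) mod int m))"
  have t_less: "t i < m" and t: "int (t i) = (i - int a) mod int m" for i
  proof -
    show "int (t i) = (i - int a) mod int m" using a by (simp add: t_def)
    then show "t i < m" using a by (metis of_nat_less_iff pos_mod_bound of_nat_0_less_iff gr_zeroI not_less0)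
  qed
  have t_pred: "t (i - 1) = (if t i = 0 then m - 1 else t i - 1)" for i
  proof -
    have "(i - 1 - int a) mod int m = ((i - int a) mod int m - 1) mod int m"
      by (metis diff_diff_eq add.commute mod_diff_left_eq)
    then have "int (t (i - 1)) = (int (t i) - 1) mod int m" by (simp add: t)
    also have "\<dots> = (if t i = 0 then int m - 1 else int (t i) - 1)"
      using t_less[of i] by (auto simp: zmod_minus1)
    finally show ?thesis using a t_less[of i] by (auto split: if_splits)
  qed
  have idx: "nat (i mod int m) = (a + k) mod m \<longleftrightarrow> t i = k" if "k < m" for i k
    using nat_mod_eq_iff[OF that a, of i] by (simp flip: t)
  have c': "occupancy b m h (Suc n) (nat (i mod int m)) = c (nat (i mod int m)) + (if t i = p then 1 else 0)" for i
    using idx[OF p(1), of i]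
    by (auto simp: insert_key_def Let_def simp flip: c_def a_def p_def)
  have x': "hash_count m (Suc n) 0 h i = hash_count m n 0 h i + (if t i = 0 then 1 else 0)" for i
    using idx[of 0 i] a by (auto simp: hash_count_Suc simp flip: a_def)
  \<comment> \<open>The new key is handed on by the buckets at distances 0 to \<open>p - 1\<close>
    and by no others, so the flow grows by one there.\<close>
  define f' where "f' = (\<lambda>i. f i + (if t i < p then 1 else 0))"
  show ?case
  proof (intro exI[of _ f'] allI)
    fix i
    have full: "c (nat (i mod int m)) = b" if "t i < p"
      using idx[OF t_less[of i], of i] p(3)[OF that] f(2)[of i] by simp
    have nonfull: "c (nat (i mod int m)) < b" if "t i = p"
      using idx[OF t_less[of i], of i] p(2) that by simp
    have "f i = 0" if "t i = p" using f(3)[of i] nonfull[OF that] by auto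
    then show "occupancy b m h (Suc n) (nat (i mod int m)) + f' i = hash_count m (Suc n) 0 h i + f' (i - 1) \<and>
       occupancy b m h (Suc n) (nat (i mod int m)) \<le> b \<and>
       (f' i > 0 \<longrightarrow> occupancy b m h (Suc n) (nat (i mod int m)) = b)"
    proof (intro conjI impI)
      \<comment> \<open>The cases are the hash address, a bucket passed on the way, the resting
        place, and a bucket not reached. At the hash address the predecessor has distance
        \<open>m - 1\<close>, which carries no extra flow because \<open>p < m\<close>.\<close>
      have "t i = 0 \<and> p = 0 \<or> t i = 0 \<and> p > 0 \<or> t i > 0 \<and> t i < p \<or> t i > 0 \<and> t i = p \<or> t i > p"
        by linarith
      then show "occupancy b m h (Suc n) (nat (i mod int m)) + f' i = hash_count m (Suc n) 0 h i + f' (i - 1)"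
        using f(1)[of i] p(1) unfolding c' x' f'_def t_pred by (elim disjE) auto
      show "occupancy b m h (Suc n) (nat (i mod int m)) \<le> b"
        using f(2)[of i] nonfull unfolding c' by auto
      show "occupancy b m h (Suc n) (nat (i mod int m)) = b" if "f' i > 0"
      proof (cases "t i < p")
        case True
        then show ?thesis using full unfolding c' by simp
      next
        case False
        then have "f i > 0" using that by (simp add: f'_def)
        then show ?thesis using f(3)[of i] nonfull unfolding c' by auto
      qed
    qed
  qed
qed

text \<open>The flow balance is telescoped over a window. If bucket \<open>i\<close> is full, go
  left to the nearest bucket that passes nothing on: everything in between is full and all its keys
  were hashed there. If bucket \<open>i\<close> is not full, it passes nothing on, so no window
  ending there received more keys than it stores, which is less than its capacity.\<close>

lemma occupancy_full_iff:
  assumes n: "n < b * m" and h: "\<And>k. k < n \<Longrightarrow> h k < m"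
  shows "occupancy b m h n (nat (i mod int m)) = b \<longleftrightarrow> full b (hash_count m n 0 h) i"
    "occupancy b m h n (nat (i mod int m)) \<le> b"
proof -
  define c where "c = (\<lambda>i. occupancy b m h n (nat (i mod int m)))"
  define x where "x = hash_count m n 0 h"
  have "\<exists>f :: int \<Rightarrow> nat. \<forall>i. c i + f i = x i + f (i - 1) \<and> c i \<le> b \<and> (f i > 0 \<longrightarrow> c i = b)"
    unfolding c_def x_def by (rule occupancy_flow) (use n h in auto)
  then obtain f :: "int \<Rightarrow> nat" where f:
    "\<And>i. c i + f i = x i + f (i - 1)" "\<And>i. c i \<le> b" "\<And>i. f i > 0 \<Longrightarrow> c i = b"
    by blast
  show "occupancy b m h n (nat (i mod int m)) \<le> b" using f(2) by (simp add: c_def)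
  have balance: "window c i l + f i = window x i l + f (i - int l)" for l
  proof (induction l)
    case (Suc l)
    have "window c i (Suc l) = window c i l + c (i - int l)" "window x i (Suc l) = window x i l + x (i - int l)"
      by (simp_all add: window_def)
    then show ?case using Suc f(1)[of "i - int l"] by (simp add: algebra_simps)
  qed (simp add: window_def)
  obtain j where j: "j < m" "occupancy b m h n j < b"
    using occupancy_nonfull[OF n] by blast
  have "c i = b \<longleftrightarrow> full b x i"
  proof
    assume i: "c i = b"
    \<comment> \<open>Some bucket has room, hence zero outflow, and is met at this distance to the
      left of \<open>i\<close>; this makes the least \<open>l\<close> below well defined.\<close>
    define l0 where "l0 = nat ((i - int j) mod int m)"
    have "(i - int l0) mod int m = int j" using j by (simp add: l0_def mod_diff_right_eq)
    then have "c (i - int l0) < b" using j by (simp add: c_def)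
    then have f0: "f (i - int l0) = 0" using f(3)[of "i - int l0"] by auto
    have "l0 \<noteq> 0" using \<open>c (i - int l0) < b\<close> i by (metis of_nat_0 diff_zero less_irrefl)
    define l where "l = (LEAST l. l \<ge> 1 \<and> f (i - int l) = 0)"
    have l: "l \<ge> 1 \<and> f (i - int l) = 0"
      unfolding l_def by (rule LeastI[of _ l0]) (use f0 \<open>l0 \<noteq> 0\<close> in auto)
    have "c (i - int t) = b" if "t < l" for t
    proof (cases "t = 0")
      case False
      then have "f (i - int t) > 0" using not_less_Least[OF that[unfolded l_def]] by auto
      then show ?thesis by (rule f(3))
    qed (use i in auto)
    then have "window c i l = b * l" by (simp add: window_def)
    then show "full b x i" unfolding full_def using balance[of l] l by (intro exI[of _ l]) auto
  next
    assume "full b x i"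
    then obtain l where l: "l \<ge> 1" "b * l \<le> window x i l" by (auto simp: full_def)
    show "c i = b"
    proof (rule ccontr)
      assume nb: "c i \<noteq> b"
      then have "c i < b" using f(2)[of i] by simp
      moreover have "f i = 0" using nb f(3)[of i] by auto
      moreover have "window c i l < (\<Sum>t<l. b)"
        unfolding window_def by (rule sum_strict_mono_ex1) (use f(2) l \<open>c i < b\<close> in \<open>auto intro!: bexI[of _ 0]\<close>)
      ultimately show False using balance[of l] l by (simp add: mult.commute)
    qed
  qed
  then show "occupancy b m h n (nat (i mod int m)) = b \<longleftrightarrow> full b (hash_count m n 0 h) i"
    by (simp add: c_def x_def)
qed

lemma U_exact_eq_first_nonfull:
  assumes n: "n < b * m" and h: "\<And>k. k < n \<Longrightarrow> h k < m"
  shows "U_exact b m n s h = first_nonfull b (hash_count m n s h)"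
    and "\<exists>k. \<not> full b (hash_count m n s h) (int k)"
proof -
  have m: "m > 0" using n by (cases m) auto
  have eq: "occupancy b m h n ((s + k) mod m) < b \<longleftrightarrow> \<not> full b (hash_count m n s h) (int k)" for k
  proof -
    have "hash_count m n s h = (\<lambda>i. hash_count m n 0 h (int s + i))"
      by (simp add: hash_count_def fun_eq_iff)
    then have "full b (hash_count m n s h) (int k) \<longleftrightarrow> full b (hash_count m n 0 h) (int s + int k)"
      using full_shift[of b "hash_count m n 0 h" "int s" "int k"] by simp
    moreover have "nat ((int s + int k) mod int m) = (s + k) mod m"
      by (simp flip: of_nat_add of_nat_mod)
    moreover have "occupancy b m h n (nat ((int s + int k) mod int m)) = b \<longleftrightarrow>
        full b (hash_count m n 0 h) (int s + int k)"
      "occupancy b m h n (nat ((int s + int k) mod int m)) \<le> b"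
      using occupancy_full_iff n h by blast+
    ultimately show ?thesis by (metis order.strict_iff_order)
  qed
  then show "U_exact b m n s h = first_nonfull b (hash_count m n s h)"
    by (simp add: U_exact_def probes_def first_nonfull_def)
  obtain j where j: "j < m" "occupancy b m h n j < b" using occupancy_nonfull[OF n] by blast
  \<comment> \<open>A nonnegative number of steps that leads from \<open>s\<close> around the circle
    to the non-full bucket \<open>j\<close>, whatever the size of \<open>s\<close>.\<close>
  have "(s + (j + (m - s mod m))) mod m = j"
  proof -
    have "s mod m < m" using m by simp
    then have "(s mod m + (j + (m - s mod m))) mod m = (j + m) mod m"
      by (simp add: algebra_simps)
    then show ?thesis using j by (metis mod_add_left_eq mod_add_self2 mod_less)
  qed
  then show "\<exists>k. \<not> full b (hash_count m n s h) (int k)" using eq j by metis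
qed

section \<open>The tree function\<close>

text \<open>The N-th finite difference annihilates polynomials of degree below N: Pascal's rule
  passes from N + 1 to N by replacing k^j with k^j - (k+1)^j, which has lower degree.\<close>

lemma alternating_binomial_sum_power_eq_0:
  assumes "j < N"
  shows "(\<Sum>k\<le>N. (-1) ^ k * of_nat (N choose k) * of_nat k ^ j) = (0 :: 'a :: comm_ring_1)"
  using assms
proof (induction N arbitrary: j)
  case (Suc N)
  let ?f = "\<lambda>k. (of_nat k ^ j :: 'a)"
  have "(\<Sum>k\<le>Suc N. (-1) ^ k * of_nat (Suc N choose k) * ?f k) =
      ?f 0 + (\<Sum>k\<le>N. (-1) ^ Suc k * of_nat (Suc N choose Suc k) * ?f (Suc k))"
    by (subst sum.atMost_Suc_shift) simp
  also have "(\<Sum>k\<le>N. (-1) ^ Suc k * of_nat (Suc N choose Suc k) * ?f (Suc k)) =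
      (\<Sum>k\<le>N. (-1) ^ Suc k * of_nat (N choose Suc k) * ?f (Suc k)) -
      (\<Sum>k\<le>N. (-1) ^ k * of_nat (N choose k) * ?f (Suc k))"
    unfolding sum_subtractf[symmetric] by (intro sum.cong refl) (simp add: algebra_simps)
  also have "?f 0 + ((\<Sum>k\<le>N. (-1) ^ Suc k * of_nat (N choose Suc k) * ?f (Suc k)) -
      (\<Sum>k\<le>N. (-1) ^ k * of_nat (N choose k) * ?f (Suc k))) =
      (\<Sum>k\<le>Suc N. (-1) ^ k * of_nat (N choose k) * ?f k) - (\<Sum>k\<le>N. (-1) ^ k * of_nat (N choose k) * ?f (Suc k))"
    by (subst sum.atMost_Suc_shift) simp
  also have "\<dots> = (\<Sum>k\<le>N. (-1) ^ k * of_nat (N choose k) * (?f k - ?f (Suc k)))"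
    by (simp add: binomial_eq_0 right_diff_distrib sum_subtractf)
  also have "\<dots> = (\<Sum>k\<le>N. (-1) ^ k * of_nat (N choose k) * - (\<Sum>i<j. of_nat (j choose i) * of_nat k ^ i))"
  proof (intro sum.cong refl arg_cong2[where f = times])
    fix k
    have "?f (Suc k) = (of_nat k + 1) ^ j" by (simp add: add.commute)
    also have "\<dots> = (\<Sum>i\<le>j. of_nat (j choose i) * of_nat k ^ i)" by (simp add: binomial_ring)
    also have "\<dots> = (\<Sum>i<j. of_nat (j choose i) * of_nat k ^ i) + ?f k"
      by (simp flip: lessThan_Suc_atMost)
    finally show "?f k - ?f (Suc k) = - (\<Sum>i<j. of_nat (j choose i) * of_nat k ^ i)" by simp
  qed
  also have "\<dots> = - (\<Sum>i<j. of_nat (j choose i) * (\<Sum>k\<le>N. (-1) ^ k * of_nat (N choose k) * of_nat k ^ i))"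
    by (simp add: sum_distrib_left sum_negf mult_ac sum.swap[of _ "{..N}"])
  also have "\<dots> = 0"
    using Suc by (simp add: less_Suc_eq_le)
  finally show ?case .
qed simp

definition tree_coeff :: "nat \<Rightarrow> real" where
  "tree_coeff n = real (Suc n ^ n) / fact (Suc n)"

definition real_tree_fun :: "real \<Rightarrow> real" where
  "real_tree_fun x = (\<Sum>n. tree_coeff n * x ^ Suc n)"

lemma tree_fun_altdef: "tree_fun z = (\<Sum>n. of_real (tree_coeff n) * z ^ Suc n)"
  by (simp add: tree_fun_def tree_coeff_def del: power_Suc)

lemma tree_coeff_pos: "tree_coeff n > 0"
  by (simp add: tree_coeff_def)

text \<open>The quotient of consecutive coefficients is (1 + 1/(n+1))^n, which is at most e; this
  gives the radius of convergence 1/e without an estimate of factorials.\<close>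

lemma tree_coeff_Suc_le: "tree_coeff (Suc n) \<le> exp 1 * tree_coeff n"
proof -
  have "tree_coeff (Suc n) = real (n + 2) ^ n * real (n + 2) / (real (n + 2) * fact (Suc n))"
    by (simp add: tree_coeff_def algebra_simps)
  also have "\<dots> = real (n + 2) ^ n / fact (Suc n)"
    by (simp del: of_nat_add)
  also have "\<dots> = (1 + 1 / real (Suc n)) ^ n * tree_coeff n"
  proof -
    have "1 + 1 / real (Suc n) = real (n + 2) / real (Suc n)" by (simp add: field_simps)
    then show ?thesis by (simp add: tree_coeff_def power_divide del: of_nat_add of_nat_Suc fact_Suc)
  qed
  also have "(1 + 1 / real (Suc n)) ^ n \<le> (exp (1 / real (Suc n))) ^ n"
    by (intro power_mono exp_ge_add_one_self) auto
  also have "\<dots> = exp (real n / real (Suc n))" by (simp flip: exp_of_nat_mult)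
  also have "\<dots> \<le> exp 1" by simp
  finally show ?thesis using tree_coeff_pos[of n] by (simp add: mult_right_mono)
qed

lemma tree_coeff_le: "tree_coeff n \<le> exp 1 ^ n"
proof (induction n)
  case (Suc n)
  then show ?case using tree_coeff_Suc_le[of n]
    by (metis exp_ge_zero mult_left_mono order_trans power_Suc)
qed (simp add: tree_coeff_def)

lemma summable_real_tree_fun:
  assumes "0 \<le> x" "x < exp (-1)"
  shows "summable (\<lambda>n. tree_coeff n * x ^ Suc n)"
proof (rule summable_comparison_test')
  have "exp 1 * x < exp 1 * exp (-1 :: real)" using assms by simp
  then have "exp 1 * x < 1" by (simp flip: exp_add)
  then show "summable (\<lambda>n. x * (exp 1 * x) ^ n)"
    using assms by (intro summable_mult summable_geometric) auto
  show "norm (tree_coeff n * x ^ Suc n) \<le> x * (exp 1 * x) ^ n" for n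
    using mult_right_mono[OF tree_coeff_le[of n], of "x ^ Suc n"] assms tree_coeff_pos[of n]
    by (simp add: power_mult_distrib abs_mult mult_ac)
qed

definition tree_fps :: "complex fps" where
  "tree_fps = Abs_fps (\<lambda>n. if n = 0 then 0 else of_real (tree_coeff (n - 1)))"

lemma tree_fps_conv_radius: "fps_conv_radius tree_fps \<ge> ereal (exp (-1))"
  unfolding fps_conv_radius_def
proof (rule conv_radius_geI_ex')
  fix r :: real assume r: "r > 0" "ereal r < ereal (exp (-1))"
  have "summable (\<lambda>n. norm (of_real (tree_coeff n) * (of_real r :: complex) ^ Suc n))"
    using summable_real_tree_fun[of r] r tree_coeff_pos
    by (simp add: norm_mult norm_power abs_of_pos less_imp_le del: power_Suc)
  then have "summable (\<lambda>n. of_real (tree_coeff n) * (of_real r :: complex) ^ Suc n)"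
    by (rule summable_norm_cancel)
  then have "summable (\<lambda>n. fps_nth tree_fps (Suc n) * of_real r ^ Suc n)"
    by (simp add: tree_fps_def)
  then show "summable (\<lambda>n. fps_nth tree_fps n * of_real r ^ n)"
    by (subst (asm) summable_Suc_iff)
qed

lemma eval_tree_fps:
  assumes "norm z < exp (-1)"
  shows "eval_fps tree_fps z = tree_fun z"
proof -
  have "summable (\<lambda>n. fps_nth tree_fps n * z ^ n)"
    by (rule summable_fps) (rule less_le_trans[OF _ tree_fps_conv_radius], use assms in simp)
  from suminf_split_head[OF this] show ?thesis
    by (simp add: eval_fps_def tree_fun_altdef tree_fps_def)
qed

lemma tree_fun_has_fps_expansion: "tree_fun has_fps_expansion tree_fps"
  unfolding has_fps_expansion_def
proof
  show "fps_conv_radius tree_fps > 0"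
    using tree_fps_conv_radius by (rule less_le_trans[rotated]) simp
  have "eventually (\<lambda>z. z \<in> ball 0 (exp (-1))) (nhds (0 :: complex))"
    by (intro eventually_nhds_in_open) auto
  then show "eventually (\<lambda>z. eval_fps tree_fps z = tree_fun z) (nhds 0)"
    by eventually_elim (simp add: eval_tree_fps)
qed

lemma tree_fun_holomorphic: "tree_fun holomorphic_on ball 0 (exp (-1))"
proof -
  have "eval_fps tree_fps holomorphic_on ball 0 (exp (-1))"
    by (rule holomorphic_on_eval_fps)
       (auto simp: in_eball_iff intro!: less_le_trans[OF _ tree_fps_conv_radius])
  then show ?thesis
    by (rule holomorphic_transform) (simp add: eval_tree_fps)
qed

text \<open>For N > 1 the N-th coefficient of T(X e^(-X)) is (-1)^N / N! times the alternating
  binomial sum of k^(N-1), an N-th difference of a polynomial of degree N - 1, hence zero.\<close>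

lemma tree_fps_compose: "fps_compose tree_fps (fps_X * fps_exp (-1)) = fps_X"
proof (rule fps_ext)
  fix N
  have nth: "((fps_X * fps_exp (-1)) ^ i) $ N = (- of_nat i) ^ (N - i) / (fact (N - i) :: complex)"
    if "i \<le> N" for i
    using that by (simp add: power_mult_distrib fps_X_power_mult_nth fps_exp_power_mult)
  show "fps_compose tree_fps (fps_X * fps_exp (-1)) $ N = (fps_X :: complex fps) $ N"
  proof (cases "N \<le> 1")
    case True
    then have "N = 0 \<or> N = 1" by auto
    then show ?thesis
      by (auto simp: fps_compose_nth tree_fps_def tree_coeff_def)
  next
    case False
    have "fps_compose tree_fps (fps_X * fps_exp (-1)) $ N =
        (\<Sum>i\<le>N. tree_fps $ i * ((- of_nat i) ^ (N - i) / fact (N - i)))"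
      unfolding fps_compose_nth atMost_atLeast0 by (intro sum.cong) (auto simp: nth)
    also have "\<dots> = (\<Sum>i\<le>N. (-1) ^ N / fact N * ((-1) ^ i * of_nat (N choose i) * of_nat i ^ (N - 1)))"
    proof (intro sum.cong refl)
      fix i assume i: "i \<in> {..N}"
      show "tree_fps $ i * ((- of_nat i) ^ (N - i) / fact (N - i)) =
          (-1) ^ N / fact N * ((-1) ^ i * of_nat (N choose i) * (of_nat i ^ (N - 1) :: complex))"
      proof (cases "i = 0")
        case i0: False
        have 1: "(- of_nat i) ^ (N - i) = (-1) ^ N * (-1) ^ i * (of_nat i ^ (N - i) :: complex)"
        proof -
          have "(-1 :: complex) ^ N * (-1) ^ i = (-1) ^ (N - i)"
            using i by (auto simp: minus_one_power_iff)
          then show ?thesis by (simp flip: power_minus)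
        qed
        have 2: "of_nat i ^ (N - 1) = (of_nat i ^ (i - 1) * of_nat i ^ (N - i) :: complex)"
          using i i0 by (simp flip: power_add)
        have 3: "of_nat (N choose i) = (fact N / (fact i * fact (N - i)) :: complex)"
          using i by (simp add: binomial_fact)
        have 4: "tree_fps $ i = of_nat i ^ (i - 1) / fact i"
          using i0 by (simp add: tree_fps_def tree_coeff_def)
        show ?thesis unfolding 1 2 3 4 by simp
      qed (use False in \<open>simp add: tree_fps_def\<close>)
    qed
    also have "\<dots> = 0"
      using alternating_binomial_sum_power_eq_0[of "N - 1" N, where 'a = complex] False
      unfolding sum_distrib_left[symmetric] by simp
    finally show ?thesis using False by simp
  qed
qed

lemma tree_fun_near_0: "eventually (\<lambda>w. tree_fun (w * exp (-w)) = w) (nhds 0)"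
proof -
  have "(\<lambda>w::complex. w * exp (- w)) has_fps_expansion (fps_X * fps_exp (-1))"
    by (intro fps_expansion_intros)
  with tree_fun_has_fps_expansion
  have "(tree_fun \<circ> (\<lambda>w. w * exp (- w))) has_fps_expansion fps_compose tree_fps (fps_X * fps_exp (-1))"
    by (intro has_fps_expansion_compose) auto
  then have "eventually (\<lambda>w. eval_fps fps_X w = tree_fun (w * exp (-w))) (nhds 0)"
    unfolding tree_fps_compose by (simp add: has_fps_expansion_def)
  then show ?thesis by eventually_elim simp
qed

text \<open>The formal identity makes T a left inverse of w e^(-w) near 0. At points z = x e^(-x)
  with small x > 0 this gives T(z) e^(-T(z)) = z; these points accumulate at 0, so the equation
  holds in the whole disc.\<close>

lemma tree_fun_functional_eq:
  assumes "norm z < exp (-1)"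
  shows "tree_fun z * exp (- tree_fun z) = z"
proof -
  let ?f = "\<lambda>z. tree_fun z * exp (- tree_fun z) - z"
  define g where "g = (\<lambda>w::complex. w * exp (-w))"
  obtain e where e: "e > 0" "\<And>w. norm w < e \<Longrightarrow> tree_fun (g w) = w"
    using tree_fun_near_0 unfolding eventually_nhds_metric g_def by auto
  define e' where "e' = min e (exp (-1))"
  have e': "e' > 0" "e' \<le> e" "e' \<le> exp (-1)" using e by (auto simp: e'_def)
  define U where "U = (\<lambda>x. g (of_real x)) ` {0<..<e'}"
  have U: "\<exists>x. 0 < x \<and> x < e' \<and> z = g (of_real x)" if "z \<in> U" for z
    using that unfolding U_def image_iff Bex_def greaterThanLessThan_iff by (simp add: conj_assoc)
  have "?f z = 0"
  proof (rule analytic_continuation[where f = ?f and S = "ball 0 (exp (-1))" and U = U and \<xi> = 0])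
    show "?f holomorphic_on ball 0 (exp (-1))"
      by (intro holomorphic_intros tree_fun_holomorphic)
    have norm_g: "norm (g (of_real x)) = x * exp (-x)" if "x > 0" for x
      using that by (simp add: g_def norm_mult flip: exp_of_real of_real_minus)
    show "U \<subseteq> ball 0 (exp (-1))"
    proof
      fix z assume "z \<in> U"
      then obtain x where x: "0 < x" "x < e'" "z = g (of_real x)" using U by blast
      have "x * exp (-x) < exp (-1) * 1"
        using x e' by (intro mult_strict_mono) auto
      then show "z \<in> ball 0 (exp (-1))" using norm_g x by simp
    qed
    show "0 islimpt U"
      unfolding islimpt_approachable
    proof (intro allI impI)
      fix d :: real assume "d > 0"
      define x where "x = min d e' / 2"
      have x: "x > 0" "x < d" "x < e'" using \<open>d > 0\<close> e' by (auto simp: x_def)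
      have "x * exp (-x) < d * 1" using x by (intro mult_strict_mono) auto
      moreover have "g (of_real x) \<in> U" using x by (auto simp: U_def)
      moreover have "g (of_real x) \<noteq> 0" using x by (simp add: g_def)
      ultimately show "\<exists>z\<in>U. z \<noteq> 0 \<and> dist z 0 < d" using norm_g[OF x(1)] by auto
    qed
    show "?f z = 0" if "z \<in> U" for z
    proof -
      obtain x where x: "0 < x" "x < e'" "z = g (of_real x)" using U[OF \<open>z \<in> U\<close>] by blast
      then have "tree_fun z = of_real x" using e(2)[of "of_real x"] e' by auto
      then show ?thesis using x(3) by (simp add: g_def)
    qed
  qed (use assms in auto)
  then show ?thesis by simp
qed

lemma tree_fun_inj: "inj_on tree_fun (ball 0 (exp (-1)))"
  by (rule inj_on_inverseI[where g = "\<lambda>w. w * exp (-w)"]) (simp add: tree_fun_functional_eq)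

lemma tree_fun_of_real:
  assumes "0 \<le> x" "x < exp (-1)"
  shows "tree_fun (of_real x) = of_real (real_tree_fun x)"
  using suminf_of_real[OF summable_real_tree_fun[OF assms], where 'a = complex]
  by (simp add: real_tree_fun_def tree_fun_altdef)

lemma real_tree_fun_functional_eq:
  assumes "0 \<le> x" "x < exp (-1)"
  shows "real_tree_fun x * exp (- real_tree_fun x) = x"
proof -
  have "complex_of_real (real_tree_fun x * exp (- real_tree_fun x)) = of_real x"
    using tree_fun_functional_eq[of "of_real x"] assms tree_fun_of_real[OF assms]
    by (simp add: exp_of_real flip: of_real_minus)
  then show ?thesis by (simp only: of_real_eq_iff)
qed

lemma real_tree_fun_nonneg:
  assumes "0 \<le> x" "x < exp (-1)"
  shows "real_tree_fun x \<ge> 0"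
  unfolding real_tree_fun_def using assms tree_coeff_pos
  by (intro suminf_nonneg summable_real_tree_fun mult_nonneg_nonneg) (auto intro: less_imp_le)

text \<open>T starts at 0 and is continuous on the real segment; attaining the value 1 at some y
  would give y = 1/e by the functional equation.\<close>

lemma real_tree_fun_less_1:
  assumes "0 \<le> x" "x < exp (-1)"
  shows "real_tree_fun x < 1"
proof (rule ccontr)
  assume *: "\<not> real_tree_fun x < 1"
  have "continuous_on {0..x} (\<lambda>x. Re (tree_fun (of_real x)))"
    using assms by (intro continuous_intros holomorphic_on_imp_continuous_on[OF holomorphic_on_subset[OF tree_fun_holomorphic]]
        continuous_on_compose2[OF holomorphic_on_imp_continuous_on[OF tree_fun_holomorphic]]) auto
  then have "continuous_on {0..x} real_tree_fun"
    by (rule continuous_on_eq) (use assms tree_fun_of_real in auto)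
  moreover have "real_tree_fun 0 = 0" by (simp add: real_tree_fun_def)
  ultimately obtain y where y: "0 \<le> y" "y \<le> x" "real_tree_fun y = 1"
    using IVT'[of real_tree_fun 0 1 x] * assms by auto
  then show False using real_tree_fun_functional_eq[of y] assms by simp
qed

lemma mult_exp_uminus_strict_mono:
  fixes x y :: real
  assumes "0 \<le> x" "x < y" "y \<le> 1"
  shows "x * exp (-x) < y * exp (-y)"
proof (rule DERIV_pos_imp_increasing_open[OF assms(2)])
  show "\<exists>d. ((\<lambda>x. x * exp (-x)) has_real_derivative d) (at t) \<and> d > 0" if "x < t" "t < y" for t
    using that assms by (intro exI[of _ "exp (-t) * (1 - t)"]) (auto intro!: derivative_eq_intros simp: algebra_simps)
qed (auto intro!: continuous_intros)

text \<open>The equation t e^(-t) = a e^(-a) has a second real solution above 1 when a > 0; since T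
  stays in [0, 1), where x e^(-x) is injective, it selects a. This is where load below 1 enters: it
  makes \<open>zeta b \<alpha> 0 1\<close> equal to 1.\<close>

lemma real_tree_fun_inverse:
  assumes "0 \<le> a" "a < 1"
  shows "real_tree_fun (a * exp (-a)) = a"
proof -
  have x: "0 \<le> a * exp (-a)" "a * exp (-a) < exp (-1)"
    using mult_exp_uminus_strict_mono[of a 1] assms by auto
  let ?t = "real_tree_fun (a * exp (-a))"
  have "?t < 1" "?t \<ge> 0" "?t * exp (-?t) = a * exp (-a)"
    using real_tree_fun_less_1[OF x] real_tree_fun_nonneg[OF x] real_tree_fun_functional_eq[OF x] by auto
  then show ?thesis
    using mult_exp_uminus_strict_mono[of a ?t] mult_exp_uminus_strict_mono[of ?t a] assms
    by (metis less_irrefl linorder_neqE_linordered_idom less_imp_le)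
qed

lemma norm_tree_fun_le:
  assumes "norm z \<le> x" "x < exp (-1)"
  shows "norm (tree_fun z) \<le> real_tree_fun x"
proof -
  have x: "0 \<le> x" using assms norm_ge_zero order_trans by blast
  have le: "norm (of_real (tree_coeff n) * z ^ Suc n) \<le> tree_coeff n * x ^ Suc n" for n
    using tree_coeff_pos[of n] assms(1) by (simp add: norm_mult norm_power mult_mono power_mono del: power_Suc)
  show ?thesis
    unfolding tree_fun_altdef real_tree_fun_def
    by (rule norm_suminf_le[OF le summable_real_tree_fun[OF x assms(2)]])
qed

text \<open>Each partial sum at 1/e is the limit of partial sums at smaller x, and those stay below
  T(x) < 1 because the terms are nonnegative.\<close>

lemma summable_tree_fun_boundary: "summable (\<lambda>n. tree_coeff n * exp (-1) ^ Suc n)"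
proof (rule summableI_nonneg_bounded)
  fix N
  have "((\<lambda>x. \<Sum>n<N. tree_coeff n * x ^ Suc n) \<longlongrightarrow> (\<Sum>n<N. tree_coeff n * exp (-1) ^ Suc n)) (at_left (exp (-1)))"
    by (intro tendsto_intros)
  moreover have "eventually (\<lambda>x::real. x \<in> {0<..<exp (-1)}) (at_left (exp (-1)))"
    by (intro eventually_at_left_real) auto
  then have "eventually (\<lambda>x. (\<Sum>n<N. tree_coeff n * x ^ Suc n) \<le> 1) (at_left (exp (-1)))"
  proof eventually_elim
    case (elim x)
    have "(\<Sum>n<N. tree_coeff n * x ^ Suc n) \<le> real_tree_fun x"
      unfolding real_tree_fun_def
      by (rule sum_le_suminf) (use elim summable_real_tree_fun[of x] tree_coeff_pos in \<open>auto intro: less_imp_le\<close>)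
    then show ?case using real_tree_fun_less_1[of x] elim by auto
  qed
  ultimately show "(\<Sum>n<N. tree_coeff n * exp (-1) ^ Suc n) \<le> 1"
    by (rule tendsto_upperbound) auto
qed (use tree_coeff_pos in \<open>auto intro: less_imp_le\<close>)

lemma tree_fun_continuous_on: "continuous_on (cball 0 (exp (-1))) tree_fun"
proof -
  have "uniform_limit (cball 0 (exp (-1))) (\<lambda>N z. \<Sum>n<N. of_real (tree_coeff n) * z ^ Suc n) tree_fun sequentially"
    unfolding tree_fun_altdef
  proof (rule Weierstrass_m_test[OF _ summable_tree_fun_boundary])
    show "norm (of_real (tree_coeff n) * z ^ Suc n) \<le> tree_coeff n * exp (-1) ^ Suc n"
      if "z \<in> cball 0 (exp (-1))" for n and z :: complex
      using tree_coeff_pos[of n] that by (simp add: norm_mult norm_power mult_mono power_mono del: power_Suc)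
  qed
  then show ?thesis
    by (rule uniform_limit_theorem[rotated]) (auto intro!: always_eventually continuous_intros)
qed

text \<open>Differentiating T e^(-T) = z gives T' (1 - T) e^(-T) = 1, and T = a at the point in
  question.\<close>

lemma tree_fun_has_field_derivative:
  assumes "0 < a" "a < 1"
  shows "(tree_fun has_field_derivative of_real (exp a / (1 - a))) (at (of_real (a * exp (-a))))"
proof -
  define z where "z = complex_of_real (a * exp (-a))"
  have lt: "a * exp (-a) < exp (-1)" using mult_exp_uminus_strict_mono[of a 1] assms by auto
  have z: "z \<in> ball 0 (exp (-1))" using lt assms by (simp add: z_def del: of_real_mult)
  have Tz: "tree_fun z = of_real a"
    using tree_fun_of_real[of "a * exp (-a)"] real_tree_fun_inverse[of a] assms lt by (simp add: z_def)
  obtain D where D: "(tree_fun has_field_derivative D) (at z)"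
    using tree_fun_holomorphic z by (meson holomorphic_on_imp_differentiable_at open_ball field_differentiable_def)
  have "((\<lambda>z. tree_fun z * exp (- tree_fun z)) has_field_derivative
      (D * exp (- tree_fun z) - D * tree_fun z * exp (- tree_fun z))) (at z)"
    by (auto intro!: derivative_eq_intros D simp: algebra_simps)
  moreover have "((\<lambda>z. tree_fun z * exp (- tree_fun z)) has_field_derivative 1) (at z)"
  proof (rule has_field_derivative_transform_within_open)
    show "((\<lambda>z. z) has_field_derivative 1) (at z)" by (rule DERIV_ident)
    show "z' = tree_fun z' * exp (- tree_fun z')" if "z' \<in> ball 0 (exp (-1))" for z'
      using that tree_fun_functional_eq[of z'] by simp
  qed (use z in auto)
  ultimately have "D * exp (- tree_fun z) - D * tree_fun z * exp (- tree_fun z) = 1"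
    by (rule DERIV_unique)
  then have "D * ((1 - of_real a) * exp (- of_real a)) = 1" by (simp add: Tz algebra_simps)
  then have "D * complex_of_real ((1 - a) * exp (- a)) = 1" by (simp flip: exp_of_real)
  moreover have "exp a / (1 - a) * ((1 - a) * exp (- a)) = 1"
    using assms by (simp add: exp_minus field_simps)
  then have "complex_of_real (exp a / (1 - a)) * complex_of_real ((1 - a) * exp (- a)) = 1"
    by (metis of_real_1 of_real_mult)
  ultimately have "D = of_real (exp a / (1 - a))"
    by (metis mult_cancel_right zero_neq_one mult_zero_right)
  then show ?thesis using D by (simp add: z_def)
qed

section \<open>The kernel method\<close>

text \<open>
  Step law: \<open>p n\<close> is the probability of a step \<open>n - b\<close>; the walk starts at \<open>0\<close>, is killed on
  becoming negative, and is at \<open>y\<close> after \<open>k\<close> steps.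
\<close>

fun excursion :: "nat \<Rightarrow> (nat \<Rightarrow> real) \<Rightarrow> nat \<Rightarrow> nat \<Rightarrow> real" where
  "excursion b p 0 y = (if y = 0 then 1 else 0)"
| "excursion b p (Suc k) y = (\<Sum>x\<le>y + b. excursion b p k x * p (y + b - x))"

text \<open>The law after one more step but before killing, with positions shifted up by
  \<open>b\<close>: entries below \<open>b\<close> are the mass about to be killed, from
  \<open>b\<close> on one reads off the next excursion law.\<close>

definition excursion_step :: "nat \<Rightarrow> (nat \<Rightarrow> real) \<Rightarrow> nat \<Rightarrow> nat \<Rightarrow> real" where
  "excursion_step b p k n = (\<Sum>x\<le>n. excursion b p k x * p (n - x))"

definition stay_prob :: "nat \<Rightarrow> (nat \<Rightarrow> real) \<Rightarrow> nat \<Rightarrow> real" where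
  "stay_prob b p k = (\<Sum>y. excursion b p k y)"

lemma excursion_Suc: "excursion b p (Suc k) y = excursion_step b p k (y + b)"
  by (simp add: excursion_step_def)

declare excursion.simps [simp del]

context
  fixes b :: nat and p :: "nat \<Rightarrow> real"
  assumes p_nonneg: "\<And>n. p n \<ge> 0" and p_sums: "p sums 1"
begin

lemma excursion_nonneg: "excursion b p k y \<ge> 0"
  by (induction k arbitrary: y) (auto simp: excursion.simps intro!: sum_nonneg mult_nonneg_nonneg p_nonneg)

lemma excursion_step_nonneg: "excursion_step b p k n \<ge> 0"
  unfolding excursion_step_def by (intro sum_nonneg mult_nonneg_nonneg excursion_nonneg p_nonneg)

lemma excursion_step_sums:
  assumes "summable (excursion b p k)"
  shows "excursion_step b p k sums stay_prob b p k"
proof -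
  have "(\<lambda>n. \<Sum>x\<le>n. excursion b p k x * p (n - x)) sums (suminf (excursion b p k) * suminf p)"
    using assms p_sums excursion_nonneg p_nonneg by (intro Cauchy_product_sums) (auto simp: sums_iff)
  then show ?thesis
    using p_sums by (simp add: excursion_step_def[abs_def] stay_prob_def sums_iff)
qed

lemma excursion_summable_le_1: "summable (excursion b p k)" "stay_prob b p k \<le> 1"
proof (induction k)
  case 0
  have "excursion b p 0 = (\<lambda>y. if y = 0 then 1 else 0)" by (rule ext) (simp add: excursion.simps)
  then have "excursion b p 0 sums 1"
    using sums_single[of 0 "\<lambda>_. 1 :: real"] by simp
  case 1 show ?case using \<open>excursion b p 0 sums 1\<close> by (simp add: sums_iff)
  case 2 show ?case unfolding stay_prob_def
    using \<open>excursion b p 0 sums 1\<close> by (simp add: sums_iff)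
next
  case (Suc k)
  have step: "excursion_step b p k sums stay_prob b p k" by (rule excursion_step_sums) (rule Suc)
  have eq: "excursion b p (Suc k) = (\<lambda>y. excursion_step b p k (y + b))" by (simp add: excursion_Suc fun_eq_iff)
  have summ: "summable (excursion_step b p k)" using step by (simp add: sums_iff)
  case 1 show ?case unfolding eq by (rule summable_ignore_initial_segment) (rule summ)
  case 2
  \<comment> \<open>A step preserves the total mass, so the only loss is the mass killed below level
    0.\<close>
  have "stay_prob b p k = stay_prob b p (Suc k) + (\<Sum>j<b. excursion_step b p k j)"
    using suminf_split_initial_segment[OF summ, of b] step
    by (simp add: stay_prob_def eq sums_iff)
  moreover have "(\<Sum>j<b. excursion_step b p k j) \<ge> 0" by (intro sum_nonneg excursion_step_nonneg)
  ultimately show ?case using Suc by linarith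
qed

lemma stay_prob_nonneg: "stay_prob b p k \<ge> 0"
  unfolding stay_prob_def by (intro suminf_nonneg excursion_summable_le_1 excursion_nonneg)

context
  fixes z :: complex
  assumes z: "norm z \<le> 1"
begin

lemma norm_of_real_power_le: "c \<ge> 0 \<Longrightarrow> norm (of_real c * z ^ n) \<le> c"
  using power_le_one[OF norm_ge_zero z, of n]
  by (simp add: norm_mult norm_power mult_left_le)

lemma summable_pgf:
  assumes "summable f" "\<And>n. f n \<ge> 0"
  shows "summable (\<lambda>n. norm (of_real (f n) * z ^ n))"
  using assms by (intro summable_comparison_test'[OF assms(1)]) (auto intro: norm_of_real_power_le)

definition excursion_pgf :: "nat \<Rightarrow> complex" where
  "excursion_pgf k = (\<Sum>y. of_real (excursion b p k y) * z ^ y)"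

lemma norm_excursion_pgf_le: "norm (excursion_pgf k) \<le> 1"
proof -
  have "norm (excursion_pgf k) \<le> stay_prob b p k"
    unfolding excursion_pgf_def stay_prob_def
    by (intro norm_suminf_le norm_of_real_power_le excursion_nonneg excursion_summable_le_1)
  then show ?thesis using excursion_summable_le_1(2)[of k] by linarith
qed

text \<open>Adding a step is a convolution, hence a product of generating functions. The shift by
  \<open>b\<close> produces the factor \<open>z ^ b\<close>, and the first \<open>b\<close>
  coefficients, the overshoot below 0, are split off.\<close>

lemma excursion_pgf_Suc:
  "z ^ b * excursion_pgf (Suc k) + (\<Sum>j<b. of_real (excursion_step b p k j) * z ^ j) =
     excursion_pgf k * (\<Sum>n. of_real (p n) * z ^ n)"
proof -
  have "excursion_pgf k * (\<Sum>n. of_real (p n) * z ^ n) =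
      (\<Sum>n. \<Sum>x\<le>n. (of_real (excursion b p k x) * z ^ x) * (of_real (p (n - x)) * z ^ (n - x)))"
    unfolding excursion_pgf_def using p_sums excursion_summable_le_1 excursion_nonneg p_nonneg
    by (intro Cauchy_product summable_pgf) (auto simp: sums_iff)
  also have "\<dots> = (\<Sum>n. of_real (excursion_step b p k n) * z ^ n)"
  proof (intro suminf_cong)
    fix n
    have "(of_real (excursion b p k x) * z ^ x) * (of_real (p (n - x)) * z ^ (n - x)) =
        of_real (excursion b p k x * p (n - x)) * z ^ n" if "x \<le> n" for x
      using that by (simp flip: power_add)
    then show "(\<Sum>x\<le>n. (of_real (excursion b p k x) * z ^ x) * (of_real (p (n - x)) * z ^ (n - x))) =
        of_real (excursion_step b p k n) * z ^ n"
      unfolding excursion_step_def of_real_sum sum_distrib_right by (intro sum.cong refl) simp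
  qed
  also have "\<dots> = (\<Sum>n. of_real (excursion_step b p k (n + b)) * z ^ (n + b)) +
      (\<Sum>j<b. of_real (excursion_step b p k j) * z ^ j)"
    using excursion_step_sums[OF excursion_summable_le_1(1), of k] excursion_step_nonneg
    by (intro suminf_split_initial_segment summable_norm_cancel[OF summable_pgf]) (auto simp: sums_iff)
  also have "(\<Sum>n. of_real (excursion_step b p k (n + b)) * z ^ (n + b)) =
      (\<Sum>n. z ^ b * (of_real (excursion b p (Suc k) n) * z ^ n))"
    by (simp add: excursion_Suc power_add mult_ac)
  also have "\<dots> = z ^ b * excursion_pgf (Suc k)"
    unfolding excursion_pgf_def
    by (intro suminf_mult summable_norm_cancel[OF summable_pgf] excursion_summable_le_1 excursion_nonneg)
  finally show ?thesis by simp
qed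

text \<open>The one-step relation is multiplied by q^(k+1) and summed over k; the start at 0
  contributes \<open>z ^ b\<close>. All series converge since the generating functions are bounded
  by 1 in the closed unit disc, so any kernel root there is also a zero of the right-hand
  side.\<close>

lemma kernel_equation:
  fixes q :: complex
  assumes q: "norm q < 1"
  shows "(\<Sum>k. q ^ k * excursion_pgf k) * (z ^ b - q * (\<Sum>n. of_real (p n) * z ^ n)) =
    z ^ b - q * (\<Sum>j<b. (\<Sum>k. q ^ k * of_real (excursion_step b p k j)) * z ^ j)"
proof -
  define G where "G = (\<lambda>k. q ^ k * excursion_pgf k)"
  define a where "a = (\<lambda>j k. q ^ k * complex_of_real (excursion_step b p k j))"
  define P where "P = (\<Sum>n. of_real (p n) * z ^ n)"
  have geo: "summable (\<lambda>k. norm q ^ k)" using q by (intro summable_geometric) auto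
  have G: "summable G"
    unfolding G_def
    by (rule summable_comparison_test'[OF geo])
       (simp add: norm_mult norm_power mult_left_le norm_excursion_pgf_le)
  have step_le: "excursion_step b p k j \<le> 1" for j k
  proof -
    have "excursion_step b p k j \<le> stay_prob b p k"
      using sum_le_suminf[of "excursion_step b p k" "{j}"]
        excursion_step_sums[OF excursion_summable_le_1(1), of k] excursion_step_nonneg
      by (simp add: sums_iff)
    then show ?thesis using excursion_summable_le_1(2)[of k] by linarith
  qed
  have a: "summable (a j)" for j
    unfolding a_def
    by (rule summable_comparison_test'[OF geo])
       (simp add: norm_mult norm_power mult_left_le step_le excursion_step_nonneg)
  have G0: "G 0 = 1"
  proof -
    have "excursion_pgf 0 = (\<Sum>y. if y = 0 then 1 else 0)"
      unfolding excursion_pgf_def by (intro suminf_cong) (auto simp: excursion.simps)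
    then show ?thesis
      using sums_unique[OF sums_single[of 0 "\<lambda>_. 1 :: complex"]] by (simp add: G_def)
  qed
  have rec: "z ^ b * G (Suc k) + q * (\<Sum>j<b. a j k * z ^ j) = q * P * G k" for k
  proof -
    have "z ^ b * G (Suc k) + q * (\<Sum>j<b. a j k * z ^ j) =
        q ^ Suc k * (z ^ b * excursion_pgf (Suc k) + (\<Sum>j<b. of_real (excursion_step b p k j) * z ^ j))"
      by (simp add: G_def a_def sum_distrib_left algebra_simps)
    also have "\<dots> = q * P * G k" unfolding excursion_pgf_Suc by (simp add: G_def P_def)
    finally show ?thesis .
  qed
  have "(\<lambda>k. z ^ b * G (Suc k) + q * (\<Sum>j<b. a j k * z ^ j)) sums
      (z ^ b * (suminf G - G 0) + q * (\<Sum>j<b. suminf (a j) * z ^ j))"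
    by (intro sums_add sums_mult sums_sum sums_mult2 summable_sums[OF a])
       (use G in \<open>simp add: sums_Suc_iff summable_sums\<close>)
  moreover have "(\<lambda>k. z ^ b * G (Suc k) + q * (\<Sum>j<b. a j k * z ^ j)) sums (q * P * suminf G)"
    unfolding rec by (intro sums_mult summable_sums G)
  ultimately have "z ^ b * (suminf G - G 0) + q * (\<Sum>j<b. suminf (a j) * z ^ j) = q * P * suminf G"
    by (rule sums_unique2)
  then have "suminf G * (z ^ b - q * P) = z ^ b - q * (\<Sum>j<b. suminf (a j) * z ^ j)"
    unfolding G0 by (simp add: algebra_simps)
  then show ?thesis by (simp only: G_def a_def P_def)
qed

end

lemma kernel_roots:
  fixes q :: complex and r :: "nat \<Rightarrow> complex"
  assumes b: "b \<ge> 1" and q: "norm q < 1"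
    and r: "\<And>l. l < b \<Longrightarrow> norm (r l) \<le> 1" "inj_on r {..<b}"
      "\<And>l. l < b \<Longrightarrow> r l ^ b = q * (\<Sum>n. of_real (p n) * r l ^ n)"
  shows "(1 - q) * (\<Sum>k. of_real (stay_prob b p k) * q ^ k) = (\<Prod>l<b. 1 - r l)"
proof -
  define R where "R = (\<lambda>j. \<Sum>k. q ^ k * complex_of_real (excursion_step b p k j))"
  define S where "S = (\<Sum>j<b. monom (R j) j)"
  define Q where "Q = monom 1 b - smult q S"
  have poly_Q: "poly Q z = z ^ b - q * (\<Sum>j<b. R j * z ^ j)" for z
    by (simp add: Q_def S_def poly_monom poly_sum)
  define W where "W = (\<Prod>l<b. [:- r l, 1:])"
  have W: "degree W = b" "coeff W b = 1"
  proof -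
    show "degree W = b"
      unfolding W_def by (subst degree_prod_eq_sum_degree) auto
    then show "coeff W b = 1"
      using lead_coeff_prod[of "\<lambda>l. [:- r l, 1:]" "{..<b}"] by (simp add: W_def)
  qed
  have coeff_S: "coeff S i = 0" if "i \<ge> b" for i
    using that by (simp add: S_def coeff_sum)
  have "coeff (Q - W) i = 0" if "i \<ge> b" for i
    using that coeff_S[OF that] W coeff_eq_0[of W i]
    by (cases "i = b") (auto simp: Q_def)
  \<comment> \<open>Both polynomials are monic of degree \<open>b\<close>, so the difference has
    lower degree, and the \<open>b\<close> distinct roots force it to vanish.\<close>
  then have deg: "degree (Q - W) < b"
    using b by (metis degree_le le_degree leading_coeff_0_iff degree_0 less_le_trans linorder_not_less zero_less_one)
  have "Q - W = 0"
  proof (rule poly_eqI_degree[where A = "r ` {..<b}"])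
    fix x assume "x \<in> r ` {..<b}"
    then obtain l where l: "l < b" "x = r l" by auto
    have "poly Q (r l) = 0"
      using kernel_equation[OF r(1)[OF l(1)] q] r(3)[OF l(1)] unfolding poly_Q R_def by simp
    moreover have "poly W (r l) = 0" using l by (auto simp: W_def poly_prod)
    ultimately show "poly (Q - W) x = poly 0 x" using l by simp
  qed (use deg b card_image[OF r(2)] in auto)
  then have "poly Q 1 = (\<Prod>l<b. 1 - r l)" by (simp add: W_def poly_prod)
  \<comment> \<open>At z = 1 the kernel reduces to 1 - q, because the step probabilities add up to
    1.\<close>
  moreover have "(\<Sum>k. q ^ k * excursion_pgf 1 k) * (1 - q) = poly Q 1"
    using kernel_equation[of 1, OF _ q] p_sums
    by (simp add: poly_Q R_def sums_iff flip: suminf_of_real)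
  moreover have "excursion_pgf 1 k = of_real (stay_prob b p k)" for k
    using excursion_summable_le_1(1)[of k]
    by (subst excursion_pgf_def) (simp_all add: stay_prob_def suminf_of_real)
  ultimately show ?thesis by (simp add: mult.commute)
qed

end

section \<open>Poisson steps and the roots of their kernel\<close>

lemma pmf_poisson_sums:
  assumes "r > 0"
  shows "pmf (poisson_pmf r) sums 1"
proof -
  have "(\<lambda>n. r ^ n /\<^sub>R fact n) sums exp r" by (rule exp_converges)
  from sums_mult2[OF this, of "exp (-r)"]
  have "(\<lambda>n. r ^ n / fact n * exp (-r)) sums 1"
    by (simp add: field_simps flip: exp_add)
  moreover have "pmf (poisson_pmf r) = (\<lambda>n. r ^ n / fact n * exp (-r))"
    using assms by (intro ext) simp
  ultimately show ?thesis by simp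
qed

lemma poisson_pgf:
  assumes "r > 0"
  shows "(\<lambda>n. of_real (pmf (poisson_pmf r) n) * (z :: 'a :: {banach,real_normed_field}) ^ n) sums exp (of_real r * (z - 1))"
proof -
  have "(\<lambda>n. (of_real r * z) ^ n /\<^sub>R fact n) sums exp (of_real r * z)" by (rule exp_converges)
  from sums_mult2[OF this, of "of_real (exp (-r))"] have
    "(\<lambda>n. (of_real r * z) ^ n /\<^sub>R fact n * of_real (exp (-r))) sums (exp (of_real r * z) * of_real (exp (-r)))" .
  also have "exp (of_real r * z) * of_real (exp (-r)) = exp (of_real r * (z - 1))"
    by (simp add: right_diff_distrib exp_diff exp_minus field_simps exp_of_real[symmetric])
  finally show ?thesis
    using assms by (simp add: scaleR_conv_of_real power_mult_distrib field_simps)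
qed

lemma inj_on_root_of_unity_power:
  assumes "b \<ge> 1"
  shows "inj_on (\<lambda>l. exp (2 * of_real pi * \<i> / of_nat b) ^ l :: complex) {..<b}"
proof -
  have "exp (2 * of_real pi * \<i> / of_nat b) ^ l = exp (2 * of_real pi * \<i> * of_nat l / of_nat b)" for l
    by (simp add: mult_ac flip: exp_of_nat_mult)
  then show ?thesis
    using bij_betw_roots_unity[of b] assms by (simp add: bij_betw_def)
qed

text \<open>With c = \<alpha> e^(-\<alpha>), rewriting the functional equation as T = \<omega>^l c y
  e^T, dividing by \<alpha> and taking b-th powers removes \<omega> and leaves the kernel equation
  for T / \<alpha>. The modulus is at most T(c) / \<alpha> = 1. Injectivity of T and
  \<open>y \<noteq> 0\<close> make the roots distinct; at 0 they would all coincide.\<close>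

lemma stay_prob_gf:
  fixes y :: complex
  assumes b: "b \<ge> 1" and \<alpha>: "0 < \<alpha>" "\<alpha> < 1" and y: "y \<noteq> 0" "norm y < 1"
  defines "\<omega> \<equiv> exp (2 * of_real pi * \<i> / of_nat b)"
  shows "(1 - y ^ b) * (\<Sum>k. of_real (stay_prob b (pmf (poisson_pmf (\<alpha> * b))) k) * (y ^ b) ^ k) =
    (\<Prod>l<b. 1 - tree_fun (\<omega> ^ l * of_real (\<alpha> * exp (-\<alpha>)) * y) / of_real \<alpha>)"
proof (rule kernel_roots)
  define c where "c = \<alpha> * exp (-\<alpha>)"
  have c: "0 < c" "c < exp (-1)"
    using mult_exp_uminus_strict_mono[of \<alpha> 1] \<alpha> by (auto simp: c_def)
  have \<omega>: "norm \<omega> = 1" "\<omega> ^ b = 1"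
    using b by (simp_all add: \<omega>_def norm_exp_eq_Re flip: exp_of_nat_mult)
  have norm_arg: "norm (\<omega> ^ l * of_real c * y) \<le> c" for l
    using c y mult_left_le[of "norm y" c] by (simp add: norm_mult norm_power \<omega>)
  show "norm (y ^ b) < 1" using y b by (simp add: norm_power power_less_one_iff)
  show "norm (tree_fun (\<omega> ^ l * of_real (\<alpha> * exp (-\<alpha>)) * y) / of_real \<alpha>) \<le> 1" for l
    using norm_tree_fun_le[OF norm_arg[of l] c(2)] real_tree_fun_inverse[of \<alpha>] \<alpha>
    by (simp add: norm_divide flip: c_def)
  show "inj_on (\<lambda>l. tree_fun (\<omega> ^ l * of_real (\<alpha> * exp (-\<alpha>)) * y) / of_real \<alpha>) {..<b}"
  proof (rule inj_onI)
    fix l l' assume l: "l \<in> {..<b}" "l' \<in> {..<b}"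
      and eq: "tree_fun (\<omega> ^ l * of_real (\<alpha> * exp (-\<alpha>)) * y) / of_real \<alpha> =
        tree_fun (\<omega> ^ l' * of_real (\<alpha> * exp (-\<alpha>)) * y) / of_real \<alpha>"
    have "\<omega> ^ l * of_real c * y = \<omega> ^ l' * of_real c * y"
      by (rule inj_onD[OF tree_fun_inj]) (use eq norm_arg c \<alpha> in \<open>auto simp flip: c_def intro: le_less_trans\<close>)
    then have "\<omega> ^ l = \<omega> ^ l'" using c y by simp
    then show "l = l'" using inj_on_root_of_unity_power[OF b] l by (auto simp: \<omega>_def inj_on_def)
  qed
  show "(tree_fun (\<omega> ^ l * of_real (\<alpha> * exp (-\<alpha>)) * y) / of_real \<alpha>) ^ b = y ^ b *
    (\<Sum>n. of_real (pmf (poisson_pmf (\<alpha> * b)) n) * (tree_fun (\<omega> ^ l * of_real (\<alpha> * exp (-\<alpha>)) * y) / of_real \<alpha>) ^ n)" for l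
  proof -
    define T where "T = tree_fun (\<omega> ^ l * of_real c * y)"
    have "T * exp (-T) = \<omega> ^ l * of_real c * y"
      unfolding T_def by (rule tree_fun_functional_eq) (use norm_arg c in \<open>auto intro: le_less_trans\<close>)
    then have "T * exp (-T) * exp T = \<omega> ^ l * of_real c * y * exp T" by simp
    then have "T = \<omega> ^ l * of_real c * y * exp T" by (simp add: mult.assoc flip: exp_add)
    then have "T / of_real \<alpha> = \<omega> ^ l * y * exp (T - of_real \<alpha>)"
      using \<alpha> by (simp add: c_def exp_diff exp_minus exp_of_real[symmetric] field_simps)
    then have "(T / of_real \<alpha>) ^ b = (\<omega> ^ b) ^ l * y ^ b * exp (T - of_real \<alpha>) ^ b"
      by (metis power_mult_distrib power_mult mult.commute)
    also have "\<dots> = y ^ b * exp (of_nat b * (T - of_real \<alpha>))" by (simp add: \<omega> exp_of_nat_mult)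
    also have "of_nat b * (T - of_real \<alpha>) = of_real (\<alpha> * b) * (T / of_real \<alpha> - 1)"
      using \<alpha> by (simp add: field_simps)
    also have "exp \<dots> = (\<Sum>n. of_real (pmf (poisson_pmf (\<alpha> * b)) n) * (T / of_real \<alpha>) ^ n)"
      by (rule sums_unique[OF poisson_pgf]) (use \<alpha> b in auto)
    finally show ?thesis by (simp add: T_def c_def)
  qed
qed (use b \<alpha> pmf_poisson_sums[of "\<alpha> * b"] in auto)

section \<open>The Poisson model\<close>

lemma distr_nat_eq_density:
  fixes U :: "'a \<Rightarrow> nat"
  assumes U: "U \<in> M \<rightarrow>\<^sub>M count_space UNIV" and "prob_space M"
  shows "distr M (count_space UNIV) U =
    density (count_space UNIV) (\<lambda>k. ennreal (measure M {w \<in> space M. U w = k}))"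
proof (rule measure_eqI_countable[where A = UNIV])
  interpret prob_space M by fact
  fix k :: nat
  have eq: "U -` {k} \<inter> space M = {w \<in> space M. U w = k}" by auto
  show "emeasure (distr M (count_space UNIV) U) {k} =
      emeasure (density (count_space UNIV) (\<lambda>k. ennreal (measure M {w \<in> space M. U w = k}))) {k}"
    using U by (simp add: emeasure_distr emeasure_density nn_integral_count_space_indicator[symmetric] eq emeasure_eq_measure)
qed auto

text \<open>Integrals over either model become series in the point probabilities, so that the
  underlying probability spaces need not be related to each other.\<close>

lemma nat_rv_integral:
  fixes U :: "'a \<Rightarrow> nat" and f :: "nat \<Rightarrow> 'b :: {banach, second_countable_topology}"
  assumes U: "U \<in> M \<rightarrow>\<^sub>M count_space UNIV" and M: "prob_space M"
  shows "integrable M (\<lambda>w. f (U w)) \<longleftrightarrow> summable (\<lambda>k. measure M {w \<in> space M. U w = k} * norm (f k))"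
    and "integrable M (\<lambda>w. f (U w)) \<Longrightarrow>
      (\<integral>w. f (U w) \<partial>M) = (\<Sum>k. measure M {w \<in> space M. U w = k} *\<^sub>R f k)"
proof -
  let ?p = "\<lambda>k. measure M {w \<in> space M. U w = k}"
  have "integrable M (\<lambda>w. f (U w)) \<longleftrightarrow> integrable (distr M (count_space UNIV) U) f"
    using U by (subst integrable_distr_eq) auto
  also have "\<dots> \<longleftrightarrow> integrable (count_space UNIV) (\<lambda>k. ?p k *\<^sub>R f k)"
    unfolding distr_nat_eq_density[OF assms] by (subst integrable_density) auto
  finally have *: "integrable M (\<lambda>w. f (U w)) \<longleftrightarrow> integrable (count_space UNIV) (\<lambda>k. ?p k *\<^sub>R f k)" .
  then show "integrable M (\<lambda>w. f (U w)) \<longleftrightarrow> summable (\<lambda>k. ?p k * norm (f k))"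
    by (simp add: integrable_count_space_nat_iff)
  assume "integrable M (\<lambda>w. f (U w))"
  have "(\<integral>w. f (U w) \<partial>M) = (\<integral>k. f k \<partial>distr M (count_space UNIV) U)"
    using U by (subst integral_distr) auto
  also have "\<dots> = (\<integral>k. ?p k *\<^sub>R f k \<partial>count_space UNIV)"
    unfolding distr_nat_eq_density[OF assms] by (subst integral_density) auto
  also have "\<dots> = (\<Sum>k. ?p k *\<^sub>R f k)"
    using * \<open>integrable M _\<close> by (intro integral_count_space_nat) auto
  finally show "(\<integral>w. f (U w) \<partial>M) = (\<Sum>k. ?p k *\<^sub>R f k)" .
qed

abbreviation nat_seqs :: "int set \<Rightarrow> (int \<Rightarrow> nat) measure" where
  "nat_seqs I \<equiv> PiM I (\<lambda>_. count_space UNIV)"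

lemma measurable_window:
  assumes "\<And>t. t < l \<Longrightarrow> i - int t \<in> I"
  shows "(\<lambda>y. window y i l) \<in> nat_seqs I \<rightarrow>\<^sub>M count_space UNIV"
  unfolding window_def
  by (intro measurable_sum_nat measurable_component_singleton assms) auto

lemma measurable_full:
  assumes "{..i} \<subseteq> I"
  shows "Measurable.pred (nat_seqs I) (\<lambda>y. full b y i)"
proof -
  have [measurable]: "(\<lambda>y. window y i l) \<in> nat_seqs I \<rightarrow>\<^sub>M count_space UNIV" for l
    by (rule measurable_window) (use assms in auto)
  show ?thesis unfolding full_def by measurable
qed

lemma (in prob_space) indep_vars_reindex:
  assumes "indep_vars N X I" "inj_on g J" "g ` J \<subseteq> I"
  shows "indep_vars (\<lambda>j. N (g j)) (\<lambda>j. X (g j)) J"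
  unfolding indep_vars_def2
proof (intro conjI ballI)
  show "random_variable (N (g j)) (X (g j))" if "j \<in> J" for j
    using assms that unfolding indep_vars_def2 by blast
  show "indep_sets (\<lambda>j. {X (g j) -` A \<inter> space M |A. A \<in> sets (N (g j))}) J"
  proof (rule indep_setsI)
    fix j assume "j \<in> J"
    then show "{X (g j) -` A \<inter> space M |A. A \<in> sets (N (g j))} \<subseteq> events"
      using assms unfolding indep_vars_def2 by (auto intro: measurable_sets)
  next
    fix A K assume K: "K \<noteq> {}" "K \<subseteq> J" "finite K"
      and A: "\<forall>j\<in>K. A j \<in> {X (g j) -` A \<inter> space M |A. A \<in> sets (N (g j))}"
    define h where "h = the_inv_into K g"
    have inj: "inj_on g K" using assms K inj_on_subset by blast
    have h: "h (g j) = j" if "j \<in> K" for j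
      unfolding h_def using the_inv_into_f_f[OF inj that] .
    have "prob (\<Inter>i\<in>g ` K. A (h i)) = (\<Prod>i\<in>g ` K. prob (A (h i)))"
    proof (rule indep_setsD[where F = "\<lambda>i. {X i -` A \<inter> space M |A. A \<in> sets (N i)}" and I = I])
      show "\<forall>i\<in>g ` K. A (h i) \<in> {X i -` A \<inter> space M |A. A \<in> sets (N i)}"
        using A h by auto
    qed (use assms K in \<open>auto simp: indep_vars_def2\<close>)
    then show "prob (\<Inter>j\<in>K. A j) = (\<Prod>j\<in>K. prob (A j))"
      using h by (simp add: prod.reindex[OF inj] cong: prod.cong INF_cong)
  qed
qed

lemma full_restrict: "{..i} \<subseteq> I \<Longrightarrow> full b (restrict y I) i \<longleftrightarrow> full b y i"
proof -
  assume "{..i} \<subseteq> I"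
  then have "window (restrict y I) i l = window y i l" for l
    by (intro window_cong) (auto simp: subset_eq)
  then show ?thesis by (simp add: full_def)
qed

lemma window_restrict:
  "(\<And>t. t < l \<Longrightarrow> i - int t \<in> I) \<Longrightarrow> window (restrict y I) i l = window y i l"
  by (intro window_cong) auto

text \<open>The infinite model with an arbitrary mean load \<open>r\<close>. Stability enters only
  through a bound \<phi> < 1 on the Chernoff ratio \<open>exp (r * (z - 1)) / z ^ b\<close>.\<close>

locale poisson_counts = prob_space M for M :: "'w measure" +
  fixes X :: "int \<Rightarrow> 'w \<Rightarrow> nat" and r :: real
  assumes indep_X: "indep_vars (\<lambda>_. count_space UNIV) X UNIV"
    and distr_X: "distr M (count_space UNIV) (X i) = measure_pmf (poisson_pmf r)"
    and r_pos: "r > 0"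
begin

lemma measurable_X [measurable]: "X i \<in> M \<rightarrow>\<^sub>M count_space UNIV"
  using indep_X unfolding indep_vars_def2 by blast

lemma measurable_seq [measurable]: "(\<lambda>w i. X i w) \<in> M \<rightarrow>\<^sub>M nat_seqs UNIV"
  by (rule measurable_PiM_single') auto

lemma prob_X: "prob {w \<in> space M. X i w = n} = pmf (poisson_pmf r) n"
proof -
  have "prob {w \<in> space M. X i w = n} = measure (distr M (count_space UNIV) (X i)) {n}"
    by (subst measure_distr) (auto intro!: arg_cong[where f = prob])
  then show ?thesis by (simp add: distr_X measure_pmf_single)
qed

lemma distr_seq: "distr M (nat_seqs UNIV) (\<lambda>w i. X i w) = PiM UNIV (\<lambda>_. measure_pmf (poisson_pmf r))"
  using indep_vars_iff_distr_eq_PiM'[where I = UNIV and M' = "\<lambda>_. count_space UNIV" and X = X] indep_X distr_X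
  by (simp add: restrict_UNIV)

lemma poisson_counts_shift: "poisson_counts M (\<lambda>i. X (c + i)) r"
proof
  show "indep_vars (\<lambda>_. count_space UNIV) (\<lambda>i. X (c + i)) UNIV"
    by (rule indep_vars_reindex[OF indep_X]) (auto intro: injI)
qed (use distr_X r_pos in auto)

lemma prob_shift:
  assumes [measurable]: "Measurable.pred (nat_seqs UNIV) P"
  shows "prob {w \<in> space M. P (\<lambda>i. X (c + i) w)} = prob {w \<in> space M. P (\<lambda>i. X i w)}"
proof -
  interpret S: poisson_counts M "\<lambda>i. X (c + i)" r by (rule poisson_counts_shift)
  have "prob {w \<in> space M. P (\<lambda>i. Y i w)} = measure (distr M (nat_seqs UNIV) (\<lambda>w i. Y i w)) {y. P y}"
    if [measurable]: "(\<lambda>w i. Y i w) \<in> M \<rightarrow>\<^sub>M nat_seqs UNIV" for Y :: "int \<Rightarrow> 'w \<Rightarrow> nat"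
  proof (subst measure_distr)
    show "{y. P y} \<in> sets (nat_seqs UNIV)"
      using assms by (simp add: pred_def space_PiM)
  qed (auto intro!: arg_cong[where f = prob])
  from this[OF S.measurable_seq] this[OF measurable_seq] show ?thesis
    by (simp add: distr_seq S.distr_seq)
qed

text \<open>\<open>P\<close> and \<open>Q\<close> are predicates on whole sequences; the two
  restriction conditions say that they look only at the coordinates in \<open>I\<close> and
  \<open>J\<close>, so independence of disjoint blocks of coordinates applies.\<close>

lemma prob_indep_split:
  assumes "I \<inter> J = {}" "Measurable.pred (nat_seqs I) P" "Measurable.pred (nat_seqs J) Q"
    and "\<And>y. P (restrict y I) = P y" "\<And>y. Q (restrict y J) = Q y"
  shows "prob {w \<in> space M. P (\<lambda>i. X i w) \<and> Q (\<lambda>i. X i w)} =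
    prob {w \<in> space M. P (\<lambda>i. X i w)} * prob {w \<in> space M. Q (\<lambda>i. X i w)}"
proof -
  let ?A = "{y \<in> space (nat_seqs I). P y}" and ?B = "{y \<in> space (nat_seqs J). Q y}"
  let ?X = "\<lambda>w. restrict (\<lambda>i. X i w) I" and ?Y = "\<lambda>w. restrict (\<lambda>i. X i w) J"
  have sp: "?X w \<in> space (nat_seqs I)" "?Y w \<in> space (nat_seqs J)" for w
    by (auto simp: space_PiM)
  have "prob ((\<lambda>w. (?X w, ?Y w)) -` (?A \<times> ?B) \<inter> space M) = prob (?X -` ?A \<inter> space M) * prob (?Y -` ?B \<inter> space M)"
    by (rule indep_varD[OF indep_var_restrict[OF indep_X]]) (use assms in \<open>auto simp: pred_def\<close>)
  moreover have "(\<lambda>w. (?X w, ?Y w)) -` (?A \<times> ?B) \<inter> space M = {w \<in> space M. P (\<lambda>i. X i w) \<and> Q (\<lambda>i. X i w)}"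
    using sp assms(4,5) by auto
  moreover have "?X -` ?A \<inter> space M = {w \<in> space M. P (\<lambda>i. X i w)}"
    using sp assms(4) by auto
  moreover have "?Y -` ?B \<inter> space M = {w \<in> space M. Q (\<lambda>i. X i w)}"
    using sp assms(5) by auto
  ultimately show ?thesis by simp
qed

lemma measurable_full_X [measurable]: "Measurable.pred M (\<lambda>w. full b (\<lambda>i. X i w) i)"
  using measurable_compose[OF measurable_seq measurable_full[of i UNIV]] by simp

lemma measurable_window_X [measurable]: "(\<lambda>w. window (\<lambda>i. X i w) i l) \<in> M \<rightarrow>\<^sub>M count_space UNIV"
  using measurable_compose[OF measurable_seq measurable_window[of l i UNIV]] by simp

lemma expectation_power_X:
  assumes "z \<ge> 0"
  shows "integrable M (\<lambda>w. z ^ X i w)" "expectation (\<lambda>w. z ^ X i w) = exp (r * (z - 1))"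
proof -
  have s: "(\<lambda>n. pmf (poisson_pmf r) n * z ^ n) sums exp (r * (z - 1))"
    using poisson_pgf[OF r_pos, of z] by simp
  show *: "integrable M (\<lambda>w. z ^ X i w)"
    using assms by (subst nat_rv_integral(1)[OF measurable_X]) (use s in \<open>auto simp: prob_X sums_iff prob_space_axioms simp del: pmf_poisson\<close>)
  show "expectation (\<lambda>w. z ^ X i w) = exp (r * (z - 1))"
    by (subst nat_rv_integral(2)[OF measurable_X]) (use s * in \<open>auto simp: prob_X sums_iff prob_space_axioms simp del: pmf_poisson\<close>)
qed

lemma expectation_power_window:
  assumes "z \<ge> 0"
  shows "integrable M (\<lambda>w. z ^ window (\<lambda>i. X i w) i l)"
    "expectation (\<lambda>w. z ^ window (\<lambda>i. X i w) i l) = exp (r * (z - 1)) ^ l"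
proof -
  have ind: "indep_vars (\<lambda>_. borel) (\<lambda>t w. z ^ X (i - int t) w) {..<l}"
    by (rule indep_vars_compose2[OF indep_vars_reindex[OF indep_X]]) (auto simp: inj_on_def)
  have eq: "(\<lambda>w. z ^ window (\<lambda>i. X i w) i l) = (\<lambda>w. \<Prod>t<l. z ^ X (i - int t) w)"
    by (simp add: window_def power_sum)
  show "integrable M (\<lambda>w. z ^ window (\<lambda>i. X i w) i l)"
    unfolding eq by (rule indep_vars_integrable[OF _ ind]) (use expectation_power_X assms in auto)
  show "expectation (\<lambda>w. z ^ window (\<lambda>i. X i w) i l) = exp (r * (z - 1)) ^ l"
    unfolding eq by (subst indep_vars_lebesgue_integral[OF _ ind]) (use expectation_power_X assms in auto)
qed

text \<open>Markov's inequality for \<open>z ^ window\<close>: each bucket contributes a factor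
  \<open>exp (r * (z - 1))\<close> to the expectation, and the threshold contributes
  \<open>z ^ b\<close> per bucket.\<close>

lemma window_tail:
  assumes "z \<ge> 1"
  shows "prob {w \<in> space M. b * l \<le> window (\<lambda>i. X i w) i l} \<le> (exp (r * (z - 1)) / z ^ b) ^ l"
proof -
  have "prob {w \<in> space M. b * l \<le> window (\<lambda>i. X i w) i l} \<le>
      prob {w \<in> space M. z ^ (b * l) \<le> z ^ window (\<lambda>i. X i w) i l}"
    using assms by (intro finite_measure_mono) (auto intro: power_increasing)
  also have "\<dots> \<le> expectation (\<lambda>w. z ^ window (\<lambda>i. X i w) i l) / z ^ (b * l)"
    using assms by (intro integral_Markov_inequality_measure[where A = "{}"] expectation_power_window) auto
  also have "\<dots> = (exp (r * (z - 1)) / z ^ b) ^ l"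
    using assms by (simp add: expectation_power_window power_mult power_divide)
  finally show ?thesis .
qed

lemma windows_tail:
  assumes "z \<ge> 1" and "exp (r * (z - 1)) / z ^ b \<le> \<phi>" "\<phi> < 1"
  shows "prob {w \<in> space M. \<exists>l\<ge>k. b * l \<le> window (\<lambda>i. X i w) i l} \<le> \<phi> ^ k / (1 - \<phi>)"
proof -
  let ?A = "\<lambda>l. {w \<in> space M. b * (l + k) \<le> window (\<lambda>i. X i w) i (l + k)}"
  have "exp (r * (z - 1)) / z ^ b \<ge> 0" using assms(1) by simp
  then have \<phi>: "\<phi> \<ge> 0" using assms(2) by linarith
  have le: "prob (?A l) \<le> \<phi> ^ k * \<phi> ^ l" for l
  proof -
    have "(exp (r * (z - 1)) / z ^ b) ^ (l + k) \<le> \<phi> ^ (l + k)"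
      using assms by (intro power_mono) auto
    then show ?thesis
      using window_tail[OF assms(1), of b "l + k" i] by (simp add: power_add mult.commute)
  qed
  have geo: "(\<lambda>l. \<phi> ^ k * \<phi> ^ l) sums (\<phi> ^ k * (1 / (1 - \<phi>)))"
    using \<phi> assms(3) by (intro sums_mult geometric_sums) auto
  have ev: "?A l \<in> events" for l by measurable
  have summ: "summable (\<lambda>l. prob (?A l))"
    by (rule summable_comparison_test'[OF sums_summable[OF geo]]) (use le in auto)
  have "{w \<in> space M. \<exists>l\<ge>k. b * l \<le> window (\<lambda>i. X i w) i l} = (\<Union>l. ?A l)"
    by (auto simp: le_iff_add add.commute[of k])
  then have "prob {w \<in> space M. \<exists>l\<ge>k. b * l \<le> window (\<lambda>i. X i w) i l} \<le> (\<Sum>l. prob (?A l))"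
    using finite_measure_subadditive_countably[OF _ summ] ev by (simp add: image_subset_iff)
  also have "\<dots> \<le> (\<Sum>l. \<phi> ^ k * \<phi> ^ l)"
    by (intro suminf_le summ sums_summable[OF geo] le)
  also have "\<dots> = \<phi> ^ k / (1 - \<phi>)" using geo by (simp add: sums_iff)
  finally show ?thesis .
qed

text \<open>A run of \<open>k\<close> full buckets forces an overloaded window of length at least
  \<open>k\<close> ending at its last bucket, so a single union bound over the lengths
  suffices.\<close>

lemma full_run_tail:
  assumes "z \<ge> 1" and "exp (r * (z - 1)) / z ^ b \<le> \<phi>" "\<phi> < 1"
  shows "prob {w \<in> space M. \<forall>i<k. full b (\<lambda>i. X i w) (int i)} \<le> \<phi> ^ k / (1 - \<phi>)"
proof (cases "k = 0")
  case True
  have "exp (r * (z - 1)) / z ^ b \<ge> 0" using assms(1) by simp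
  then have "\<phi> \<ge> 0" using assms(2) by linarith
  then show ?thesis using True assms(3) by (simp add: prob_space)
next
  case False
  have "prob {w \<in> space M. \<forall>i<k. full b (\<lambda>i. X i w) (int i)} \<le>
      prob {w \<in> space M. \<exists>l\<ge>k. b * l \<le> window (\<lambda>i. X i w) (int (k - 1)) l}"
  proof (intro finite_measure_mono subsetI CollectI conjI)
    fix w assume w: "w \<in> {w \<in> space M. \<forall>i<k. full b (\<lambda>i. X i w) (int i)}"
    show "\<exists>l\<ge>k. b * l \<le> window (\<lambda>i. X i w) (int (k - 1)) l"
    proof (rule full_run_window)
      show "full b (\<lambda>i. X i w) (int (k - 1) - int i)" if "i < k" for i
      proof -
        have "int (k - 1) - int i = int (k - 1 - i)" using that by simp
        moreover have "full b (\<lambda>i. X i w) (int (k - 1 - i))" using w False by simp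
        ultimately show ?thesis by simp
      qed
    qed (use False in auto)
  qed auto
  also have "\<dots> \<le> \<phi> ^ k / (1 - \<phi>)" by (rule windows_tail) (use assms in auto)
  finally show ?thesis .
qed

lemma AE_nonfull:
  assumes "z \<ge> 1" and "exp (r * (z - 1)) / z ^ b \<le> \<phi>" "\<phi> < 1"
  shows "AE w in M. \<exists>k. \<not> full b (\<lambda>i. X i w) (int k)"
proof -
  let ?A = "{w \<in> space M. \<forall>k. full b (\<lambda>i. X i w) (int k)}"
  have "exp (r * (z - 1)) / z ^ b \<ge> 0" using assms(1) by simp
  then have \<phi>: "\<phi> \<ge> 0" using assms(2) by linarith
  have "prob ?A \<le> \<phi> ^ k / (1 - \<phi>)" for k
  proof -
    have "prob ?A \<le> prob {w \<in> space M. \<forall>i<k. full b (\<lambda>i. X i w) (int i)}"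
      by (intro finite_measure_mono) auto
    also have "\<dots> \<le> \<phi> ^ k / (1 - \<phi>)" by (rule full_run_tail[OF assms])
    finally show ?thesis .
  qed
  moreover have "(\<lambda>k. \<phi> ^ k / (1 - \<phi>)) \<longlonglongrightarrow> 0 / (1 - \<phi>)"
    using assms \<phi> by (intro tendsto_intros LIMSEQ_realpow_zero) auto
  ultimately have "prob ?A \<le> 0"
    by (intro LIMSEQ_le_const[where X = "\<lambda>k. \<phi> ^ k / (1 - \<phi>)"]) auto
  then have "prob ?A = 0" by (simp add: measure_le_0_iff)
  then have "AE w in M. w \<notin> ?A"
    by (intro AE_not_in) (auto simp: null_sets_def emeasure_eq_measure)
  then show ?thesis by (rule AE_mp) (auto intro!: AE_I2)
qed

text \<open>The window of length i ending at bucket i covers buckets 1 to i, and its content minus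
  \<open>b * i\<close> is the position of the walk after i steps. For the recursion the event is
  split by the position x one step earlier, which depends on buckets 1 to k and is independent of
  the last count.\<close>

lemma prob_excursion:
  "prob {w \<in> space M. (\<forall>i\<in>{1..k}. b * i \<le> window (\<lambda>i. X i w) (int i) i) \<and>
      window (\<lambda>i. X i w) (int k) k = b * k + y} = excursion b (pmf (poisson_pmf r)) k y"
proof (induction k arbitrary: y)
  case 0
  show ?case by (cases "y = 0") (simp_all add: window_def excursion.simps prob_space)
next
  case (Suc k)
  let ?W = "\<lambda>w i. window (\<lambda>i. X i w) (int i) i"
  define P where "P = (\<lambda>x y. (\<forall>i\<in>{1..k}. b * i \<le> window y (int i) i) \<and> window y (int k) k = b * k + x)"
  let ?E = "\<lambda>x. {w \<in> space M. P x (\<lambda>i. X i w) \<and> X (1 + int k) w = y + b - x}"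
  have W_Suc: "?W w (Suc k) = X (1 + int k) w + ?W w k" for w
    using window_Suc_right[of "\<lambda>i. X i w" "int (Suc k)" k] by simp
  have eq: "{w \<in> space M. (\<forall>i\<in>{1..Suc k}. b * i \<le> ?W w i) \<and> ?W w (Suc k) = b * Suc k + y} = (\<Union>x\<le>y + b. ?E x)"
  proof (intro set_eqI iffI)
    fix w assume "w \<in> {w \<in> space M. (\<forall>i\<in>{1..Suc k}. b * i \<le> ?W w i) \<and> ?W w (Suc k) = b * Suc k + y}"
    then have w: "w \<in> space M" "\<forall>i\<in>{1..k}. b * i \<le> ?W w i" "?W w (Suc k) = b * Suc k + y" by auto
    have "b * k \<le> ?W w k" using w(2) by (cases "k = 0") auto
    then have "?W w k = b * k + (?W w k - b * k)" by simp
    moreover have "?W w k - b * k \<le> y + b" "X (1 + int k) w = y + b - (?W w k - b * k)"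
      using w(3) \<open>b * k \<le> ?W w k\<close> unfolding W_Suc by (auto simp: algebra_simps)
    ultimately have "w \<in> ?E (?W w k - b * k)" unfolding P_def using w by blast
    then show "w \<in> (\<Union>x\<le>y + b. ?E x)" using \<open>?W w k - b * k \<le> y + b\<close> by blast
  next
    fix w assume "w \<in> (\<Union>x\<le>y + b. ?E x)"
    then obtain x where x: "x \<le> y + b" "w \<in> space M" "\<forall>i\<in>{1..k}. b * i \<le> ?W w i" "?W w k = b * k + x"
      "X (1 + int k) w = y + b - x" by (auto simp: P_def)
    then have "?W w (Suc k) = b * Suc k + y" unfolding W_Suc by simp
    then show "w \<in> {w \<in> space M. (\<forall>i\<in>{1..Suc k}. b * i \<le> ?W w i) \<and> ?W w (Suc k) = b * Suc k + y}"
      using x by (auto simp: atLeastAtMostSuc_conv simp del: of_nat_Suc)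
  qed
  have meas: "Measurable.pred M (\<lambda>w. P x (\<lambda>i. X i w))" for x
    unfolding P_def by measurable
  have "prob {w \<in> space M. (\<forall>i\<in>{1..Suc k}. b * i \<le> ?W w i) \<and> ?W w (Suc k) = b * Suc k + y} = (\<Sum>x\<le>y + b. prob (?E x))"
    unfolding eq
  proof (rule finite_measure_finite_Union)
    show "?E ` {..y + b} \<subseteq> events" using meas by auto
    show "disjoint_family_on ?E {..y + b}" by (auto simp: disjoint_family_on_def P_def)
  qed auto
  also have "\<dots> = (\<Sum>x\<le>y + b. excursion b (pmf (poisson_pmf r)) k x * pmf (poisson_pmf r) (y + b - x))"
  proof (intro sum.cong refl)
    fix x
    have restr: "window (restrict y {1..int k}) (int i) i = window y (int i) i" if "i \<le> k" for y i
      by (rule window_restrict) (use that in auto)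
    have "prob (?E x) = prob {w \<in> space M. P x (\<lambda>i. X i w)} * prob {w \<in> space M. X (1 + int k) w = y + b - x}"
    proof (rule prob_indep_split[where I = "{1..int k}" and J = "{1 + int k}" and Q = "\<lambda>v. v (1 + int k) = y + b - x"])
      have [measurable]: "(\<lambda>y. window y (int i) i) \<in> nat_seqs {1..int k} \<rightarrow>\<^sub>M count_space UNIV" if "i \<le> k" for i
        by (rule measurable_window) (use that in auto)
      show "Measurable.pred (nat_seqs {1..int k}) (P x)"
        unfolding P_def by (intro pred_intros_logic pred_intros_finite) (auto intro!: measurable_compose_countable)
      show "Measurable.pred (nat_seqs {1 + int k}) (\<lambda>v. v (1 + int k) = y + b - x)"
        by measurable
      show "P x (restrict y {1..int k}) = P x y" for y
        unfolding P_def using restr by auto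
    qed auto
    also have "prob {w \<in> space M. P x (\<lambda>i. X i w)} = excursion b (pmf (poisson_pmf r)) k x"
      unfolding P_def by (rule Suc.IH)
    finally show "prob (?E x) = excursion b (pmf (poisson_pmf r)) k x * pmf (poisson_pmf r) (y + b - x)"
      by (simp add: prob_X del: pmf_poisson)
  qed
  finally show ?case by (simp add: excursion.simps)
qed

end

section \<open>The generating function of the number of full buckets\<close>

context poisson_counts
begin

lemma prob_stay:
  "prob {w \<in> space M. \<forall>i\<in>{1..k}. b * i \<le> window (\<lambda>i. X i w) (int i) i} =
     stay_prob b (pmf (poisson_pmf r)) k"
proof -
  let ?A = "\<lambda>y. {w \<in> space M. (\<forall>i\<in>{1..k}. b * i \<le> window (\<lambda>i. X i w) (int i) i) \<and>
      window (\<lambda>i. X i w) (int k) k = b * k + y}"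
  have "(\<lambda>y. prob (?A y)) sums prob (\<Union>y. ?A y)"
  proof (rule finite_measure_UNION)
    have "?A y \<in> events" for y by measurable
    then show "range ?A \<subseteq> events" by auto
  qed (auto simp: disjoint_family_on_def)
  moreover have "(\<Union>y. ?A y) = {w \<in> space M. \<forall>i\<in>{1..k}. b * i \<le> window (\<lambda>i. X i w) (int i) i}"
  proof (intro set_eqI iffI)
    fix w assume w: "w \<in> {w \<in> space M. \<forall>i\<in>{1..k}. b * i \<le> window (\<lambda>i. X i w) (int i) i}"
    then have "b * k \<le> window (\<lambda>i. X i w) (int k) k" by (cases "k = 0") auto
    then have "w \<in> ?A (window (\<lambda>i. X i w) (int k) k - b * k)" using w by simp
    then show "w \<in> (\<Union>y. ?A y)" by blast
  qed auto
  ultimately show ?thesis unfolding stay_prob_def prob_excursion by (simp only: sums_iff)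
qed

lemma measurable_first_nonfull [measurable]:
  "(\<lambda>w. first_nonfull b (\<lambda>i. X i w)) \<in> M \<rightarrow>\<^sub>M count_space UNIV"
  unfolding first_nonfull_def by measurable

text \<open>
  By stationarity, \<open>k\<close> full buckets followed by a non-full one are as likely as a non-full one
  followed by \<open>k\<close> full ones; after a non-full bucket the past plays no role.
\<close>

lemma prob_full_run_nonfull:
  "prob {w \<in> space M. (\<forall>i<k. full b (\<lambda>i. X i w) (int i)) \<and> \<not> full b (\<lambda>i. X i w) (int k)} =
     prob {w \<in> space M. \<not> full b (\<lambda>i. X i w) 0} * stay_prob b (pmf (poisson_pmf r)) k"
proof -
  let ?f = "\<lambda>w. full b (\<lambda>i. X i w)"
  let ?R = "\<lambda>k. {w \<in> space M. \<forall>i<k. ?f w (int i)}"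
  let ?S = "{w \<in> space M. \<forall>i<k. ?f w (1 + int i)}"
  have "{w \<in> space M. (\<forall>i<k. ?f w (int i)) \<and> \<not> ?f w (int k)} = ?R k - ?R (Suc k)"
    by (auto simp: less_Suc_eq)
  then have "prob {w \<in> space M. (\<forall>i<k. ?f w (int i)) \<and> \<not> ?f w (int k)} = prob (?R k) - prob (?R (Suc k))"
    by (simp, subst finite_measure_Diff) auto
  \<comment> \<open>Only this term is shifted. The shifted event contains \<open>?R (Suc k)\<close>,
    and removing the latter leaves bucket 0 non-full and buckets 1 to k full.\<close>
  also have "prob (?R k) = prob ?S"
  proof -
    have [measurable]: "Measurable.pred (nat_seqs UNIV) (\<lambda>y. full b y i)" for i
      by (rule measurable_full) auto
    have "Measurable.pred (nat_seqs UNIV) (\<lambda>y. \<forall>i<k. full b y (int i))" by measurable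
    from prob_shift[OF this, of 1] show ?thesis
      using full_shift[of b "\<lambda>i. X i w" 1 for w] by simp
  qed
  also have "prob ?S - prob (?R (Suc k)) = prob (?S - ?R (Suc k))"
  proof -
    have "?R (Suc k) \<subseteq> ?S"
    proof
      fix w assume w: "w \<in> ?R (Suc k)"
      have "?f w (1 + int i)" if "i < k" for i
        using w that by (auto dest!: spec[of _ "Suc i"])
      then show "w \<in> ?S" using w by auto
    qed
    then show ?thesis by (subst finite_measure_Diff) auto
  qed
  also have "?S - ?R (Suc k) = {w \<in> space M. \<not> ?f w 0 \<and> (\<forall>i\<in>{1..k}. b * i \<le> window (\<lambda>i. X i w) (int i) i)}"
  proof -
    have "w \<in> ?S - ?R (Suc k) \<longleftrightarrow> w \<in> space M \<and> \<not> ?f w 0 \<and> (\<forall>i\<in>{1..k}. ?f w (0 + int i))" for w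
    proof -
      have "(\<forall>i<Suc k. ?f w (int i)) \<longleftrightarrow> ?f w 0 \<and> (\<forall>i<k. ?f w (1 + int i))"
        unfolding All_less_Suc2 by simp
      moreover have "(\<forall>i\<in>{1..k}. ?f w (0 + int i)) \<longleftrightarrow> (\<forall>i<k. ?f w (1 + int i))"
      proof
        assume "\<forall>i\<in>{1..k}. ?f w (0 + int i)"
        then show "\<forall>i<k. ?f w (1 + int i)" by (auto dest!: bspec[of _ _ "Suc _"])
      next
        assume L: "\<forall>i<k. ?f w (1 + int i)"
        show "\<forall>i\<in>{1..k}. ?f w (0 + int i)"
        proof
          fix i assume "i \<in> {1..k}"
          then have "i - 1 < k" "i \<ge> 1" by auto
          then show "?f w (0 + int i)" using L[rule_format, of "i - 1"] by (simp add: of_nat_diff)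
        qed
      qed
      ultimately show ?thesis by auto
    qed
    moreover have "(\<forall>i\<in>{1..k}. ?f w (0 + int i)) \<longleftrightarrow> (\<forall>i\<in>{1..k}. b * i \<le> window (\<lambda>i. X i w) (int i) i)"
      if "\<not> ?f w 0" for w
      using full_run_after_nonfull_iff[OF that, of k] by simp
    ultimately show ?thesis by blast
  qed
  also have "prob \<dots> = prob {w \<in> space M. \<not> ?f w 0} *
      prob {w \<in> space M. \<forall>i\<in>{1..k}. b * i \<le> window (\<lambda>i. X i w) (int i) i}"
  proof (rule prob_indep_split[where I = "{..0}" and J = "{1..}" and P = "\<lambda>y. \<not> full b y 0"])
    show "Measurable.pred (nat_seqs {..0}) (\<lambda>y. \<not> full b y 0)"
      by (intro pred_intros_logic measurable_full) auto
    have [measurable]: "(\<lambda>y. window y (int i) i) \<in> nat_seqs {1..} \<rightarrow>\<^sub>M count_space UNIV" for i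
      by (rule measurable_window) auto
    show "Measurable.pred (nat_seqs {1..}) (\<lambda>y. \<forall>i\<in>{1..k}. b * i \<le> window y (int i) i)"
      by measurable
    show "(\<not> full b (restrict y {..0}) 0) = (\<not> full b y 0)" for y by (simp add: full_restrict)
    show "(\<forall>i\<in>{1..k}. b * i \<le> window (restrict y {1..}) (int i) i) \<longleftrightarrow>
        (\<forall>i\<in>{1..k}. b * i \<le> window y (int i) i)" for y
      by (intro ball_cong refl) (subst window_restrict, auto)
  qed auto
  finally show ?thesis unfolding prob_stay .
qed

lemma prob_first_nonfull_eq:
  assumes "AE w in M. \<exists>k. \<not> full b (\<lambda>i. X i w) (int k)"
  shows "prob {w \<in> space M. first_nonfull b (\<lambda>i. X i w) = k} =
      prob {w \<in> space M. (\<forall>i<k. full b (\<lambda>i. X i w) (int i)) \<and> \<not> full b (\<lambda>i. X i w) (int k)}"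
proof (rule finite_measure_eq_AE)
  show "AE w in M. (w \<in> {w \<in> space M. first_nonfull b (\<lambda>i. X i w) = k}) =
      (w \<in> {w \<in> space M. (\<forall>i<k. full b (\<lambda>i. X i w) (int i)) \<and> \<not> full b (\<lambda>i. X i w) (int k)})"
    using assms by eventually_elim (use first_nonfull_eq_iff in blast)
qed auto

lemma prob_first_nonfull:
  assumes "AE w in M. \<exists>k. \<not> full b (\<lambda>i. X i w) (int k)"
  shows "prob {w \<in> space M. first_nonfull b (\<lambda>i. X i w) = k} =
     prob {w \<in> space M. \<not> full b (\<lambda>i. X i w) 0} * stay_prob b (pmf (poisson_pmf r)) k"
  using prob_first_nonfull_eq[OF assms] prob_full_run_nonfull by simp

end

section \<open>Continuation of the product formula and the value of its constant\<close>

lemma zeta_radius_gt_1: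
  assumes "b \<ge> 1" "0 < \<alpha>" "\<alpha> < 1"
  shows "exp (\<alpha> - 1) / \<alpha> > 1" "zeta_radius b \<alpha> > 1"
proof -
  \<comment> \<open>x e^(-x) increases strictly up to its value 1/e at x = 1. This gap lets the
    argument of T remain in its disc for some y with |y| > 1.\<close>
  have "\<alpha> * exp (-\<alpha>) < exp (-1)"
    using mult_exp_uminus_strict_mono[of \<alpha> 1] assms by simp
  then have "\<alpha> * exp (-\<alpha>) * exp \<alpha> < exp (-1) * exp \<alpha>" by simp
  then have "\<alpha> < exp (\<alpha> - 1)" by (simp add: mult.assoc exp_diff exp_minus field_simps)
  then show *: "exp (\<alpha> - 1) / \<alpha> > 1" using assms by simp
  then show "zeta_radius b \<alpha> > 1" unfolding zeta_radius_def using assms by (intro one_less_power) auto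
qed

text \<open>The product over all \<open>1 - zeta b \<alpha> l q\<close> as a function of $y = q^{1/b}$, in which it is holomorphic.\<close>

definition zeta_prod :: "nat \<Rightarrow> real \<Rightarrow> complex \<Rightarrow> complex" where
  "zeta_prod b \<alpha> y = (\<Prod>l<b. 1 - tree_fun (exp (2 * of_real pi * \<i> / of_nat b) ^ l *
     of_real (\<alpha> * exp (-\<alpha>)) * y) / of_real \<alpha>)"

definition pgf_series :: "(nat \<Rightarrow> real) \<Rightarrow> complex \<Rightarrow> complex" where
  "pgf_series p q = (\<Sum>k. of_real (p k) * q ^ k)"

context
  fixes b :: nat and \<alpha> p0 C :: real and p :: "nat \<Rightarrow> real"
  assumes b: "b \<ge> 1" and \<alpha>: "0 < \<alpha>" "\<alpha> < 1"
    and p_eq: "\<And>k. p k = p0 * stay_prob b (pmf (poisson_pmf (\<alpha> * b))) k"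
    and p_nonneg: "\<And>k. p k \<ge> 0" and p_sums: "p sums 1"
    and p_le: "\<And>k. p k \<le> C * (1 / zeta_radius b \<alpha>) ^ k"
begin

lemma norm_zeta_arg:
  "norm (exp (2 * of_real pi * \<i> / of_nat b) ^ l * of_real (\<alpha> * exp (-\<alpha>)) * y) = \<alpha> * exp (-\<alpha>) * norm y"
  using \<alpha> by (simp add: norm_mult norm_power norm_exp_eq_Re)

lemma zeta_arg_radius: "\<alpha> * exp (-\<alpha>) * (exp (\<alpha> - 1) / \<alpha>) = exp (-1)"
  using \<alpha> by (simp flip: exp_add)

lemma zeta_prod_holomorphic: "zeta_prod b \<alpha> holomorphic_on ball 0 (exp (\<alpha> - 1) / \<alpha>)"
  unfolding zeta_prod_def[abs_def]
proof (intro holomorphic_intros holomorphic_on_compose_gen[OF _ tree_fun_holomorphic, unfolded o_def])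
  show "(\<lambda>y. exp (2 * of_real pi * \<i> / of_nat b) ^ l * of_real (\<alpha> * exp (-\<alpha>)) * y) ` ball 0 (exp (\<alpha> - 1) / \<alpha>) \<subseteq> ball 0 (exp (-1))" for l
  proof clarify
    fix y :: complex assume "y \<in> ball 0 (exp (\<alpha> - 1) / \<alpha>)"
    then have "\<alpha> * exp (-\<alpha>) * norm y < \<alpha> * exp (-\<alpha>) * (exp (\<alpha> - 1) / \<alpha>)"
      using \<alpha> by (intro mult_strict_left_mono) auto
    then show "exp (2 * of_real pi * \<i> / of_nat b) ^ l * of_real (\<alpha> * exp (-\<alpha>)) * y \<in> ball 0 (exp (-1))"
      unfolding zeta_arg_radius by (simp only: mem_ball_0 norm_zeta_arg)
  qed
qed (use \<alpha> in auto)

lemma zeta_prod_continuous: "continuous_on (cball 0 (exp (\<alpha> - 1) / \<alpha>)) (zeta_prod b \<alpha>)"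
  unfolding zeta_prod_def[abs_def]
proof (intro continuous_intros continuous_on_compose2[OF tree_fun_continuous_on])
  show "(\<lambda>y. exp (2 * of_real pi * \<i> / of_nat b) ^ l * of_real (\<alpha> * exp (-\<alpha>)) * y) ` cball 0 (exp (\<alpha> - 1) / \<alpha>) \<subseteq> cball 0 (exp (-1))" for l
  proof clarify
    fix y :: complex assume "y \<in> cball 0 (exp (\<alpha> - 1) / \<alpha>)"
    then have "\<alpha> * exp (-\<alpha>) * norm y \<le> \<alpha> * exp (-\<alpha>) * (exp (\<alpha> - 1) / \<alpha>)"
      using \<alpha> by (intro mult_left_mono) auto
    then show "exp (2 * of_real pi * \<i> / of_nat b) ^ l * of_real (\<alpha> * exp (-\<alpha>)) * y \<in> cball 0 (exp (-1))"
      unfolding zeta_arg_radius by (simp only: mem_cball_0 norm_zeta_arg)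
  qed
qed (use \<alpha> in auto)

lemma summable_pgf_series:
  assumes "norm q < zeta_radius b \<alpha>"
  shows "summable (\<lambda>k. p k * norm q ^ k)"
proof (rule summable_comparison_test')
  have R: "zeta_radius b \<alpha> > 1" using zeta_radius_gt_1 b \<alpha> by simp
  show "summable (\<lambda>k. C * (norm q / zeta_radius b \<alpha>) ^ k)"
    using assms R by (intro summable_mult summable_geometric) auto
  show "norm (p k * norm q ^ k) \<le> C * (norm q / zeta_radius b \<alpha>) ^ k" for k
    using mult_right_mono[OF p_le[of k], of "norm q ^ k"] p_nonneg[of k]
    by (simp add: abs_mult power_divide)
qed

lemma pgf_series_holomorphic: "pgf_series p holomorphic_on ball 0 (zeta_radius b \<alpha>)"
proof -
  define F where "F = Abs_fps (\<lambda>k. complex_of_real (p k))"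
  have R: "zeta_radius b \<alpha> > 1" using zeta_radius_gt_1 b \<alpha> by simp
  have "fps_conv_radius F \<ge> ereal (zeta_radius b \<alpha>)"
    unfolding fps_conv_radius_def
  proof (rule conv_radius_geI_ex')
    fix r :: real assume "r > 0" "ereal r < ereal (zeta_radius b \<alpha>)"
    then have "summable (\<lambda>k. p k * r ^ k)" using summable_pgf_series[of "complex_of_real r"] by simp
    then have "summable (\<lambda>k. complex_of_real (p k * r ^ k))" by (subst summable_complex_of_real)
    then show "summable (\<lambda>n. fps_nth F n * of_real r ^ n)" by (simp add: F_def)
  qed
  then have "norm x < zeta_radius b \<alpha> \<Longrightarrow> ereal (norm x) < fps_conv_radius F" for x :: complex
    using less_le_trans[of "ereal (norm x)" "ereal (zeta_radius b \<alpha>)"] by simp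
  then have "eval_fps F holomorphic_on ball 0 (zeta_radius b \<alpha>)"
    by (intro holomorphic_on_eval_fps) (auto simp: in_eball_iff)
  then show ?thesis by (simp add: eval_fps_def[abs_def] F_def pgf_series_def[abs_def])
qed

lemma pgf_series_1: "pgf_series p 1 = 1"
  using p_sums by (simp add: pgf_series_def sums_iff flip: suminf_of_real)

lemma power_in_zeta_ball: "norm (y ^ b) < zeta_radius b \<alpha> \<longleftrightarrow> norm y < exp (\<alpha> - 1) / \<alpha>"
  "norm (y ^ b) \<le> zeta_radius b \<alpha> \<longleftrightarrow> norm y \<le> exp (\<alpha> - 1) / \<alpha>" for y :: complex
  unfolding zeta_radius_def norm_power
  using b \<alpha> by (simp_all add: power_mono_iff flip: not_le)

lemma pgf_series_identity:
  assumes "norm y < exp (\<alpha> - 1) / \<alpha>"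
  shows "(1 - y ^ b) * pgf_series p (y ^ b) = of_real p0 * zeta_prod b \<alpha> y"
\<comment> \<open>The kernel method needs distinct roots and so says nothing at y = 0; the punctured
  disc is still open and nonempty, which is enough for continuation.\<close>
proof (rule analytic_continuation_open[where s = "ball 0 1 - {0}" and s' = "ball 0 (exp (\<alpha> - 1) / \<alpha>)"
    and f = "\<lambda>y. (1 - y ^ b) * pgf_series p (y ^ b)" and g = "\<lambda>y. of_real p0 * zeta_prod b \<alpha> y"])
  show "ball 0 1 - {0} \<subseteq> ball (0::complex) (exp (\<alpha> - 1) / \<alpha>)"
    using zeta_radius_gt_1(1)[OF b \<alpha>] by auto
  have "(1/2 :: complex) \<in> ball 0 1 - {0}" by simp
  then show "ball 0 1 - {0::complex} \<noteq> {}" by blast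
  show "(\<lambda>y. (1 - y ^ b) * pgf_series p (y ^ b)) holomorphic_on ball 0 (exp (\<alpha> - 1) / \<alpha>)"
    by (intro holomorphic_intros holomorphic_on_compose_gen[OF _ pgf_series_holomorphic, unfolded o_def])
       (use power_in_zeta_ball in auto)
  show "(\<lambda>y. of_real p0 * zeta_prod b \<alpha> y) holomorphic_on ball 0 (exp (\<alpha> - 1) / \<alpha>)"
    by (intro holomorphic_intros zeta_prod_holomorphic)
  show "(1 - y ^ b) * pgf_series p (y ^ b) = of_real p0 * zeta_prod b \<alpha> y" if "y \<in> ball 0 1 - {0}" for y
  proof -
    have y: "y \<noteq> 0" "norm y < 1" using that by auto
    have "summable (\<lambda>k. norm (of_real (stay_prob b (pmf (poisson_pmf (\<alpha> * b))) k) * (y ^ b) ^ k))"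
    proof (rule summable_comparison_test'[where g = "\<lambda>k. norm (y ^ b) ^ k"])
      show "summable (\<lambda>k. norm (y ^ b) ^ k)"
        using y b by (intro summable_geometric) (simp add: norm_power power_less_one_iff)
      fix k
      have "stay_prob b (pmf (poisson_pmf (\<alpha> * b))) k \<le> 1" "stay_prob b (pmf (poisson_pmf (\<alpha> * b))) k \<ge> 0"
        using excursion_summable_le_1(2) stay_prob_nonneg pmf_poisson_sums[of "\<alpha> * b"] b \<alpha> by auto
      then show "norm (norm (of_real (stay_prob b (pmf (poisson_pmf (\<alpha> * b))) k) * (y ^ b) ^ k)) \<le> norm (y ^ b) ^ k"
        by (simp add: norm_mult norm_power mult_left_le_one_le)
    qed
    then have "pgf_series p (y ^ b) = of_real p0 * (\<Sum>k. of_real (stay_prob b (pmf (poisson_pmf (\<alpha> * b))) k) * (y ^ b) ^ k)"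
      unfolding pgf_series_def p_eq by (subst suminf_mult[symmetric]) (auto intro: summable_norm_cancel simp: mult.assoc)
    then show ?thesis
      using stay_prob_gf[OF b \<alpha> y] by (simp add: zeta_prod_def mult.left_commute)
  qed
qed (use assms b in \<open>auto intro!: open_Diff\<close>)

text \<open>The factor with l = 0 vanishes at y = 1, since T(\<alpha> e^(-\<alpha>)) = \<alpha>; by
  the product rule only its derivative, -1 / (1 - \<alpha>), times the other factors
  survives.\<close>

lemma zeta_prod_has_field_derivative_1:
  "(zeta_prod b \<alpha> has_field_derivative - (\<Prod>l\<in>{1..<b}. 1 - zeta b \<alpha> l 1) / of_real (1 - \<alpha>)) (at 1)"
proof -
  define c where "c = complex_of_real (\<alpha> * exp (-\<alpha>))"
  define \<omega> where "\<omega> = exp (2 * complex_of_real pi * \<i> / of_nat b)"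
  define f where "f = (\<lambda>l y. 1 - tree_fun (\<omega> ^ l * c * y) / of_real \<alpha>)"
  define g where "g = (\<lambda>y. \<Prod>l\<in>{1..<b}. f l y)"
  have split: "{..<b} = insert 0 {1..<b}" using b by auto
  have zp: "zeta_prod b \<alpha> = (\<lambda>y. f 0 y * g y)"
    by (simp add: zeta_prod_def[abs_def] f_def g_def c_def \<omega>_def split)
  have "f l holomorphic_on ball 0 (exp (\<alpha> - 1) / \<alpha>)" for l
    unfolding f_def
  proof (intro holomorphic_intros holomorphic_on_compose_gen[OF _ tree_fun_holomorphic, unfolded o_def])
    show "(\<lambda>y. \<omega> ^ l * c * y) ` ball 0 (exp (\<alpha> - 1) / \<alpha>) \<subseteq> ball 0 (exp (-1))"
    proof clarify
      fix y :: complex assume "y \<in> ball 0 (exp (\<alpha> - 1) / \<alpha>)"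
      then have "\<alpha> * exp (-\<alpha>) * norm y < \<alpha> * exp (-\<alpha>) * (exp (\<alpha> - 1) / \<alpha>)"
        using \<alpha> by (intro mult_strict_left_mono) auto
      then show "\<omega> ^ l * c * y \<in> ball 0 (exp (-1))"
        unfolding zeta_arg_radius \<omega>_def c_def by (simp only: mem_ball_0 norm_zeta_arg)
    qed
  qed (use \<alpha> in auto)
  then have "g holomorphic_on ball 0 (exp (\<alpha> - 1) / \<alpha>)"
    unfolding g_def by (intro holomorphic_intros)
  then obtain g' where g': "(g has_field_derivative g') (at 1)"
    using zeta_radius_gt_1(1)[OF b \<alpha>]
    by (metis holomorphic_on_imp_differentiable_at open_ball mem_ball_0 norm_one field_differentiable_def)
  have f0: "f 0 1 = 0"
  proof -
    have "tree_fun c = of_real \<alpha>"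
      unfolding c_def using tree_fun_of_real[of "\<alpha> * exp (-\<alpha>)"] real_tree_fun_inverse[of \<alpha>]
        mult_exp_uminus_strict_mono[of \<alpha> 1] \<alpha> by simp
    then show ?thesis using \<alpha> by (simp add: f_def)
  qed
  have "((\<lambda>y. tree_fun (c * y)) has_field_derivative (of_real (exp \<alpha> / (1 - \<alpha>)) * c)) (at 1)"
    by (rule DERIV_chain2[where f = tree_fun and g = "\<lambda>y. c * y"])
       (use tree_fun_has_field_derivative[OF \<alpha>] in \<open>auto simp: c_def intro!: derivative_eq_intros\<close>)
  moreover have "complex_of_real (exp \<alpha> / (1 - \<alpha>)) * c = of_real (\<alpha> / (1 - \<alpha>))"
  proof -
    have "exp \<alpha> / (1 - \<alpha>) * (\<alpha> * exp (-\<alpha>)) = \<alpha> / (1 - \<alpha>)" by (simp add: exp_minus)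
    then show ?thesis unfolding c_def by (metis of_real_mult)
  qed
  ultimately have "(f 0 has_field_derivative - (of_real (\<alpha> / (1 - \<alpha>)) / of_real \<alpha>)) (at 1)"
    unfolding f_def by (auto intro!: derivative_eq_intros)
  then have "(f 0 has_field_derivative - (1 / of_real (1 - \<alpha>))) (at 1)" using \<alpha> by simp
  from DERIV_mult[OF this g'] have "(zeta_prod b \<alpha> has_field_derivative - (1 / of_real (1 - \<alpha>)) * g 1) (at 1)"
    by (simp add: zp f0)
  moreover have "g 1 = (\<Prod>l\<in>{1..<b}. 1 - zeta b \<alpha> l 1)"
    by (simp add: g_def f_def zeta_def Let_def \<omega>_def c_def)
  ultimately show ?thesis by simp
qed

text \<open>Both sides of the continued identity vanish at y = 1. The left derivative there is -b,
  because the series has value 1 at q = 1; the right one is -p0 / (1 - \<alpha>) times the product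
  defining T0.\<close>

lemma p0_eq_T0: "of_real p0 = T0 b \<alpha>"
proof -
  let ?P = "\<Prod>l\<in>{1..<b}. 1 - zeta b \<alpha> l 1"
  let ?\<rho> = "exp (\<alpha> - 1) / \<alpha>"
  have \<rho>: "?\<rho> > 1" and R: "zeta_radius b \<alpha> > 1" using zeta_radius_gt_1[OF b \<alpha>] by auto
  have "((\<lambda>y. of_real p0 * zeta_prod b \<alpha> y) has_field_derivative of_real p0 * (- ?P / of_real (1 - \<alpha>))) (at 1)"
    by (intro DERIV_cmult zeta_prod_has_field_derivative_1)
  then have 1: "((\<lambda>y. (1 - y ^ b) * pgf_series p (y ^ b)) has_field_derivative of_real p0 * (- ?P / of_real (1 - \<alpha>))) (at 1)"
    by (rule has_field_derivative_transform_within_open[where S = "ball 0 ?\<rho>"])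
       (use \<rho> pgf_series_identity in auto)
  obtain D where "(pgf_series p has_field_derivative D) (at 1)"
    using pgf_series_holomorphic R
    by (metis holomorphic_on_imp_differentiable_at open_ball mem_ball_0 norm_one field_differentiable_def)
  then have "(pgf_series p has_field_derivative D) (at (1 ^ b))" by simp
  then have "((\<lambda>y. pgf_series p (y ^ b)) has_field_derivative D * of_nat b) (at 1)"
    by (rule DERIV_chain2) (auto intro!: derivative_eq_intros)
  then have 2: "((\<lambda>y. (1 - y ^ b) * pgf_series p (y ^ b)) has_field_derivative - of_nat b) (at 1)"
    by (auto intro!: derivative_eq_intros simp: pgf_series_1)
  have "of_real p0 * ?P = of_nat b * (1 - of_real \<alpha>)"
    using DERIV_unique[OF 1 2] \<alpha> by (simp add: field_simps)
  \<comment> \<open>Hence the product is nonzero as well, and the division in \<open>T0\<close> is a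
    genuine one.\<close>
  moreover have "of_nat b * (1 - complex_of_real \<alpha>) \<noteq> 0"
    using b \<alpha> by (simp add: complex_eq_iff)
  ultimately show ?thesis unfolding T0_def by (metis mult_zero_right nonzero_eq_divide_eq)
qed

text \<open>The geometric bound on \<open>p\<close> does not decide the boundary circle. For real x
  below the critical radius the identity bounds the series, as the product is continuous on the
  compact closed disc; nonnegative terms carry this bound to the partial sums, and x may then tend
  to the radius.\<close>

lemma summable_pgf_series_boundary: "summable (\<lambda>k. p k * zeta_radius b \<alpha> ^ k)"
proof -
  let ?\<rho> = "exp (\<alpha> - 1) / \<alpha>"
  have \<rho>: "?\<rho> > 1" using zeta_radius_gt_1[OF b \<alpha>] by auto
  have "compact (zeta_prod b \<alpha> ` cball 0 ?\<rho>)"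
    by (intro compact_continuous_image zeta_prod_continuous) auto
  then have "\<exists>B. \<forall>y\<in>cball 0 ?\<rho>. norm (zeta_prod b \<alpha> y) \<le> B"
    by (auto dest!: compact_imp_bounded simp: bounded_iff)
  then obtain B where B: "\<And>y. norm y \<le> ?\<rho> \<Longrightarrow> norm (zeta_prod b \<alpha> y) \<le> B"
    by (meson mem_cball_0)
  \<comment> \<open>Restricting to x > x0 > 1 keeps the divisor x^b - 1 away from its zero at 1, so
    that \<open>K\<close> does not depend on x.\<close>
  obtain x0 where x0: "1 < x0" "x0 < ?\<rho>" using dense[OF \<rho>] by blast
  define K where "K = \<bar>p0\<bar> * B / (x0 ^ b - 1)"
  have x0b: "x0 ^ b > 1" using x0 b by (intro one_less_power) auto
  have bound: "(\<Sum>k<n. p k * (x ^ b) ^ k) \<le> K" if "x0 < x" "x < ?\<rho>" for x n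
  proof -
    let ?y = "complex_of_real x"
    have y: "norm ?y < ?\<rho>" using that x0 by simp
    have xb: "x0 ^ b \<le> x ^ b" using that x0 by (intro power_mono) auto
    have s: "summable (\<lambda>k. p k * (x ^ b) ^ k)"
      using summable_pgf_series[of "?y ^ b"] y power_in_zeta_ball(1)[of ?y] that x0 by (simp add: norm_power)
    have "(\<Sum>k<n. p k * (x ^ b) ^ k) \<le> (\<Sum>k. p k * (x ^ b) ^ k)"
      using that x0 by (intro sum_le_suminf s) (auto intro!: mult_nonneg_nonneg p_nonneg)
    also have "\<dots> \<le> norm (pgf_series p (?y ^ b))"
    proof -
      have "pgf_series p (?y ^ b) = of_real (\<Sum>k. p k * (x ^ b) ^ k)"
        unfolding pgf_series_def by (subst suminf_of_real[OF s]) simp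
      then show ?thesis by simp
    qed
    also have "\<dots> \<le> K"
    proof -
      have "norm (1 - ?y ^ b) * norm (pgf_series p (?y ^ b)) = \<bar>p0\<bar> * norm (zeta_prod b \<alpha> ?y)"
        using arg_cong[OF pgf_series_identity[OF y], of norm] by (simp add: norm_mult)
      also have "\<dots> \<le> \<bar>p0\<bar> * B" using B[of ?y] y by (intro mult_left_mono) auto
      finally have "norm (1 - ?y ^ b) * norm (pgf_series p (?y ^ b)) \<le> \<bar>p0\<bar> * B" .
      moreover have "norm (1 - ?y ^ b) = x ^ b - 1"
      proof -
        have "1 - ?y ^ b = of_real (1 - x ^ b)" by simp
        then show ?thesis using xb x0b by (simp only: norm_of_real)
      qed
      moreover have "(x0 ^ b - 1) * norm (pgf_series p (?y ^ b)) \<le> (x ^ b - 1) * norm (pgf_series p (?y ^ b))"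
        using xb by (intro mult_right_mono) auto
      ultimately show ?thesis using x0b by (simp add: K_def field_simps)
    qed
    finally show ?thesis .
  qed
  show ?thesis
  proof (rule summableI_nonneg_bounded)
    fix n
    have "((\<lambda>x. \<Sum>k<n. p k * (x ^ b) ^ k) \<longlongrightarrow> (\<Sum>k<n. p k * (?\<rho> ^ b) ^ k)) (at_left ?\<rho>)"
      by (intro tendsto_intros)
    moreover have "eventually (\<lambda>x. x \<in> {x0<..<?\<rho>}) (at_left ?\<rho>)"
      using x0 by (intro eventually_at_left_real) auto
    then have "eventually (\<lambda>x. (\<Sum>k<n. p k * (x ^ b) ^ k) \<le> K) (at_left ?\<rho>)"
      by eventually_elim (use bound in auto)
    ultimately show "(\<Sum>k<n. p k * zeta_radius b \<alpha> ^ k) \<le> K"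
      unfolding zeta_radius_def by (rule tendsto_upperbound) auto
  qed (use zeta_radius_gt_1[OF b \<alpha>] in \<open>auto intro!: mult_nonneg_nonneg p_nonneg\<close>)
qed

lemma summable_pgf_series_le:
  assumes "norm q \<le> zeta_radius b \<alpha>"
  shows "summable (\<lambda>k. p k * norm q ^ k)"
  by (rule summable_comparison_test'[OF summable_pgf_series_boundary])
     (use assms p_nonneg in \<open>auto simp: abs_mult intro!: mult_left_mono power_mono\<close>)

lemma pgf_series_continuous: "continuous_on (cball 0 (zeta_radius b \<alpha>)) (pgf_series p)"
proof -
  have "uniform_limit (cball 0 (zeta_radius b \<alpha>)) (\<lambda>n q. \<Sum>k<n. of_real (p k) * q ^ k) (pgf_series p) sequentially"
    unfolding pgf_series_def[abs_def]
    by (rule Weierstrass_m_test[OF _ summable_pgf_series_boundary])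
       (use p_nonneg in \<open>auto simp: norm_mult norm_power intro!: mult_left_mono power_mono\<close>)
  then show ?thesis
    by (rule uniform_limit_theorem[rotated]) (auto intro!: always_eventually continuous_intros)
qed

lemma pgf_series_identity_closed:
  assumes "norm y \<le> exp (\<alpha> - 1) / \<alpha>"
  shows "(1 - y ^ b) * pgf_series p (y ^ b) = of_real p0 * zeta_prod b \<alpha> y"
proof -
  let ?\<rho> = "exp (\<alpha> - 1) / \<alpha>"
  have \<rho>: "?\<rho> > 0" using \<alpha> by simp
  have "(1 - y ^ b) * pgf_series p (y ^ b) - of_real p0 * zeta_prod b \<alpha> y = 0"
  proof (rule continuous_constant_on_closure[where S = "ball 0 ?\<rho>" and
        f = "\<lambda>y. (1 - y ^ b) * pgf_series p (y ^ b) - of_real p0 * zeta_prod b \<alpha> y"])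
    show "continuous_on (closure (ball 0 ?\<rho>)) (\<lambda>y. (1 - y ^ b) * pgf_series p (y ^ b) - of_real p0 * zeta_prod b \<alpha> y)"
      unfolding closure_ball[OF \<rho>]
      by (intro continuous_intros zeta_prod_continuous continuous_on_compose2[OF pgf_series_continuous])
         (use power_in_zeta_ball in auto)
    show "y \<in> closure (ball 0 ?\<rho>)" using assms by (simp add: closure_ball[OF \<rho>])
  qed (use pgf_series_identity in auto)
  then show ?thesis by simp
qed

text \<open>The identity in y holds for every y with y^b = q, so the principal root may be inserted
  pointwise and its jump across the cut does no harm.\<close>

lemma pgf_series_eq_psi_formula:
  assumes "norm q \<le> zeta_radius b \<alpha>" "q \<noteq> 1"
  shows "pgf_series p q = psi_formula b \<alpha> q"
proof -
  define y where "y = q powr (1 / of_nat b)"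
  have yb: "y ^ b = q"
  proof (cases "q = 0")
    case False
    have "y ^ b = q powr (of_nat b * (1 / of_nat b))"
      unfolding y_def using False by (simp add: powr_def exp_of_nat_mult[symmetric])
    then show ?thesis using b False by simp
  qed (use b in \<open>simp add: y_def\<close>)
  have "norm y \<le> exp (\<alpha> - 1) / \<alpha>" using power_in_zeta_ball(2)[of y] assms yb by simp
  from pgf_series_identity_closed[OF this] have "(1 - q) * pgf_series p q = T0 b \<alpha> * zeta_prod b \<alpha> y"
    by (simp add: yb p0_eq_T0)
  moreover have "zeta_prod b \<alpha> y = (\<Prod>l<b. 1 - zeta b \<alpha> l q)"
    by (simp add: zeta_prod_def zeta_def Let_def y_def)
  ultimately show ?thesis using assms(2) by (simp add: psi_formula_def field_simps)
qed

text \<open>Near 1 the formula agrees, off the point itself, with a power series that is holomorphic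
  there.\<close>

lemma psi_formula_tendsto: "(psi_formula b \<alpha> \<longlongrightarrow> pgf_series p 1) (at 1)"
proof -
  have R: "zeta_radius b \<alpha> > 1" using zeta_radius_gt_1[OF b \<alpha>] by auto
  have "isCont (pgf_series p) 1"
    using holomorphic_on_imp_continuous_on[OF pgf_series_holomorphic] R
    by (simp add: continuous_on_eq_continuous_at)
  then have "(pgf_series p \<longlongrightarrow> pgf_series p 1) (at 1)" by (simp add: isCont_def)
  moreover have "eventually (\<lambda>q. q \<in> ball 0 (zeta_radius b \<alpha>) - {1}) (at (1 :: complex))"
    using R by (intro eventually_at_in_open) auto
  then have "eventually (\<lambda>q. pgf_series p q = psi_formula b \<alpha> q) (at 1)"
    by eventually_elim (auto intro!: pgf_series_eq_psi_formula)
  ultimately show ?thesis by (rule Lim_transform_eventually)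
qed

end

section \<open>Hash counts in the exact model\<close>

lemma cyclic_address_inj:
  assumes "l \<le> m"
  shows "inj_on (\<lambda>t. nat ((int s + (i - int t)) mod int m)) {..<l}"
proof (rule inj_onI)
  fix t t' assume t: "t \<in> {..<l}" "t' \<in> {..<l}"
    and eq: "nat ((int s + (i - int t)) mod int m) = nat ((int s + (i - int t')) mod int m)"
  have m: "int m > 0" using t assms by auto
  have "(int s + (i - int t)) mod int m = (int s + (i - int t')) mod int m"
    using eq m by (simp add: eq_nat_nat_iff)
  then have "int m dvd (int s + (i - int t)) - (int s + (i - int t'))" by (simp add: mod_eq_dvd_iff)
  then have "int m dvd int t' - int t" by simp
  moreover have "\<bar>int t' - int t\<bar> < int m" using t assms by auto
  ultimately show "t = t'" using zdvd_imp_le[of "int m" "\<bar>int t' - int t\<bar>"] by fastforce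
qed

lemma cyclic_address_less: "m > 0 \<Longrightarrow> nat ((int s + i) mod int m) < m"
  by (simp add: nat_less_iff)

text \<open>At most \<open>m\<close> consecutive buckets have distinct addresses, so the window
  counts the keys hashed into a fixed set of \<open>l\<close> addresses, a binomial variable under
  uniform hashing.\<close>

lemma window_hash_count:
  assumes "l \<le> m"
  shows "window (hash_count m n s h) i l =
    card {k. k < n \<and> h k \<in> (\<lambda>t. nat ((int s + (i - int t)) mod int m)) ` {..<l}}"
proof -
  have "{k. k < n \<and> h k \<in> (\<lambda>t. nat ((int s + (i - int t)) mod int m)) ` {..<l}} =
      (\<Union>t<l. {k. k < n \<and> h k = nat ((int s + (i - int t)) mod int m)})"
    by auto
  also have "card \<dots> = (\<Sum>t<l. card {k. k < n \<and> h k = nat ((int s + (i - int t)) mod int m)})"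
    using cyclic_address_inj[OF assms, of s i] by (intro card_UN_disjoint) (auto simp: inj_on_def)
  finally show ?thesis by (simp add: window_def hash_count_def)
qed

lemma set_hash_pmf:
  assumes "m > 0" "h \<in> set_pmf (hash_pmf m n)" "k < n"
  shows "h k < m"
proof -
  have "{..<m} \<noteq> {}" using assms by auto
  then show ?thesis using assms by (auto simp: hash_pmf_def set_Pi_pmf PiE_dflt_def)
qed

text \<open>The expectation of \<open>z ^ window\<close> is (1 + (z-1) l/m)^n, a product over
  independent keys. By 1 + u \<le> e^u it is at most the Poisson value with mean n/m per bucket, so
  the size of the table enters only through n/m.\<close>

lemma hash_window_tail:
  assumes m: "m > 0" and l: "l \<le> m" and z: "z \<ge> 1"
  shows "measure_pmf.prob (hash_pmf m n) {h. b * l \<le> window (hash_count m n s h) i l} \<le>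
    (exp ((z - 1) * (n / m)) / z ^ b) ^ l"
proof -
  define W where "W = (\<lambda>t. nat ((int s + (i - int t)) mod int m)) ` {..<l}"
  have W: "card W = l" "W \<subseteq> {..<m}"
    using card_image[OF cyclic_address_inj[OF l, of s i]] cyclic_address_less[OF m] by (auto simp: W_def)
  let ?g = "\<lambda>x. if x \<in> W then z else 1"
  have pow: "z ^ window (hash_count m n s h) i l = (\<Prod>k<n. ?g (h k))" for h
  proof -
    have "(\<Prod>k<n. ?g (h k)) = z ^ card {k \<in> {..<n}. h k \<in> W}"
      by (subst prod.If_cases) (auto simp: Int_def)
    then show ?thesis by (simp add: window_hash_count[OF l] W_def)
  qed
  have ne: "{..<m} \<noteq> {}" using m by auto
  have E1: "measure_pmf.expectation (pmf_of_set {..<m}) ?g = 1 + (z - 1) * (l / m)"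
  proof -
    have "(\<Sum>x<m. ?g x) = (\<Sum>x<m. 1 + (z - 1) * (if x \<in> W then 1 else 0))" by (intro sum.cong) auto
    also have "\<dots> = real m + (z - 1) * (\<Sum>x<m. if x \<in> W then 1 else 0)"
      by (simp add: sum.distrib flip: sum_distrib_left)
    also have "(\<Sum>x<m. if x \<in> W then 1 else 0 :: real) = real l"
      using W by (simp add: sum.If_cases Int_absorb1)
    finally show ?thesis using m ne by (simp add: integral_pmf_of_set field_simps)
  qed
  have fin: "finite (set_pmf (pmf_of_set {..<m}))" using ne by simp
  have int: "integrable (measure_pmf (hash_pmf m n)) (\<lambda>h. z ^ window (hash_count m n s h) i l)"
    unfolding pow hash_pmf_def
    by (rule integrable_prod_Pi_pmf) (auto intro: integrable_measure_pmf_finite[OF fin])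
  have "measure_pmf.expectation (hash_pmf m n) (\<lambda>h. z ^ window (hash_count m n s h) i l) = (1 + (z - 1) * (l / m)) ^ n"
    unfolding pow hash_pmf_def
    by (subst expectation_prod_Pi_pmf)
       (use z E1 in \<open>auto intro: integrable_measure_pmf_finite[OF fin]\<close>)
  also have "\<dots> \<le> exp ((z - 1) * (l / m)) ^ n"
    using z by (intro power_mono exp_ge_add_one_self) auto
  also have "\<dots> = exp ((z - 1) * (n / m)) ^ l"
    by (simp flip: exp_of_nat_mult)
  finally have E: "measure_pmf.expectation (hash_pmf m n) (\<lambda>h. z ^ window (hash_count m n s h) i l) \<le>
      exp ((z - 1) * (n / m)) ^ l" .
  have "measure_pmf.prob (hash_pmf m n) {h. b * l \<le> window (hash_count m n s h) i l} \<le>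
      measure_pmf.prob (hash_pmf m n) {h \<in> space (measure_pmf (hash_pmf m n)). z ^ (b * l) \<le> z ^ window (hash_count m n s h) i l}"
    using z by (intro measure_pmf.finite_measure_mono) (auto intro: power_increasing)
  also have "\<dots> \<le> measure_pmf.expectation (hash_pmf m n) (\<lambda>h. z ^ window (hash_count m n s h) i l) / z ^ (b * l)"
    using z by (intro integral_Markov_inequality_measure[where A = "{}"] int) auto
  also have "\<dots> \<le> exp ((z - 1) * (n / m)) ^ l / z ^ (b * l)"
    using z E by (intro divide_right_mono) auto
  finally show ?thesis by (simp add: power_mult power_divide)
qed

lemma hash_windows_tail:
  assumes m: "m > 0" and z: "z \<ge> 1" and \<phi>: "exp ((z - 1) * (n / m)) / z ^ b \<le> \<phi>" "\<phi> < 1"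
  shows "measure_pmf.prob (hash_pmf m n) {h. \<exists>l. k \<le> l \<and> l < m \<and> b * l \<le> window (hash_count m n s h) i l} \<le>
    \<phi> ^ k / (1 - \<phi>)"
proof -
  have "exp ((z - 1) * (n / m)) / z ^ b \<ge> 0" using z by simp
  then have \<phi>0: "\<phi> \<ge> 0" using \<phi> by linarith
  have "{h. \<exists>l. k \<le> l \<and> l < m \<and> b * l \<le> window (hash_count m n s h) i l} =
      (\<Union>l\<in>{k..<m}. {h. b * l \<le> window (hash_count m n s h) i l})" by auto
  then have "measure_pmf.prob (hash_pmf m n) {h. \<exists>l. k \<le> l \<and> l < m \<and> b * l \<le> window (hash_count m n s h) i l} \<le>
      (\<Sum>l\<in>{k..<m}. measure_pmf.prob (hash_pmf m n) {h. b * l \<le> window (hash_count m n s h) i l})"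
    by (simp add: measure_pmf.finite_measure_subadditive_finite)
  also have "\<dots> \<le> (\<Sum>l\<in>{k..<m}. \<phi> ^ l)"
  proof (rule sum_mono)
    fix l assume "l \<in> {k..<m}"
    then have "measure_pmf.prob (hash_pmf m n) {h. b * l \<le> window (hash_count m n s h) i l} \<le>
        (exp ((z - 1) * (n / m)) / z ^ b) ^ l"
      by (intro hash_window_tail m z) auto
    also have "\<dots> \<le> \<phi> ^ l" using \<phi> z by (intro power_mono) auto
    finally show "measure_pmf.prob (hash_pmf m n) {h. b * l \<le> window (hash_count m n s h) i l} \<le> \<phi> ^ l" .
  qed
  also have "\<dots> \<le> \<phi> ^ k / (1 - \<phi>)"
  proof -
    have "(\<Sum>l\<in>{k..<m}. \<phi> ^ l) = (\<Sum>l\<in>{0..<m - k}. \<phi> ^ (l + k))"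
      by (rule sum.reindex_bij_witness[of _ "\<lambda>l. l + k" "\<lambda>l. l - k"]) auto
    also have "\<dots> = \<phi> ^ k * (\<Sum>l<m - k. \<phi> ^ l)"
      by (simp add: power_add sum_distrib_left mult.commute atLeast0LessThan)
    also have "(\<Sum>l<m - k. \<phi> ^ l) \<le> (\<Sum>l. \<phi> ^ l)"
      using \<phi> \<phi>0 by (intro sum_le_suminf summable_geometric) auto
    also have "\<dots> = 1 / (1 - \<phi>)" using \<phi> \<phi>0 by (intro suminf_geometric) auto
    finally show ?thesis using \<phi>0 by (simp add: mult_left_mono)
  qed
  finally show ?thesis .
qed

section \<open>Joint law of finitely many hash counts\<close>

definition key_count :: "nat \<Rightarrow> (nat \<Rightarrow> nat) \<Rightarrow> nat \<Rightarrow> nat" where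
  "key_count n h j = card {k. k < n \<and> h k = j}"

lemma key_count_Suc: "key_count (Suc n) (h(n := x)) j = key_count n h j + (if x = j then 1 else 0)"
proof -
  have "{k. k < Suc n \<and> (h(n := x)) k = j} = (if x = j then insert n {k. k < n \<and> h k = j} else {k. k < n \<and> h k = j})"
    by (auto simp: less_Suc_eq)
  then show ?thesis by (simp add: key_count_def)
qed

lemma hash_count_eq_key_count: "hash_count m n s h i = key_count n h (nat ((int s + i) mod int m))"
  by (simp add: hash_count_def key_count_def)

lemma measure_bind_pmf: "measure (bind_pmf p f) A = measure_pmf.expectation p (\<lambda>x. measure (f x) A)"
proof -
  have "ennreal (measure (bind_pmf p f) A) = (\<integral>\<^sup>+x. ennreal (measure (f x) A) \<partial>p)"
    by (simp flip: measure_pmf.emeasure_eq_measure)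
  also have "\<dots> = ennreal (measure_pmf.expectation p (\<lambda>x. measure (f x) A))"
    by (intro nn_integral_eq_integral measure_pmf.integrable_const_bound[where B = 1]) auto
  finally show ?thesis by (subst (asm) ennreal_inj) (auto intro: integral_nonneg)
qed

text \<open>
  If the prescribed counts add up to more than \<open>n\<close>, the first factor vanishes, so the truncated
  subtraction in the exponent is harmless.
\<close>

lemma prob_key_counts:
  assumes m: "m > 0" and T: "finite T" "inj_on g T" "g ` T \<subseteq> {..<m}"
  shows "measure_pmf.prob (hash_pmf m n) {h. \<forall>t\<in>T. key_count n h (g t) = a t} =
    (\<Prod>i<sum a T. (real n - real i) / real m) / (\<Prod>t\<in>T. fact (a t)) * (1 - card T / m) ^ (n - sum a T)"
proof (induction n arbitrary: a)
  case 0
  show ?case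
  proof (cases "\<forall>t\<in>T. a t = 0")
    case True
    then have "{h. \<forall>t\<in>T. key_count 0 h (g t) = a t} = UNIV" by (auto simp: key_count_def)
    then show ?thesis using True by simp
  next
    case False
    then obtain t where t: "t \<in> T" "a t \<noteq> 0" by blast
    then have "{h. \<forall>t\<in>T. key_count 0 h (g t) = a t} = {}" by (auto simp: key_count_def)
    moreover have "sum a T \<noteq> 0" using t T(1) by (metis sum_eq_0_iff)
    then have "sum a T > 0" by (simp only: neq0_conv)
    then have "(\<Prod>i<sum a T. (real 0 - real i) / real m) = 0"
      by (intro prod_zero bexI[of _ 0]) simp_all
    ultimately show ?thesis by (simp only: measure_empty div_0 mult_zero_left)
  qed
next
  case (Suc n)
  let ?P = "\<lambda>n a. measure_pmf.prob (hash_pmf m n) {h. \<forall>t\<in>T. key_count n h (g t) = a t}"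
  let ?A = "sum a T" and ?q = "1 - card T / m" and ?c = "\<Prod>t\<in>T. fact (a t) :: real"
  \<comment> \<open>The falling factorial n (n-1) ... (n-A+1) divided by m^A.\<close>
  define ff where "ff = (\<lambda>n A. \<Prod>i<A. (real n - real i) / real m)"
  have ne: "{..<m} \<noteq> {}" using m by auto
  have card: "card (g ` T) = card T" by (rule card_image) fact
  \<comment> \<open>Condition on the address x of the last key: away from the prescribed buckets the
    requirement on the earlier keys is unchanged, while at \<open>g u\<close> they must supply one
    key fewer.\<close>
  have "?P (Suc n) a = measure_pmf.prob (bind_pmf (pmf_of_set {..<m}) (\<lambda>x. map_pmf (\<lambda>h. h(n := x)) (hash_pmf m n)))
      {h. \<forall>t\<in>T. key_count (Suc n) h (g t) = a t}"
    by (simp add: hash_pmf_def lessThan_Suc Pi_pmf_insert' map_pmf_def)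
  also have "\<dots> = measure_pmf.expectation (pmf_of_set {..<m})
      (\<lambda>x. measure_pmf.prob (hash_pmf m n) {h. \<forall>t\<in>T. key_count (Suc n) (h(n := x)) (g t) = a t})"
    by (simp add: measure_bind_pmf vimage_def)
  also have "\<dots> = (\<Sum>x<m. measure_pmf.prob (hash_pmf m n) {h. \<forall>t\<in>T. key_count (Suc n) (h(n := x)) (g t) = a t}) / m"
    using ne by (simp add: integral_pmf_of_set)
  also have "(\<Sum>x<m. measure_pmf.prob (hash_pmf m n) {h. \<forall>t\<in>T. key_count (Suc n) (h(n := x)) (g t) = a t}) =
      (\<Sum>x\<in>{..<m} - g ` T. ?P n a) + (\<Sum>x\<in>g ` T. measure_pmf.prob (hash_pmf m n) {h. \<forall>t\<in>T. key_count (Suc n) (h(n := x)) (g t) = a t})"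
  proof -
    have "(\<Sum>x\<in>{..<m} - g ` T. measure_pmf.prob (hash_pmf m n) {h. \<forall>t\<in>T. key_count (Suc n) (h(n := x)) (g t) = a t}) =
        (\<Sum>x\<in>{..<m} - g ` T. ?P n a)"
      by (intro sum.cong refl arg_cong[where f = "measure_pmf.prob (hash_pmf m n)"]) (auto simp: key_count_Suc)
    from this[symmetric] show ?thesis
      by (simp only:) (rule sum.subset_diff[OF T(3) finite_lessThan])
  qed
  also have "(\<Sum>x\<in>{..<m} - g ` T. ?P n a) = (real m - real (card T)) * ?P n a"
    using T(3) card card_mono[OF _ T(3)] by (simp add: card_Diff_subset T of_nat_diff)
  also have "(\<Sum>x\<in>g ` T. measure_pmf.prob (hash_pmf m n) {h. \<forall>t\<in>T. key_count (Suc n) (h(n := x)) (g t) = a t}) =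
      (\<Sum>u\<in>T. measure_pmf.prob (hash_pmf m n) {h. \<forall>t\<in>T. key_count (Suc n) (h(n := g u)) (g t) = a t})"
    by (subst sum.reindex[OF T(2)]) simp
  also have "\<dots> = (\<Sum>u\<in>T. a u * (ff n (?A - 1) / ?c * ?q ^ (n - (?A - 1))))"
  proof (intro sum.cong refl)
    fix u assume u: "u \<in> T"
    show "measure_pmf.prob (hash_pmf m n) {h. \<forall>t\<in>T. key_count (Suc n) (h(n := g u)) (g t) = a t} =
        a u * (ff n (?A - 1) / ?c * ?q ^ (n - (?A - 1)))"
    proof (cases "a u = 0")
      case True
      then have "{h. \<forall>t\<in>T. key_count (Suc n) (h(n := g u)) (g t) = a t} = {}"
        using u by (auto simp: key_count_Suc intro!: bexI[of _ u])
      then show ?thesis using True by (simp only: measure_empty of_nat_0 mult_zero_left)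
    next
      case False
      define a' where "a' = a(u := a u - 1)"
      have "{h. \<forall>t\<in>T. key_count (Suc n) (h(n := g u)) (g t) = a t} = {h. \<forall>t\<in>T. key_count n h (g t) = a' t}"
      proof -
        have "key_count (Suc n) (h(n := g u)) (g t) = a t \<longleftrightarrow> key_count n h (g t) = a' t" if "t \<in> T" for h t
          using that u T(2) False by (auto simp: key_count_Suc a'_def inj_on_def)
        then show ?thesis by auto
      qed
      moreover have "sum a' T = ?A - 1"
      proof -
        have "sum a T = a u + sum a (T - {u})" "sum a' T = a' u + sum a' (T - {u})"
          using u T by (simp_all add: sum.remove)
        moreover have "sum a' (T - {u}) = sum a (T - {u})" by (intro sum.cong) (auto simp: a'_def)
        ultimately show ?thesis using False by (simp add: a'_def)
      qed
      moreover have "?c = a u * (\<Prod>t\<in>T. fact (a' t))"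
      proof -
        have "?c = fact (a u) * (\<Prod>t\<in>T - {u}. fact (a t))" "(\<Prod>t\<in>T. fact (a' t) :: real) = fact (a' u) * (\<Prod>t\<in>T - {u}. fact (a' t))"
          using u T by (simp_all add: prod.remove)
        moreover have "(\<Prod>t\<in>T - {u}. fact (a' t) :: real) = (\<Prod>t\<in>T - {u}. fact (a t))"
          by (intro prod.cong) (auto simp: a'_def)
        moreover have "(fact (a u) :: real) = a u * fact (a' u)"
          using False by (simp add: a'_def fact_reduce)
        ultimately show ?thesis by simp
      qed
      ultimately show ?thesis using Suc.IH[of a'] False by (simp add: ff_def)
    qed
  qed
  also have "\<dots> = ?A * (ff n (?A - 1) / ?c * ?q ^ (n - (?A - 1)))"
    unfolding sum_distrib_right[symmetric] of_nat_sum ..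
  finally have rec: "?P (Suc n) a = ?q * ?P n a + ?A * ff n (?A - 1) / m / ?c * ?q ^ (n - (?A - 1))"
    using m by (simp add: field_simps)
  have ff0: "ff n A = 0" if "A > n" for n A
    unfolding ff_def using that by (intro prod_zero bexI[of _ n]) auto
  \<comment> \<open>Falling factorials satisfy (n+1)_(A+1) = (n)_(A+1) + (A+1) (n)_A; the two
    summands match the two terms of \<open>rec\<close>.\<close>
  have ff_rec: "ff (Suc n) (Suc A) = ff n (Suc A) + Suc A * ff n A / m" for A
  proof -
    have s: "ff (Suc n) (Suc A) = (real n + 1) / m * ff n A"
      unfolding ff_def by (subst prod.lessThan_Suc_shift) simp
    have "ff n (Suc A) = ff n A * ((real n - real A) / m)" by (simp add: ff_def)
    then show ?thesis unfolding s using m by (simp add: field_simps)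
  qed
  have "?P (Suc n) a = ff (Suc n) ?A / ?c * ?q ^ (Suc n - ?A)"
  proof (cases ?A)
    case 0
    then show ?thesis using rec Suc.IH[of a] by (simp add: ff_def)
  next
    case (Suc A)
    have IH: "?P n a = ff n (Suc A) / ?c * ?q ^ (n - Suc A)"
      using Suc.IH[of a] unfolding \<open>?A = Suc A\<close> ff_def .
    have "?q * ?P n a = ff n (Suc A) / ?c * ?q ^ (n - A)"
    proof (cases "Suc A \<le> n")
      case True
      then have "n - A = Suc (n - Suc A)" by simp
      then show ?thesis unfolding IH by (simp only: power_Suc mult.left_commute)
    next
      case False
      then have "ff n (Suc A) = 0" using ff0[of n "Suc A"] by simp
      then show ?thesis unfolding IH by (simp only: div_0 mult_zero_left mult_zero_right)
    qed
    then show ?thesis unfolding rec Suc ff_rec using \<open>?A = Suc A\<close> by (simp add: algebra_simps add_divide_distrib)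
  qed
  then show ?case by (simp only: ff_def)
qed

text \<open>In the exact formula the falling factorial over m^A tends to r^A with A the total
  prescribed count, and (1 - d/m)^(n-A) tends to e^(-d r) with d the number of buckets. Together
  with the factorials these are the Poisson weights. The addresses \<open>g N\<close> may vary with
  N.\<close>

lemma prob_key_counts_tendsto:
  fixes m n :: "nat \<Rightarrow> nat" and g :: "nat \<Rightarrow> 'a \<Rightarrow> nat"
  assumes m: "filterlim m at_top sequentially" and n: "filterlim n at_top sequentially"
    and ratio: "(\<lambda>N. real (n N) / real (m N)) \<longlonglongrightarrow> r" and r: "r > 0"
    and T: "finite T" and g: "eventually (\<lambda>N. inj_on (g N) T \<and> g N ` T \<subseteq> {..<m N}) sequentially"
  shows "(\<lambda>N. measure_pmf.prob (hash_pmf (m N) (n N)) {h. \<forall>t\<in>T. key_count (n N) h (g N t) = a t})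
    \<longlonglongrightarrow> (\<Prod>t\<in>T. pmf (poisson_pmf r) (a t))"
proof -
  define A where "A = sum a T"
  define d where "d = real (card T)"
  define q where "q = (\<lambda>N. 1 - d / real (m N))"
  have m_real: "filterlim (\<lambda>N. real (m N)) at_top sequentially"
    by (rule filterlim_compose[OF filterlim_real_sequentially m])
  have inv: "(\<lambda>N. c / real (m N)) \<longlonglongrightarrow> 0" for c
    by (rule tendsto_divide_0[OF tendsto_const filterlim_at_top_imp_at_infinity[OF m_real]])
  have "(\<lambda>N. (real (n N) - real i) / real (m N)) \<longlonglongrightarrow> r" for i
    using tendsto_diff[OF ratio inv[of "real i"]] by (simp add: diff_divide_distrib)
  then have 1: "(\<lambda>N. \<Prod>i<A. (real (n N) - real i) / real (m N)) \<longlonglongrightarrow> (\<Prod>i<A. r)"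
    by (intro tendsto_prod)
  have q1: "q \<longlonglongrightarrow> 1" using tendsto_diff[OF tendsto_const inv[of d], of 1] by (simp add: q_def[abs_def])
  \<comment> \<open>The power q^n is treated as (q^m)^(n/m), which combines the limit e^(-d) of the
    base with the limit r of the exponent.\<close>
  have "(\<lambda>N. (1 + (- d) / real (m N)) powr real (m N)) \<longlonglongrightarrow> exp (- d)"
    by (rule filterlim_compose[OF tendsto_exp_limit_at_top m_real])
  then have "(\<lambda>N. (q N powr real (m N)) powr (real (n N) / real (m N))) \<longlonglongrightarrow> exp (- d) powr r"
    by (intro tendsto_powr ratio) (auto simp: q_def)
  moreover have "eventually (\<lambda>N. m N > 0) sequentially"
    using m[unfolded filterlim_at_top, rule_format, of 1] by eventually_elim simp
  moreover have q_pos: "eventually (\<lambda>N. q N > 0) sequentially"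
    using q1 by (rule order_tendstoD) simp
  ultimately have 2: "(\<lambda>N. q N ^ n N) \<longlonglongrightarrow> exp (- d * r)"
  proof (subst (asm) exp_powr_real, elim Lim_transform_eventually)
    assume "eventually (\<lambda>N. m N > 0) sequentially"
    with q_pos show "eventually (\<lambda>N. (q N powr real (m N)) powr (real (n N) / real (m N)) = q N ^ n N) sequentially"
      by eventually_elim (subst powr_powr, simp add: powr_realpow)
  qed
  have n_ge: "eventually (\<lambda>N. n N \<ge> A) sequentially"
    using n unfolding filterlim_at_top by blast
  have 3: "(\<lambda>N. q N ^ (n N - A)) \<longlonglongrightarrow> exp (- d * r)"
  proof (rule Lim_transform_eventually)
    show "(\<lambda>N. q N ^ n N / q N ^ A) \<longlonglongrightarrow> exp (- d * r)"
      using tendsto_divide[OF 2 tendsto_power[OF q1, of A]] by simp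
    show "eventually (\<lambda>N. q N ^ n N / q N ^ A = q N ^ (n N - A)) sequentially"
      using n_ge q_pos by eventually_elim (simp add: power_diff)
  qed
  have "(\<lambda>N. (\<Prod>i<A. (real (n N) - real i) / real (m N)) / (\<Prod>t\<in>T. fact (a t)) * q N ^ (n N - A))
      \<longlonglongrightarrow> (\<Prod>i<A. r) / (\<Prod>t\<in>T. fact (a t)) * exp (- d * r)"
    by (intro tendsto_mult tendsto_divide tendsto_const 1 3) (simp add: T)
  moreover have "(\<Prod>i<A. r) / (\<Prod>t\<in>T. fact (a t)) * exp (- d * r) = (\<Prod>t\<in>T. pmf (poisson_pmf r) (a t))"
    using r T by (simp add: prod.distrib prod_dividef A_def power_sum d_def flip: exp_of_nat_mult)
  moreover have "eventually (\<lambda>N. (\<Prod>i<A. (real (n N) - real i) / real (m N)) / (\<Prod>t\<in>T. fact (a t)) * q N ^ (n N - A) =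
      measure_pmf.prob (hash_pmf (m N) (n N)) {h. \<forall>t\<in>T. key_count (n N) h (g N t) = a t}) sequentially"
    using g \<open>eventually (\<lambda>N. m N > 0) sequentially\<close>
    by eventually_elim (simp add: prob_key_counts[OF _ T] A_def q_def d_def)
  ultimately show ?thesis by (simp add: Lim_transform_eventually)
qed

section \<open>Localisation and convergence\<close>

text \<open>A version of "buckets 0 to k-1 full, bucket k not" that inspects only the L buckets
  ending at k: the inequality \<open>k - i + l \<le> L\<close> keeps the witness window of bucket i
  inside this stretch.\<close>

definition local_run :: "nat \<Rightarrow> nat \<Rightarrow> nat \<Rightarrow> (int \<Rightarrow> nat) \<Rightarrow> bool" where
  "local_run b L k y \<longleftrightarrow> (\<forall>l\<in>{1..L}. window y (int k) l < b * l) \<and>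
     (\<forall>i<k. \<exists>l\<ge>1. k - i + l \<le> L \<and> b * l \<le> window y (int i) l)"

lemma local_run_cong:
  assumes "\<And>t. t < L \<Longrightarrow> y (int k - int t) = y' (int k - int t)"
  shows "local_run b L k y \<longleftrightarrow> local_run b L k y'"
proof -
  have "window y (int k) l = window y' (int k) l" if "l \<le> L" for l
    by (intro window_cong assms) (use that in auto)
  moreover have "window y (int i) l = window y' (int i) l" if "i < k" "k - i + l \<le> L" for i l
  proof (rule window_cong)
    fix t assume "t < l"
    then show "y (int i - int t) = y' (int i - int t)"
      using assms[of "k - i + t"] that by (simp add: of_nat_diff algebra_simps)
  qed
  ultimately show ?thesis unfolding local_run_def by (metis atLeastAtMost_iff)
qed

text \<open>Finite patterns of counts, read leftwards from bucket k. The cap \<open>b * L\<close>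
  makes the set finite and excludes nothing, since the first clause of \<open>local_run\<close>
  bounds every count in the stretch.\<close>

definition local_run_counts :: "nat \<Rightarrow> nat \<Rightarrow> nat \<Rightarrow> (nat \<Rightarrow> nat) set" where
  "local_run_counts b L k =
     {a \<in> PiE {..<L} (\<lambda>_. {..b * L}). local_run b L k (\<lambda>i. a (nat (int k - i)))}"

lemma finite_local_run_counts: "finite (local_run_counts b L k)"
  unfolding local_run_counts_def by (rule finite_subset[of _ "PiE {..<L} (\<lambda>_. {..b * L})"]) (auto intro: finite_PiE)

lemma local_run_iff_counts:
  "local_run b L k y \<longleftrightarrow> (\<exists>a\<in>local_run_counts b L k. \<forall>t<L. y (int k - int t) = a t)"
proof
  assume y: "local_run b L k y"
  define a where "a = restrict (\<lambda>t. y (int k - int t)) {..<L}"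
  have "a t \<le> b * L" if "t < L" for t
  proof -
    have "y (int k - int t) \<le> window y (int k) (Suc t)" by (simp add: window_def)
    also have "Suc t \<in> {1..L}" using that by auto
    then have "window y (int k) (Suc t) < b * Suc t" using y unfolding local_run_def by blast
    also have "\<dots> \<le> b * L" using that by (intro mult_left_mono) auto
    finally show ?thesis using that by (simp add: a_def)
  qed
  moreover have "local_run b L k (\<lambda>i. a (nat (int k - i)))"
    using y by (subst local_run_cong[of L _ _ y]) (auto simp: a_def)
  ultimately have "a \<in> local_run_counts b L k"
    by (auto simp: local_run_counts_def a_def)
  then show "\<exists>a\<in>local_run_counts b L k. \<forall>t<L. y (int k - int t) = a t"
    by (intro bexI[of _ a]) (auto simp: a_def)
next
  assume "\<exists>a\<in>local_run_counts b L k. \<forall>t<L. y (int k - int t) = a t"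
  then obtain a where a: "local_run b L k (\<lambda>i. a (nat (int k - i)))" "\<And>t. t < L \<Longrightarrow> y (int k - int t) = a t"
    by (auto simp: local_run_counts_def)
  show "local_run b L k y" using a(1) by (subst (asm) local_run_cong[of L _ _ y]) (use a(2) in auto)
qed

text \<open>The event is a disjoint union of finitely many prescriptions of L counts, the only
  events whose limits have been computed.\<close>

lemma (in prob_space) prob_local_run:
  assumes ev: "\<And>a. {w \<in> space M. \<forall>t<L. Y w (int k - int t) = a t} \<in> events"
  shows "{w \<in> space M. local_run b L k (Y w)} \<in> events"
    and "prob {w \<in> space M. local_run b L k (Y w)} =
      (\<Sum>a\<in>local_run_counts b L k. prob {w \<in> space M. \<forall>t<L. Y w (int k - int t) = a t})"
proof -
  let ?E = "\<lambda>a. {w \<in> space M. \<forall>t<L. Y w (int k - int t) = a t}"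
  have eq: "{w \<in> space M. local_run b L k (Y w)} = (\<Union>a\<in>local_run_counts b L k. ?E a)"
    by (auto simp: local_run_iff_counts)
  show "{w \<in> space M. local_run b L k (Y w)} \<in> events"
    unfolding eq by (intro sets.finite_UN finite_local_run_counts ev)
  show "prob {w \<in> space M. local_run b L k (Y w)} = (\<Sum>a\<in>local_run_counts b L k. prob (?E a))"
    unfolding eq
  proof (rule finite_measure_finite_Union[OF finite_local_run_counts])
    show "disjoint_family_on ?E (local_run_counts b L k)"
      unfolding disjoint_family_on_def
    proof (intro ballI impI)
      fix a a' assume a: "a \<in> local_run_counts b L k" "a' \<in> local_run_counts b L k" "a \<noteq> a'"
      then have "\<exists>t<L. a t \<noteq> a' t"
      proof -
        have PiE: "a \<in> PiE {..<L} (\<lambda>_. {..b * L})" "a' \<in> PiE {..<L} (\<lambda>_. {..b * L})"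
          using a(1,2) unfolding local_run_counts_def by simp_all
        then show ?thesis using PiE_ext[OF PiE] a(3) by auto
      qed
      then show "?E a \<inter> ?E a' = {}" by auto
    qed
  qed (rule image_subsetI, rule ev)
qed

text \<open>
  \<open>Q\<close> is the range of window lengths that have to be considered: all of them in the infinite
  model, those shorter than a full turn in the exact model.
\<close>

lemma local_run_iff:
  assumes full: "\<And>i. full b y i \<longleftrightarrow> (\<exists>l\<ge>1. Q l \<and> b * l \<le> window y i l)"
    and short: "\<And>i l. i \<le> k \<Longrightarrow> L - k < l \<Longrightarrow> Q l \<Longrightarrow> window y (int i) l < b * l" and "k \<le> L"
  shows "(\<forall>i<k. full b y (int i)) \<and> \<not> full b y (int k) \<longleftrightarrow> local_run b L k y"
proof
  assume y: "(\<forall>i<k. full b y (int i)) \<and> \<not> full b y (int k)"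
  have "\<exists>l\<ge>1. k - i + l \<le> L \<and> b * l \<le> window y (int i) l" if i: "i < k" for i
  proof -
    obtain l where l: "l \<ge> 1" "Q l" "b * l \<le> window y (int i) l" using y full i by blast
    \<comment> \<open>This length leaves room for the offset \<open>k - i\<close>, which is at most
      k, so the window stays within the L buckets ending at k.\<close>
    then have "l \<le> L - k" using short[of i l] i by (meson less_imp_le not_le)
    then show ?thesis using l \<open>k \<le> L\<close> by (intro exI[of _ l]) auto
  qed
  moreover have "window y (int k) l < b * l" if "l \<in> {1..L}" for l
    using y that unfolding full_def by (meson atLeastAtMost_iff not_le)
  ultimately show "local_run b L k y" by (simp add: local_run_def)
next
  assume y: "local_run b L k y"
  have "\<not> full b y (int k)"
  proof
    assume "full b y (int k)"
    then obtain l where l: "l \<ge> 1" "Q l" "b * l \<le> window y (int k) l" using full by blast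
    then have "l \<le> L - k" using short[of k l] by (meson order_refl not_le)
    then show False using y l by (auto simp: local_run_def not_less[symmetric])
  qed
  moreover have "full b y (int i)" if "i < k" for i
    using y that by (auto simp: local_run_def full_def)
  ultimately show "(\<forall>i<k. full b y (int i)) \<and> \<not> full b y (int k)" by blast
qed

lemma (in prob_space) prob_diff_le:
  assumes "A \<in> events" "B \<in> events" "D \<in> events" "\<And>w. w \<in> space M \<Longrightarrow> w \<notin> D \<Longrightarrow> w \<in> A \<longleftrightarrow> w \<in> B"
  shows "\<bar>prob A - prob B\<bar> \<le> prob D"
proof -
  have le: "prob A' \<le> prob B' + prob D"
    if "A' \<in> events" "B' \<in> events" "\<And>w. w \<in> space M \<Longrightarrow> w \<notin> D \<Longrightarrow> w \<in> A' \<longleftrightarrow> w \<in> B'" for A' B'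
  proof -
    have "A' \<subseteq> B' \<union> D" using that sets.sets_into_space by blast
    then have "prob A' \<le> prob (B' \<union> D)" using that assms by (intro finite_measure_mono) auto
    also have "\<dots> \<le> prob B' + prob D" using that assms by (intro measure_Un_le) auto
    finally show ?thesis .
  qed
  show ?thesis using le[of A B] le[of B A] assms by auto
qed

lemma (in prob_space) prob_long_window_le:
  assumes "\<And>i. {w \<in> space M. \<exists>l\<ge>K. Q l \<and> b * l \<le> window (Y w) (int i) l} \<in> events"
    and "\<And>i. prob {w \<in> space M. \<exists>l\<ge>K. Q l \<and> b * l \<le> window (Y w) (int i) l} \<le> c"
  shows "{w \<in> space M. \<exists>i\<le>k. \<exists>l\<ge>K. Q l \<and> b * l \<le> window (Y w) (int i) l} \<in> events"
    "prob {w \<in> space M. \<exists>i\<le>k. \<exists>l\<ge>K. Q l \<and> b * l \<le> window (Y w) (int i) l} \<le> real (Suc k) * c"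
proof -
  let ?E = "\<lambda>i. {w \<in> space M. \<exists>l\<ge>K. Q l \<and> b * l \<le> window (Y w) (int i) l}"
  have eq: "{w \<in> space M. \<exists>i\<le>k. \<exists>l\<ge>K. Q l \<and> b * l \<le> window (Y w) (int i) l} = (\<Union>i\<le>k. ?E i)" by auto
  show "{w \<in> space M. \<exists>i\<le>k. \<exists>l\<ge>K. Q l \<and> b * l \<le> window (Y w) (int i) l} \<in> events"
    unfolding eq by (intro sets.finite_UN assms(1)) simp
  have "prob (\<Union>i\<le>k. ?E i) \<le> (\<Sum>i\<le>k. prob (?E i))"
    by (rule finite_measure_subadditive_finite[OF finite_atMost]) (rule image_subsetI, rule assms(1))
  also have "\<dots> \<le> (\<Sum>i\<le>k. c)" by (intro sum_mono assms(2))
  finally show "prob {w \<in> space M. \<exists>i\<le>k. \<exists>l\<ge>K. Q l \<and> b * l \<le> window (Y w) (int i) l} \<le> real (Suc k) * c"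
    unfolding eq by simp
qed

lemma (in poisson_counts) prob_counts:
  "prob {w \<in> space M. \<forall>t<L. X (i - int t) w = a t} = (\<Prod>t<L. pmf (poisson_pmf r) (a t))"
proof (cases "L = 0")
  case False
  have "indep_vars (\<lambda>_. count_space UNIV) (\<lambda>t. X (i - int t)) {..<L}"
    by (rule indep_vars_reindex[OF indep_X]) (auto simp: inj_on_def)
  then have "prob (\<Inter>t\<in>{..<L}. X (i - int t) -` {a t} \<inter> space M) = (\<Prod>t<L. prob (X (i - int t) -` {a t} \<inter> space M))"
    by (rule indep_varsD) (use False in auto)
  moreover have "(\<Inter>t\<in>{..<L}. X (i - int t) -` {a t} \<inter> space M) = {w \<in> space M. \<forall>t<L. X (i - int t) w = a t}"
    using False by auto
  moreover have "X (i - int t) -` {a t} \<inter> space M = {w \<in> space M. X (i - int t) w = a t}" for t by auto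
  ultimately show ?thesis by (simp add: prob_X del: pmf_poisson)
qed (simp add: prob_space)

text \<open>Off the event \<open>?D\<close> that one of the buckets 0 to k ends an overloaded window
  longer than \<open>L - k\<close>, the local and the true event coincide; there are k + 1 such
  buckets, each with a geometric tail.\<close>

lemma (in poisson_counts) prob_local_run_approx:
  assumes "z \<ge> 1" and "exp (r * (z - 1)) / z ^ b \<le> \<phi>" "\<phi> < 1" and "k \<le> L"
  shows "\<bar>prob {w \<in> space M. first_nonfull b (\<lambda>i. X i w) = k} -
      (\<Sum>a\<in>local_run_counts b L k. \<Prod>t<L. pmf (poisson_pmf r) (a t))\<bar> \<le>
    real (Suc k) * (\<phi> ^ Suc (L - k) / (1 - \<phi>))"
proof -
  have ev: "{w \<in> space M. \<forall>t<L. X (int k - int t) w = a t} \<in> events" for a by measurable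
  let ?D = "{w \<in> space M. \<exists>i\<le>k. \<exists>l\<ge>Suc (L - k). True \<and> b * l \<le> window (\<lambda>i. X i w) (int i) l}"
  have D: "?D \<in> events" "prob ?D \<le> real (Suc k) * (\<phi> ^ Suc (L - k) / (1 - \<phi>))"
  proof -
    have "{w \<in> space M. \<exists>l\<ge>Suc (L - k). True \<and> b * l \<le> window (\<lambda>i. X i w) (int i) l} \<in> events" for i
      by measurable
    moreover have "prob {w \<in> space M. \<exists>l\<ge>Suc (L - k). True \<and> b * l \<le> window (\<lambda>i. X i w) (int i) l} \<le>
        \<phi> ^ Suc (L - k) / (1 - \<phi>)" for i
      using windows_tail[OF assms(1-3), of "Suc (L - k)" "int i"] by (simp only: True_implies_equals simp_thms)
    ultimately show "?D \<in> events" "prob ?D \<le> real (Suc k) * (\<phi> ^ Suc (L - k) / (1 - \<phi>))"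
      by (rule prob_long_window_le)+
  qed
  have "\<bar>prob {w \<in> space M. (\<forall>i<k. full b (\<lambda>i. X i w) (int i)) \<and> \<not> full b (\<lambda>i. X i w) (int k)} -
      prob {w \<in> space M. local_run b L k (\<lambda>i. X i w)}\<bar> \<le> prob ?D"
  proof (rule prob_diff_le)
    show "w \<in> {w \<in> space M. (\<forall>i<k. full b (\<lambda>i. X i w) (int i)) \<and> \<not> full b (\<lambda>i. X i w) (int k)} \<longleftrightarrow>
        w \<in> {w \<in> space M. local_run b L k (\<lambda>i. X i w)}" if w: "w \<in> space M" "w \<notin> ?D" for w
    proof -
      have "window (\<lambda>i. X i w) (int i) l < b * l" if "i \<le> k" "L - k < l" for i l
      proof (rule ccontr)
        assume "\<not> window (\<lambda>i. X i w) (int i) l < b * l"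
        then have "\<exists>i\<le>k. \<exists>l\<ge>Suc (L - k). True \<and> b * l \<le> window (\<lambda>i. X i w) (int i) l"
          using that by (intro exI[of _ i] conjI exI[of _ l]) auto
        then show False using w by blast
      qed
      then show ?thesis
        using local_run_iff[of b "\<lambda>i. X i w" "\<lambda>_. True" k L] \<open>k \<le> L\<close> w by (simp add: full_def)
    qed
  qed (use prob_local_run(1)[OF ev] D in auto)
  then show ?thesis
    using D prob_first_nonfull_eq[OF AE_nonfull[OF assms(1-3)], of k] prob_local_run(2)[OF ev, of b]
    by (simp add: prob_counts del: pmf_poisson)
qed

lemma hash_count_periodic: "hash_count m n s h (i mod int m) = hash_count m n s h i"
  by (simp add: hash_count_def mod_add_right_eq)

lemma U_exact_set_pmf:
  assumes n: "n < b * m" and h: "h \<in> set_pmf (hash_pmf m n)"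
  shows "U_exact b m n s h = first_nonfull b (hash_count m n s h)"
    and "\<exists>k. \<not> full b (hash_count m n s h) (int k)"
proof -
  have "m > 0" using n by (cases m) auto
  then have lt: "h k < m" if "k < n" for k using h that by (rule set_hash_pmf)
  show "U_exact b m n s h = first_nonfull b (hash_count m n s h)"
    by (rule U_exact_eq_first_nonfull(1)) (use n lt in auto)
  show "\<exists>k. \<not> full b (hash_count m n s h) (int k)"
    by (rule U_exact_eq_first_nonfull(2)) (use n lt in auto)
qed

lemma hash_full_run_window:
  assumes n: "n < b * m" and h: "h \<in> set_pmf (hash_pmf m n)"
    and k: "k \<ge> 1" "\<And>i. i < k \<Longrightarrow> full b (hash_count m n s h) (j - int i)"
  shows "\<exists>l. k \<le> l \<and> l < m \<and> b * l \<le> window (hash_count m n s h) j l"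
proof -
  have m: "m > 0" using n by (cases m) auto
  obtain p where "\<not> full b (hash_count m n s h) (int p)"
    using U_exact_set_pmf(2)[OF n h] by blast
  then show ?thesis
    by (rule periodic_full_run_window[OF m hash_count_periodic _ k])
qed

text \<open>The error has the same form as in the infinite model and, for given \<phi>, is free of m
  and n; the size of the table can therefore grow before L does.\<close>

lemma hash_local_run_approx:
  assumes n: "n < b * m" and z: "z \<ge> 1" and \<phi>: "exp ((z - 1) * (n / m)) / z ^ b \<le> \<phi>" "\<phi> < 1"
    and L: "k \<le> L" "L \<le> m"
  shows "\<bar>measure_pmf.prob (hash_pmf m n) {h. U_exact b m n s h = k} -
      (\<Sum>a\<in>local_run_counts b L k. measure_pmf.prob (hash_pmf m n)
        {h. \<forall>t\<in>{..<L}. key_count n h (nat ((int s + (int k - int t)) mod int m)) = a t})\<bar> \<le>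
    real (Suc k) * (\<phi> ^ Suc (L - k) / (1 - \<phi>))"
proof -
  have m: "m > 0" using n by (cases m) auto
  let ?P = "measure_pmf.prob (hash_pmf m n)"
  let ?c = "hash_count m n s"
  let ?D = "{h \<in> space (hash_pmf m n). \<exists>i\<le>k. \<exists>l\<ge>Suc (L - k). l < m \<and> b * l \<le> window (?c h) (int i) l}"
  have D: "?P ?D \<le> real (Suc k) * (\<phi> ^ Suc (L - k) / (1 - \<phi>))"
  proof (rule measure_pmf.prob_long_window_le)
    show "?P {h \<in> space (hash_pmf m n). \<exists>l\<ge>Suc (L - k). l < m \<and> b * l \<le> window (?c h) (int i) l} \<le>
        \<phi> ^ Suc (L - k) / (1 - \<phi>)" for i
      using hash_windows_tail[OF m z \<phi>, of "Suc (L - k)" s "int i"]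
      by (simp only: space_measure_pmf UNIV_I simp_thms)
  qed simp
  let ?S = "set_pmf (hash_pmf m n)"
  \<comment> \<open>Both events are intersected with the support, because the description of linear
    probing by windows relies on all addresses being below m.\<close>
  have "\<bar>?P ({h. U_exact b m n s h = k} \<inter> ?S) - ?P ({h. local_run b L k (?c h)} \<inter> ?S)\<bar> \<le> ?P ?D"
  proof (rule measure_pmf.prob_diff_le)
    show "h \<in> {h. U_exact b m n s h = k} \<inter> ?S \<longleftrightarrow> h \<in> {h. local_run b L k (?c h)} \<inter> ?S"
      if w: "h \<notin> ?D" for h
    proof (cases "h \<in> ?S")
      case True
      note U = U_exact_set_pmf[OF n True, of s]
      obtain p where p: "\<not> full b (?c h) (int p)" using U(2) by blast
      have "window (?c h) (int i) l < b * l" if "i \<le> k" "L - k < l" "l < m" for i l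
      proof (rule ccontr)
        assume "\<not> window (?c h) (int i) l < b * l"
        then have "\<exists>i\<le>k. \<exists>l\<ge>Suc (L - k). l < m \<and> b * l \<le> window (?c h) (int i) l"
          using that by (intro exI[of _ i] conjI exI[of _ l]) auto
        then show False using w by simp
      qed
      moreover have "full b (?c h) i \<longleftrightarrow> (\<exists>l\<ge>1. l < m \<and> b * l \<le> window (?c h) i l)" for i
        using hash_full_run_window[OF n True, of 1 s i] by (auto simp: full_def)
      ultimately have "U_exact b m n s h = k \<longleftrightarrow> local_run b L k (?c h)"
        using local_run_iff[of b "?c h" "\<lambda>l. l < m" k L] L first_nonfull_eq_iff[OF p, of k]
        unfolding U(1) by blast
      then show ?thesis using True by simp
    qed auto
  qed auto
  then have "\<bar>?P {h. U_exact b m n s h = k} - ?P {h. local_run b L k (?c h)}\<bar> \<le> ?P ?D"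
    by (simp only: measure_Int_set_pmf)
  moreover have "?P {h. local_run b L k (?c h)} = (\<Sum>a\<in>local_run_counts b L k. ?P
        {h. \<forall>t\<in>{..<L}. key_count n h (nat ((int s + (int k - int t)) mod int m)) = a t})"
    using measure_pmf.prob_local_run(2)[where Y = ?c and k = k and L = L and b = b]
    by (simp add: hash_count_eq_key_count Ball_def)
  ultimately show ?thesis using D by linarith
qed

lemma hash_U_tail:
  assumes n: "n < b * m" and z: "z \<ge> 1" and \<phi>: "exp ((z - 1) * (n / m)) / z ^ b \<le> \<phi>" "\<phi> < 1"
  shows "measure_pmf.prob (hash_pmf m n) {h. U_exact b m n s h = k} \<le> \<phi> ^ k / (1 - \<phi>)"
proof (cases "k = 0")
  case True
  have "exp ((z - 1) * (n / m)) / z ^ b \<ge> 0" using z by simp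
  then have "0 \<le> \<phi>" using \<phi> by linarith
  then have "1 \<le> \<phi> ^ k / (1 - \<phi>)" using \<phi> True by simp
  then show ?thesis using measure_pmf.prob_le_1 order_trans by blast
next
  case False
  have m: "m > 0" using n by (cases m) auto
  let ?S = "set_pmf (hash_pmf m n)"
  have "measure_pmf.prob (hash_pmf m n) ({h. U_exact b m n s h = k} \<inter> ?S) \<le>
    measure_pmf.prob (hash_pmf m n) {h. \<exists>l. k \<le> l \<and> l < m \<and> b * l \<le> window (hash_count m n s h) (int (k - 1)) l}"
  proof (intro measure_pmf.finite_measure_mono subsetI CollectI)
    fix h assume h: "h \<in> {h. U_exact b m n s h = k} \<inter> ?S"
    then have "h \<in> ?S" by blast
    note U = U_exact_set_pmf[OF n this, of s]
    obtain p where p: "\<not> full b (hash_count m n s h) (int p)" using U(2) by blast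
    have run: "\<forall>i<k. full b (hash_count m n s h) (int i)"
      using first_nonfull_eq_iff[OF p, of k] U(1) h by auto
    show "\<exists>l. k \<le> l \<and> l < m \<and> b * l \<le> window (hash_count m n s h) (int (k - 1)) l"
    proof (rule hash_full_run_window[OF n])
      show "full b (hash_count m n s h) (int (k - 1) - int i)" if "i < k" for i
      proof -
        have eq: "int (k - 1) - int i = int (k - 1 - i)" and "k - 1 - i < k" using that by auto
        then show ?thesis unfolding eq using run by blast
      qed
    qed (use h False in auto)
  qed auto
  also have "\<dots> \<le> \<phi> ^ k / (1 - \<phi>)" by (rule hash_windows_tail[OF m z \<phi>])
  finally show ?thesis by (simp only: measure_Int_set_pmf)
qed

text \<open>One term of the exponential series of k ln \<rho> is at most the whole series, which is
  \<rho>^k.\<close>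

lemma power_le_const_mult_power:
  fixes \<rho> :: real
  assumes "\<rho> > 1"
  shows "\<exists>B. \<forall>k. real k ^ r \<le> B * \<rho> ^ k"
proof (intro exI allI)
  fix k
  have t: "ln \<rho> > 0" using assms by simp
  have "(real k * ln \<rho>) ^ r / fact r \<le> exp (real k * ln \<rho>)"
  proof -
    have s: "(\<lambda>n. (real k * ln \<rho>) ^ n /\<^sub>R fact n) sums exp (real k * ln \<rho>)" by (rule exp_converges)
    have "(\<Sum>n\<in>{r}. (real k * ln \<rho>) ^ n /\<^sub>R fact n) \<le> (\<Sum>n. (real k * ln \<rho>) ^ n /\<^sub>R fact n)"
      using s t by (intro sum_le_suminf) (auto simp: sums_iff)
    then show ?thesis using s by (simp add: sums_iff divide_inverse mult.commute)
  qed
  also have "exp (real k * ln \<rho>) = \<rho> ^ k" using assms by (simp add: exp_of_nat_mult)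
  finally show "real k ^ r \<le> (fact r / ln \<rho> ^ r) * \<rho> ^ k"
    using t by (simp add: power_mult_distrib field_simps)
qed

section \<open>Convergence from point probabilities and a common geometric tail\<close>

context
  fixes Ms :: "nat \<Rightarrow> 'a measure" and Us :: "nat \<Rightarrow> 'a \<Rightarrow> nat"
    and M :: "'b measure" and U :: "'b \<Rightarrow> nat" and C \<phi> \<rho> :: real
  assumes Ms: "\<And>N. prob_space (Ms N)" and Us: "\<And>N. Us N \<in> Ms N \<rightarrow>\<^sub>M count_space UNIV"
    and M: "prob_space M" and U: "U \<in> M \<rightarrow>\<^sub>M count_space UNIV"
    and lim: "\<And>k. (\<lambda>N. measure (Ms N) {w \<in> space (Ms N). Us N w = k}) \<longlonglongrightarrow> measure M {w \<in> space M. U w = k}"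
    and tail: "eventually (\<lambda>N. \<forall>k. measure (Ms N) {w \<in> space (Ms N). Us N w = k} \<le> C * \<phi> ^ k) sequentially"
    and \<phi>: "\<phi> \<ge> 0" and \<rho>: "\<rho> > 1" "\<rho> * \<phi> < 1"
begin

lemma limit_tail: "measure M {w \<in> space M. U w = k} \<le> C * \<phi> ^ k"
proof (rule tendsto_upperbound[OF lim])
  show "\<forall>\<^sub>F N in sequentially. measure (Ms N) {w \<in> space (Ms N). Us N w = k} \<le> C * \<phi> ^ k"
    using tail by eventually_elim simp
qed auto

lemma C_nonneg: "C \<ge> 0"
  using order_trans[OF measure_nonneg limit_tail[of 0]] by simp

lemma summable_tail: "summable (\<lambda>k. \<rho> ^ k * (C * \<phi> ^ k))"
proof -
  have "summable (\<lambda>k. C * (\<rho> * \<phi>) ^ k)"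
    using \<phi> \<rho> by (intro summable_mult summable_geometric) auto
  then show ?thesis by (simp add: power_mult_distrib mult_ac)
qed

text \<open>A weighted l^1 distance between the two laws. It controls at once all test functions
  growing at most like \<rho>^k: indicators, powers of k, and q^k with |q| \<le> \<rho>.\<close>

definition discrepancy :: "nat \<Rightarrow> real" where
  "discrepancy N = (\<Sum>k. \<rho> ^ k * \<bar>measure (Ms N) {w \<in> space (Ms N). Us N w = k} - measure M {w \<in> space M. U w = k}\<bar>)"

lemma abs_diff_le:
  assumes "measure (Ms N) {w \<in> space (Ms N). Us N w = k} \<le> C * \<phi> ^ k"
  shows "\<bar>measure (Ms N) {w \<in> space (Ms N). Us N w = k} - measure M {w \<in> space M. U w = k}\<bar> \<le> C * \<phi> ^ k"
  using assms limit_tail[of k] measure_nonneg[of M] measure_nonneg[of "Ms N"] by (simp add: abs_le_iff add_increasing2 diff_le_eq)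

text \<open>Dominated convergence for series: each term tends to 0, and the common tail supplies a
  summable majorant because \<rho> \<phi> < 1.\<close>

lemma discrepancy_tendsto: "discrepancy \<longlonglongrightarrow> 0"
proof -
  let ?a = "\<lambda>k N. \<rho> ^ k * \<bar>measure (Ms N) {w \<in> space (Ms N). Us N w = k} - measure M {w \<in> space M. U w = k}\<bar>"
  have "(\<lambda>N. \<Sum>k. ?a k N) \<longlonglongrightarrow> (\<Sum>k. 0)"
  proof (rule tannerys_theorem[THEN conjunct2, THEN conjunct2])
    show "(\<lambda>N. ?a k N) \<longlonglongrightarrow> 0" for k
      using tendsto_mult_right_zero[OF tendsto_rabs_zero[OF LIM_zero[OF lim[of k]]], of "\<rho> ^ k"] by simp
    show "\<forall>\<^sub>F (k, N) in sequentially \<times>\<^sub>F sequentially. norm (?a k N) \<le> \<rho> ^ k * (C * \<phi> ^ k)"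
      unfolding eventually_prod_filter
    proof (intro exI conjI allI impI)
      show "\<forall>\<^sub>F k in sequentially. (\<lambda>_. True) k" by simp
      show "\<forall>\<^sub>F N in sequentially. (\<lambda>N. \<forall>k. measure (Ms N) {w \<in> space (Ms N). Us N w = k} \<le> C * \<phi> ^ k) N"
        using tail by simp
      fix k N assume "\<forall>k. measure (Ms N) {w \<in> space (Ms N). Us N w = k} \<le> C * \<phi> ^ k"
      then show "case (k, N) of (k, N) \<Rightarrow> norm (?a k N) \<le> \<rho> ^ k * (C * \<phi> ^ k)"
        using abs_diff_le[of N k] \<rho> by (simp add: abs_mult mult_left_mono)
    qed
  qed (use summable_tail in auto)
  then show ?thesis by (simp add: discrepancy_def[abs_def])
qed

lemma integrable_of_tail:
  fixes f :: "nat \<Rightarrow> 'c :: {banach, second_countable_topology}" and M' :: "'d measure"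
  assumes "prob_space M'" "V \<in> M' \<rightarrow>\<^sub>M count_space UNIV"
    and "\<And>k. measure M' {w \<in> space M'. V w = k} \<le> C * \<phi> ^ k" and "\<And>k. norm (f k) \<le> B * \<rho> ^ k"
  shows "integrable M' (\<lambda>w. f (V w))"
  unfolding nat_rv_integral(1)[OF assms(2,1)]
proof (rule summable_comparison_test'[OF summable_mult[OF summable_tail, of B]])
  fix k
  have "measure M' {w \<in> space M'. V w = k} * norm (f k) \<le> (C * \<phi> ^ k) * (B * \<rho> ^ k)"
    using C_nonneg \<phi> by (intro mult_mono assms) auto
  then show "norm (measure M' {w \<in> space M'. V w = k} * norm (f k)) \<le> B * (\<rho> ^ k * (C * \<phi> ^ k))"
    by (simp add: mult_ac)
qed

lemma expectation_diff_le:
  fixes f :: "nat \<Rightarrow> 'c :: {banach, second_countable_topology}"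
  assumes N: "\<forall>k. measure (Ms N) {w \<in> space (Ms N). Us N w = k} \<le> C * \<phi> ^ k"
    and f: "\<And>k. norm (f k) \<le> B * \<rho> ^ k"
  shows "norm ((\<integral>w. f (Us N w) \<partial>Ms N) - (\<integral>w. f (U w) \<partial>M)) \<le> B * discrepancy N"
proof -
  let ?p = "\<lambda>k. measure (Ms N) {w \<in> space (Ms N). Us N w = k}" and ?q = "\<lambda>k. measure M {w \<in> space M. U w = k}"
  have i1: "integrable (Ms N) (\<lambda>w. f (Us N w))" by (rule integrable_of_tail[OF Ms Us _ f]) (use N in auto)
  have i2: "integrable M (\<lambda>w. f (U w))" by (rule integrable_of_tail[OF M U limit_tail f])
  have s1: "summable (\<lambda>k. ?p k *\<^sub>R f k)"
    using i1 unfolding nat_rv_integral(1)[OF Us Ms] by (intro summable_norm_cancel[of "\<lambda>k. ?p k *\<^sub>R f k"]) simp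
  have s2: "summable (\<lambda>k. ?q k *\<^sub>R f k)"
    using i2 unfolding nat_rv_integral(1)[OF U M] by (intro summable_norm_cancel[of "\<lambda>k. ?q k *\<^sub>R f k"]) simp
  have s: "summable (\<lambda>k. \<rho> ^ k * \<bar>?p k - ?q k\<bar>)"
    by (rule summable_comparison_test'[OF summable_tail]) (use N abs_diff_le[of N] \<rho> in \<open>auto simp: abs_mult intro!: mult_left_mono\<close>)
  have "(\<integral>w. f (Us N w) \<partial>Ms N) - (\<integral>w. f (U w) \<partial>M) = (\<Sum>k. (?p k - ?q k) *\<^sub>R f k)"
    using nat_rv_integral(2)[OF Us Ms i1] nat_rv_integral(2)[OF U M i2] suminf_diff[OF s1 s2]
    by (simp add: scaleR_left_diff_distrib)
  also have "norm \<dots> \<le> (\<Sum>k. B * (\<rho> ^ k * \<bar>?p k - ?q k\<bar>))"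
  proof (rule norm_suminf_le)
    show "norm ((?p k - ?q k) *\<^sub>R f k) \<le> B * (\<rho> ^ k * \<bar>?p k - ?q k\<bar>)" for k
      using mult_left_mono[OF f[of k], of "\<bar>?p k - ?q k\<bar>"] by (simp add: mult_ac)
  qed (rule summable_mult[OF s])
  also have "\<dots> = B * discrepancy N" unfolding discrepancy_def by (rule suminf_mult[OF s])
  finally show ?thesis .
qed

lemma expectation_tendsto:
  fixes f :: "nat \<Rightarrow> 'c :: {banach, second_countable_topology}"
  assumes f: "\<And>k. norm (f k) \<le> B * \<rho> ^ k"
  shows "(\<lambda>N. \<integral>w. f (Us N w) \<partial>Ms N) \<longlonglongrightarrow> (\<integral>w. f (U w) \<partial>M)"
proof -
  have "(\<lambda>N. (\<integral>w. f (Us N w) \<partial>Ms N) - (\<integral>w. f (U w) \<partial>M)) \<longlonglongrightarrow> 0"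
  proof (rule Lim_null_comparison)
    show "\<forall>\<^sub>F N in sequentially. norm ((\<integral>w. f (Us N w) \<partial>Ms N) - (\<integral>w. f (U w) \<partial>M)) \<le> B * discrepancy N"
      using tail by eventually_elim (rule expectation_diff_le[OF _ f])
    show "(\<lambda>N. B * discrepancy N) \<longlonglongrightarrow> 0" using tendsto_mult_right_zero[OF discrepancy_tendsto] .
  qed
  then show ?thesis by (simp add: LIM_zero_iff)
qed

text \<open>A distribution function is the expectation of a bounded indicator, so it converges at
  every point, including the jumps of the limit.\<close>

lemma weak_conv_of_tail:
  "weak_conv_m (\<lambda>N. distr (Ms N) borel (\<lambda>w. real (Us N w))) (distr M borel (\<lambda>w. real (U w)))"
  unfolding weak_conv_m_def weak_conv_def
proof (intro allI impI)
  fix x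
  let ?f = "\<lambda>k. indicator {k. real k \<le> x} k :: real"
  have cdf: "cdf (distr M' borel (\<lambda>w. real (V w))) x = (\<integral>w. ?f (V w) \<partial>M')"
    if "prob_space M'" and V[measurable]: "V \<in> M' \<rightarrow>\<^sub>M count_space UNIV" for M' :: "'d measure" and V
  proof -
    interpret prob_space M' by fact
    have "cdf (distr M' borel (\<lambda>w. real (V w))) x = prob {w \<in> space M'. real (V w) \<le> x}"
      unfolding cdf_def by (subst measure_distr) (auto intro!: arg_cong[where f = prob])
    also have "\<dots> = expectation (indicator {w \<in> space M'. real (V w) \<le> x})" by simp
    also have "\<dots> = (\<integral>w. ?f (V w) \<partial>M')"
      by (intro Bochner_Integration.integral_cong) (auto simp: indicator_def)
    finally show ?thesis .
  qed
  have "norm (?f k) \<le> 1 * \<rho> ^ k" for k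
    using \<rho>(1) one_le_power[of \<rho> k] by (auto simp: indicator_def)
  from expectation_tendsto[OF this]
  show "(\<lambda>N. cdf (distr (Ms N) borel (\<lambda>w. real (Us N w))) x) \<longlonglongrightarrow> cdf (distr M borel (\<lambda>w. real (U w))) x"
    by (simp add: cdf[OF Ms Us] cdf[OF M U])
qed

lemma moments_of_tail:
  "integrable M (\<lambda>w. real (U w) ^ r)"
  "(\<lambda>N. \<integral>w. real (Us N w) ^ r \<partial>Ms N) \<longlonglongrightarrow> (\<integral>w. real (U w) ^ r \<partial>M)"
proof -
  obtain B where "\<And>k. real k ^ r \<le> B * \<rho> ^ k" using power_le_const_mult_power[OF \<rho>(1)] by blast
  then have B: "norm (real k ^ r) \<le> B * \<rho> ^ k" for k by simp
  show "integrable M (\<lambda>w. real (U w) ^ r)" by (rule integrable_of_tail[OF M U limit_tail B])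
  show "(\<lambda>N. \<integral>w. real (Us N w) ^ r \<partial>Ms N) \<longlonglongrightarrow> (\<integral>w. real (U w) ^ r \<partial>M)"
    by (rule expectation_tendsto[OF B])
qed

text \<open>The bound |q^k| \<le> \<rho>^k has the constant 1 for all q in the disc, hence
  \<open>discrepancy\<close> bounds the difference uniformly.\<close>

lemma pgf_uniform_limit:
  "uniform_limit (cball 0 \<rho>) (\<lambda>N. pgf (Ms N) (Us N)) (pgf M U) sequentially"
proof (rule uniform_limitI)
  fix e :: real assume "e > 0"
  with discrepancy_tendsto have "\<forall>\<^sub>F N in sequentially. discrepancy N < e" by (rule order_tendstoD)
  with tail show "\<forall>\<^sub>F N in sequentially. \<forall>q\<in>cball 0 \<rho>. dist (pgf (Ms N) (Us N) q) (pgf M U q) < e"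
  proof eventually_elim
    case (elim N)
    show ?case
    proof
      fix q :: complex assume "q \<in> cball 0 \<rho>"
      then have "norm (q ^ k) \<le> 1 * \<rho> ^ k" for k by (simp add: norm_power power_mono)
      from expectation_diff_le[OF elim(1) this] elim(2)
      show "dist (pgf (Ms N) (Us N) q) (pgf M U q) < e" by (simp add: pgf_def dist_norm)
    qed
  qed
qed

end

text \<open>An interchange of limits: for fixed L the approximations converge, and their distance to
  both sequence and limit is at most \<epsilon>(L), with L chosen last to make this small.\<close>

lemma tendsto_of_approximations:
  fixes x :: "nat \<Rightarrow> real" and t :: "nat \<Rightarrow> nat \<Rightarrow> real"
  assumes t: "\<And>L. L \<ge> k \<Longrightarrow> t L \<longlonglongrightarrow> \<tau> L"
    and x: "\<And>L. L \<ge> k \<Longrightarrow> eventually (\<lambda>N. \<bar>x N - t L N\<bar> \<le> \<epsilon> L) sequentially"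
    and y: "\<And>L. L \<ge> k \<Longrightarrow> \<bar>y - \<tau> L\<bar> \<le> \<epsilon> L"
    and \<epsilon>: "\<epsilon> \<longlonglongrightarrow> 0"
  shows "x \<longlonglongrightarrow> y"
proof (rule tendstoI)
  fix e :: real assume e: "e > 0"
  have "eventually (\<lambda>L. \<epsilon> L < e / 3) sequentially"
    using \<epsilon> e by (intro order_tendstoD(2)) auto
  then have "eventually (\<lambda>L. L \<ge> k \<and> \<epsilon> L < e / 3) sequentially"
    using eventually_ge_at_top[of k] by eventually_elim simp
  then obtain L where L: "L \<ge> k" "\<epsilon> L < e / 3" by (auto simp: eventually_sequentially)
  have "eventually (\<lambda>N. dist (t L N) (\<tau> L) < e / 3) sequentially"
    using t[OF L(1)] e by (intro tendstoD) auto
  with x[OF L(1)] show "eventually (\<lambda>N. dist (x N) y < e) sequentially"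
  proof eventually_elim
    case (elim N)
    then show ?case using y[OF L(1)] L(2) unfolding dist_real_def by linarith
  qed
qed

text \<open>For mean load x b the Chernoff ratio is minimal at z = 1/x, with value (x e^(1-x))^b.
  That this is the reciprocal of \<open>zeta_radius\<close> ties the probabilistic tail to the disc
  of the formula.\<close>

lemma chernoff_at_inverse:
  assumes "x > 0"
  shows "exp (x * real b * (1 / x - 1)) / (1 / x) ^ b = 1 / zeta_radius b x"
proof -
  have "exp (x * real b * (1 / x - 1)) = exp (1 - x) ^ b"
    using assms by (simp add: field_simps flip: exp_of_nat_mult)
  moreover have "exp (1 - x) * exp (x - 1) = 1" by (simp flip: exp_add)
  then have "exp (1 - x) = 1 / exp (x - 1)" by (simp add: field_simps)
  ultimately show ?thesis by (simp add: zeta_radius_def power_divide)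
qed

lemma poisson_model_imp_poisson_counts:
  assumes "poisson_model b \<alpha> M X" "b \<ge> 1" "\<alpha> > 0"
  shows "poisson_counts M X (\<alpha> * real b)"
  using assms by (auto simp: poisson_model_def poisson_counts_def poisson_counts_axioms_def)

text \<open>For every L the pattern probabilities converge to their Poisson values; the localisation
  error common to both models vanishes as L grows. The starting bucket may change with N.\<close>

lemma (in poisson_counts) U_exact_prob_tendsto:
  fixes m n s :: "nat \<Rightarrow> nat"
  assumes m: "filterlim m at_top sequentially" and n: "filterlim n at_top sequentially"
    and ratio: "(\<lambda>N. real (n N) / real (m N)) \<longlonglongrightarrow> r"
    and less: "\<And>N. n N < b * m N"
    and z: "z \<ge> 1" and \<phi>: "exp (r * (z - 1)) / z ^ b \<le> \<phi>" "\<phi> < 1"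
    and ev: "eventually (\<lambda>N. exp ((z - 1) * (n N / m N)) / z ^ b \<le> \<phi>) sequentially"
  shows "(\<lambda>N. measure_pmf.prob (hash_pmf (m N) (n N)) {h. U_exact b (m N) (n N) (s N) h = k})
    \<longlonglongrightarrow> prob {w \<in> space M. first_nonfull b (\<lambda>i. X i w) = k}"
proof -
  have "exp (r * (z - 1)) / z ^ b \<ge> 0" using z by simp
  then have \<phi>0: "\<phi> \<ge> 0" using \<phi> by linarith
  let ?g = "\<lambda>N t. nat ((int (s N) + (int k - int t)) mod int (m N))"
  let ?t = "\<lambda>L N. \<Sum>a\<in>local_run_counts b L k. measure_pmf.prob (hash_pmf (m N) (n N))
    {h. \<forall>t\<in>{..<L}. key_count (n N) h (?g N t) = a t}"
  show ?thesis
  proof (rule tendsto_of_approximations[where k = k and t = ?t and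
        \<epsilon> = "\<lambda>L. real (Suc k) * (\<phi> ^ Suc (L - k) / (1 - \<phi>))" and
        \<tau> = "\<lambda>L. \<Sum>a\<in>local_run_counts b L k. \<Prod>t<L. pmf (poisson_pmf r) (a t)"])
    fix L assume L: "L \<ge> k"
    have m_ge: "eventually (\<lambda>N. c \<le> m N) sequentially" for c
      using m unfolding filterlim_at_top by blast
    show "?t L \<longlonglongrightarrow> (\<Sum>a\<in>local_run_counts b L k. \<Prod>t<L. pmf (poisson_pmf r) (a t))"
    proof (intro tendsto_sum prob_key_counts_tendsto m n ratio r_pos finite_lessThan)
      show "eventually (\<lambda>N. inj_on (?g N) {..<L} \<and> ?g N ` {..<L} \<subseteq> {..<m N}) sequentially"
        using m_ge[of L] m_ge[of 1]
      proof eventually_elim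
        case (elim N)
        then have "?g N t < m N" for t by (intro cyclic_address_less) simp
        then show ?case using cyclic_address_inj[OF elim(1)] by auto
      qed
    qed
    show "eventually (\<lambda>N. \<bar>measure_pmf.prob (hash_pmf (m N) (n N)) {h. U_exact b (m N) (n N) (s N) h = k} - ?t L N\<bar>
        \<le> real (Suc k) * (\<phi> ^ Suc (L - k) / (1 - \<phi>))) sequentially"
      using m_ge[of L] ev by eventually_elim (rule hash_local_run_approx[OF less z _ \<phi>(2) L])
    show "\<bar>prob {w \<in> space M. first_nonfull b (\<lambda>i. X i w) = k} -
        (\<Sum>a\<in>local_run_counts b L k. \<Prod>t<L. pmf (poisson_pmf r) (a t))\<bar>
        \<le> real (Suc k) * (\<phi> ^ Suc (L - k) / (1 - \<phi>))"
      by (rule prob_local_run_approx[OF z \<phi> L])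
  next
    have "(\<lambda>L. \<phi> ^ Suc L) \<longlonglongrightarrow> 0"
      using \<phi>0 \<phi> by (intro LIMSEQ_Suc LIMSEQ_realpow_zero) auto
    then have "(\<lambda>L. real (Suc k) * (\<phi> ^ Suc (L + k - k) / (1 - \<phi>))) \<longlonglongrightarrow> real (Suc k) * (0 / (1 - \<phi>))"
      using \<phi> by (intro tendsto_intros) auto
    then show "(\<lambda>L. real (Suc k) * (\<phi> ^ Suc (L - k) / (1 - \<phi>))) \<longlonglongrightarrow> 0"
      using LIMSEQ_offset[where k = k and f = "\<lambda>L. real (Suc k) * (\<phi> ^ Suc (L - k) / (1 - \<phi>))"] by simp
  qed
qed

theorem theorem11p2:
  fixes b :: nat and \<alpha> :: real and M :: "'w measure" and X :: "int \<Rightarrow> 'w \<Rightarrow> nat"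
  assumes "b \<ge> 1" and "0 < \<alpha>" and "\<alpha> < 1"
    and "poisson_model b \<alpha> M X"
  shows "(AE w in M. \<exists>k::nat. \<not> full_bucket b X w (int k)) \<and>
    U_inf b X \<in> measurable M (count_space UNIV) \<and>
    (\<forall>q::complex. norm q \<le> zeta_radius b \<alpha> \<longrightarrow>
       integrable M (\<lambda>w. q ^ U_inf b X w) \<and>
       (q \<noteq> 1 \<longrightarrow> pgf M (U_inf b X) q = psi_formula b \<alpha> q)) \<and>
    (psi_formula b \<alpha> \<longlongrightarrow> pgf M (U_inf b X) 1) (at 1) \<and>
    (\<exists>\<delta>>0. 1 + \<delta> \<le> zeta_radius b \<alpha> \<and>
      (\<forall>m n s :: nat \<Rightarrow> nat.
         filterlim m at_top sequentially \<and> filterlim n at_top sequentially \<and>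
         (\<lambda>k. real (n k) / (real b * real (m k))) \<longlonglongrightarrow> \<alpha> \<and>
         (\<forall>k. n k < b * m k \<and> s k < m k) \<longrightarrow>
         weak_conv_m
           (\<lambda>k. distr (measure_pmf (hash_pmf (m k) (n k))) borel
                  (\<lambda>h. real (U_exact b (m k) (n k) (s k) h)))
           (distr M borel (\<lambda>w. real (U_inf b X w))) \<and>
         (\<forall>r::nat. integrable M (\<lambda>w. real (U_inf b X w) ^ r) \<and>
           (\<lambda>k. \<integral>h. real (U_exact b (m k) (n k) (s k) h) ^ r \<partial>measure_pmf (hash_pmf (m k) (n k)))
             \<longlonglongrightarrow> (\<integral>w. real (U_inf b X w) ^ r \<partial>M)) \<and>
         uniform_limit (cball 0 (1 + \<delta>))
           (\<lambda>k. pgf (measure_pmf (hash_pmf (m k) (n k))) (U_exact b (m k) (n k) (s k)))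
           (pgf M (U_inf b X)) sequentially))"
proof -
  note b = assms(1) and \<alpha> = assms(2,3)
  interpret poisson_counts M X "\<alpha> * real b"
    by (rule poisson_model_imp_poisson_counts) (use assms in auto)
  define U where "U = (\<lambda>w. first_nonfull b (\<lambda>i. X i w))"
  have U_inf: "U_inf b X = U" by (simp add: fun_eq_iff U_def U_inf_eq_first_nonfull)
  have U_meas [measurable]: "U \<in> M \<rightarrow>\<^sub>M count_space UNIV" unfolding U_def by measurable
  define p where "p = (\<lambda>k. prob {w \<in> space M. U w = k})"
  define R where "R = zeta_radius b \<alpha>"
  have R: "R > 1" unfolding R_def by (rule zeta_radius_gt_1(2)[OF b \<alpha>])
  have z: "1 / \<alpha> \<ge> 1" and chernoff: "exp (\<alpha> * real b * (1 / \<alpha> - 1)) / (1 / \<alpha>) ^ b \<le> 1 / R" "1 / R < 1"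
    using \<alpha> R chernoff_at_inverse[OF \<alpha>(1), of b] by (simp_all add: R_def)
  have AE: "AE w in M. \<exists>k. \<not> full b (\<lambda>i. X i w) (int k)"
    by (rule AE_nonfull[OF z chernoff])
  define p0 where "p0 = prob {w \<in> space M. \<not> full b (\<lambda>i. X i w) 0}"
  have p_eq: "p k = p0 * stay_prob b (pmf (poisson_pmf (\<alpha> * real b))) k" for k
    unfolding p_def p0_def U_def by (rule prob_first_nonfull[OF AE])
  have p_nonneg: "p k \<ge> 0" for k by (simp add: p_def)
  have p_sums: "p sums 1"
  proof -
    have "(\<lambda>k. prob {w \<in> space M. U w = k}) sums prob (\<Union>k. {w \<in> space M. U w = k})"
      by (rule finite_measure_UNION) (auto simp: disjoint_family_on_def)
    moreover have "(\<Union>k. {w \<in> space M. U w = k}) = space M" by auto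
    ultimately show ?thesis by (simp add: p_def prob_space)
  qed
  \<comment> \<open>The optimal tilt 1/\<alpha> is essential here: its ratio 1/R makes the series
    converge in the full open disc of the formula.\<close>
  have p_le: "p k \<le> 1 / (1 - 1 / R) * (1 / zeta_radius b \<alpha>) ^ k" for k
  proof -
    have "p k \<le> prob {w \<in> space M. \<forall>i<k. full b (\<lambda>i. X i w) (int i)}"
      unfolding p_def U_def prob_first_nonfull_eq[OF AE] by (intro finite_measure_mono) auto
    also have "\<dots> \<le> (1 / R) ^ k / (1 - 1 / R)" by (rule full_run_tail[OF z chernoff])
    finally show ?thesis by (simp add: R_def)
  qed
  note gf = b \<alpha> p_eq p_nonneg p_sums p_le

  have int_q: "integrable M (\<lambda>w. q ^ U w)" if "norm q \<le> R" for q :: complex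
  proof -
    have "summable (\<lambda>k. p k * norm q ^ k)"
      by (rule summable_pgf_series_le[OF gf]) (use that in \<open>simp add: R_def\<close>)
    then show ?thesis
      unfolding nat_rv_integral(1)[OF U_meas prob_space_axioms] norm_power p_def .
  qed
  have pgf_eq: "pgf M U q = pgf_series p q" if "norm q \<le> R" for q
    unfolding pgf_def nat_rv_integral(2)[OF U_meas prob_space_axioms int_q[OF that]]
    by (simp add: pgf_series_def p_def scaleR_conv_of_real)
  have formula: "pgf M U q = psi_formula b \<alpha> q" if "norm q \<le> R" "q \<noteq> 1" for q
    unfolding pgf_eq[OF that(1)]
    by (rule pgf_series_eq_psi_formula[OF gf]) (use that in \<open>simp_all add: R_def\<close>)
  have at_1: "(psi_formula b \<alpha> \<longlongrightarrow> pgf M U 1) (at 1)"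
    using psi_formula_tendsto[OF gf] pgf_eq[of 1] R by simp

  \<comment> \<open>Any load strictly between \<alpha> and 1 would do: the loads of the tables lie
    below it eventually, which gives them a common tail ratio \<phi> with the tilt that is optimal
    for \<beta>.\<close>
  define \<beta> where "\<beta> = (1 + \<alpha>) / 2"
  have \<beta>: "0 < \<beta>" "\<beta> < 1" "\<alpha> < \<beta>" using \<alpha> by (auto simp: \<beta>_def)
  define \<phi> where "\<phi> = 1 / zeta_radius b \<beta>"
  define z where "z = 1 / \<beta>"
  have z: "z \<ge> 1" using \<beta> by (simp add: z_def)
  have \<phi>: "0 \<le> \<phi>" "\<phi> < 1" using zeta_radius_gt_1(2)[OF b \<beta>(1,2)] by (simp_all add: \<phi>_def)
  have chernoff_le: "exp ((z - 1) * x) / z ^ b \<le> \<phi>" if "x \<le> \<beta> * real b" for x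
  proof -
    have "exp ((z - 1) * x) / z ^ b \<le> exp ((z - 1) * (\<beta> * real b)) / z ^ b"
      using that z by (intro divide_right_mono iffD2[OF exp_le_cancel_iff] mult_left_mono) auto
    also have "\<dots> = \<phi>" using chernoff_at_inverse[OF \<beta>(1), of b] by (simp add: \<phi>_def z_def mult.commute)
    finally show ?thesis .
  qed
  have chernoff_\<alpha>: "exp (\<alpha> * real b * (z - 1)) / z ^ b \<le> \<phi>"
    using chernoff_le[of "\<alpha> * real b"] \<beta> by (simp add: mult.commute mult_right_mono)
  \<comment> \<open>Below R, the closed disc of radius \<rho> lies where the formula holds; below
    \<open>zeta_radius b \<beta>\<close>, which is 1/\<phi>, the weights \<rho>^k are beaten by the
    tails. The \<delta> of the theorem is \<rho> - 1.\<close>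
  obtain \<rho> where \<rho>: "1 < \<rho>" "\<rho> < min R (zeta_radius b \<beta>)"
    using dense[of 1 "min R (zeta_radius b \<beta>)"] R zeta_radius_gt_1(2)[OF b \<beta>(1,2)] by auto
  have \<rho>\<phi>: "\<rho> * \<phi> < 1" using \<rho> by (simp add: \<phi>_def divide_simps)

  have main: "weak_conv_m (\<lambda>k. distr (measure_pmf (hash_pmf (m k) (n k))) borel (\<lambda>h. real (U_exact b (m k) (n k) (s k) h)))
        (distr M borel (\<lambda>w. real (U w)))"
      "integrable M (\<lambda>w. real (U w) ^ r)"
      "(\<lambda>k. \<integral>h. real (U_exact b (m k) (n k) (s k) h) ^ r \<partial>measure_pmf (hash_pmf (m k) (n k)))
         \<longlonglongrightarrow> (\<integral>w. real (U w) ^ r \<partial>M)"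
      "uniform_limit (cball 0 \<rho>) (\<lambda>k. pgf (measure_pmf (hash_pmf (m k) (n k))) (U_exact b (m k) (n k) (s k)))
         (pgf M U) sequentially"
    if m: "filterlim m at_top sequentially" and n: "filterlim n at_top sequentially"
      and ratio: "(\<lambda>k. real (n k) / (real b * real (m k))) \<longlonglongrightarrow> \<alpha>"
      and less: "\<And>k. n k < b * m k" for m n s :: "nat \<Rightarrow> nat" and r
  proof -
    have "eventually (\<lambda>k. real (n k) / (real b * real (m k)) < \<beta>) sequentially"
      using ratio \<beta>(3) by (rule order_tendstoD)
    then have ev: "eventually (\<lambda>k. exp ((z - 1) * (n k / m k)) / z ^ b \<le> \<phi>) sequentially"
    proof eventually_elim
      case (elim k)
      have "n k / m k = n k / (b * m k) * b" using b by simp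
      also have "\<dots> \<le> \<beta> * b" using elim by (intro mult_right_mono) auto
      finally show ?case by (rule chernoff_le)
    qed
    have ratio': "(\<lambda>k. real (n k) / real (m k)) \<longlonglongrightarrow> \<alpha> * real b"
      using tendsto_mult_right[OF ratio, of "real b"] b by simp
    have lim: "(\<lambda>N. measure (hash_pmf (m N) (n N)) {h \<in> space (hash_pmf (m N) (n N)). U_exact b (m N) (n N) (s N) h = k})
        \<longlonglongrightarrow> measure M {w \<in> space M. U w = k}" for k
      using U_exact_prob_tendsto[OF m n ratio' less z chernoff_\<alpha> \<phi>(2) ev, of s k] by (simp add: U_def)
    have tail: "eventually (\<lambda>N. \<forall>k. measure (hash_pmf (m N) (n N))
        {h \<in> space (hash_pmf (m N) (n N)). U_exact b (m N) (n N) (s N) h = k} \<le> 1 / (1 - \<phi>) * \<phi> ^ k) sequentially"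
      using ev
    proof eventually_elim
      case (elim N)
      then show ?case using hash_U_tail[OF less z _ \<phi>(2)] by simp
    qed
    show "weak_conv_m (\<lambda>k. distr (measure_pmf (hash_pmf (m k) (n k))) borel (\<lambda>h. real (U_exact b (m k) (n k) (s k) h)))
        (distr M borel (\<lambda>w. real (U w)))"
      by (rule weak_conv_of_tail[OF _ _ prob_space_axioms U_meas lim tail \<phi>(1) \<rho>(1) \<rho>\<phi>]) (auto intro: measure_pmf.prob_space_axioms)
    show "integrable M (\<lambda>w. real (U w) ^ r)"
      by (rule moments_of_tail(1)[OF _ _ prob_space_axioms U_meas lim tail \<phi>(1) \<rho>(1) \<rho>\<phi>]) (auto intro: measure_pmf.prob_space_axioms)
    show "(\<lambda>k. \<integral>h. real (U_exact b (m k) (n k) (s k) h) ^ r \<partial>measure_pmf (hash_pmf (m k) (n k)))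
         \<longlonglongrightarrow> (\<integral>w. real (U w) ^ r \<partial>M)"
      by (rule moments_of_tail(2)[OF _ _ prob_space_axioms U_meas lim tail \<phi>(1) \<rho>(1) \<rho>\<phi>]) (auto intro: measure_pmf.prob_space_axioms)
    show "uniform_limit (cball 0 \<rho>) (\<lambda>k. pgf (measure_pmf (hash_pmf (m k) (n k))) (U_exact b (m k) (n k) (s k)))
         (pgf M U) sequentially"
      by (rule pgf_uniform_limit[OF _ _ prob_space_axioms U_meas lim tail \<phi>(1) \<rho>(1) \<rho>\<phi>]) (auto intro: measure_pmf.prob_space_axioms)
  qed

  show ?thesis
    unfolding U_inf full_bucket_iff_full
  proof (intro conjI)
    show "\<exists>\<delta>>0. 1 + \<delta> \<le> zeta_radius b \<alpha> \<and>
      (\<forall>m n s :: nat \<Rightarrow> nat.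
         filterlim m at_top sequentially \<and> filterlim n at_top sequentially \<and>
         (\<lambda>k. real (n k) / (real b * real (m k))) \<longlonglongrightarrow> \<alpha> \<and>
         (\<forall>k. n k < b * m k \<and> s k < m k) \<longrightarrow>
         weak_conv_m
           (\<lambda>k. distr (measure_pmf (hash_pmf (m k) (n k))) borel
                  (\<lambda>h. real (U_exact b (m k) (n k) (s k) h)))
           (distr M borel (\<lambda>w. real (U w))) \<and>
         (\<forall>r::nat. integrable M (\<lambda>w. real (U w) ^ r) \<and>
           (\<lambda>k. \<integral>h. real (U_exact b (m k) (n k) (s k) h) ^ r \<partial>measure_pmf (hash_pmf (m k) (n k)))
             \<longlonglongrightarrow> (\<integral>w. real (U w) ^ r \<partial>M)) \<and>
         uniform_limit (cball 0 (1 + \<delta>))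
           (\<lambda>k. pgf (measure_pmf (hash_pmf (m k) (n k))) (U_exact b (m k) (n k) (s k)))
           (pgf M U) sequentially)"
    proof (intro exI[of _ "\<rho> - 1"] conjI allI impI; (elim conjE)?)
      fix m n s :: "nat \<Rightarrow> nat"
      assume m: "filterlim m at_top sequentially" and n: "filterlim n at_top sequentially"
        and ratio: "(\<lambda>k. real (n k) / (real b * real (m k))) \<longlonglongrightarrow> \<alpha>"
        and "\<forall>k. n k < b * m k \<and> s k < m k"
      then have less: "n k < b * m k" for k by blast
      note conv = main[OF m n ratio less]
      show "weak_conv_m (\<lambda>k. distr (measure_pmf (hash_pmf (m k) (n k))) borel (\<lambda>h. real (U_exact b (m k) (n k) (s k) h)))
          (distr M borel (\<lambda>w. real (U w)))" by (rule conv(1))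
      show "integrable M (\<lambda>w. real (U w) ^ r)" for r by (rule conv(2))
      show "(\<lambda>k. \<integral>h. real (U_exact b (m k) (n k) (s k) h) ^ r \<partial>measure_pmf (hash_pmf (m k) (n k)))
         \<longlonglongrightarrow> (\<integral>w. real (U w) ^ r \<partial>M)" for r by (rule conv(3))
      show "uniform_limit (cball 0 (1 + (\<rho> - 1)))
         (\<lambda>k. pgf (measure_pmf (hash_pmf (m k) (n k))) (U_exact b (m k) (n k) (s k))) (pgf M U) sequentially"
        using conv(4) by simp
    qed (use \<rho> in \<open>simp_all add: R_def\<close>)
  qed (use AE U_meas int_q formula at_1 in \<open>auto simp: R_def\<close>)
qed

end
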